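(* For every $\varepsilon>0$ there exist $\theta,a,\delta,\delta_2\in(0,1)$ (with $\theta,a$ sufficiently close to $1$ and $\delta,\delta_2$ sufficiently close to $0$) and $\beta,\gamma,b_0>0$ sufficiently large such that, if $b\ge b_0$, $$\sup_{B\in\mathcal F}\bigl|\hat P_0(B)-P_0^*(B)\bigr|\le\varepsilon ,$$ where $\mathcal F=\sigma\bigl(\bigcup_{n=0}^\infty\sigma\{S_k: 0\le k\le n\}\bigr)$, $P_0^*$ is the law of the random walk started at $0$ conditioned on ever hitting $bA^*$, and $\hat P_0$ is the approximating law (depending on $b,\theta,a,\delta,\delta_2,\beta,\gamma$) defined in the context.
   Context: Random walk. $X,X_1,X_2,\dots$ are i.i.d. random vectors in $\mathbb R^d$ with a continuous distribution and mean $EX=\eta=-(1,\dots,1)^T$. $X$ is multivariate regularly varying with index $\alpha>1$: $P(\|X\|_2>b)=b^{-\alpha}L(b)$ with $L$ slowly varying, and there is a non-null Radon measure $\mu$ on $\overline{\mathbb R}^d\setminus\{0\}$ with $\mu(\overline{\mathbb R}^d\setminus\mathbb R^d)=0$ such that $P(X\in b\,\cdot)/P(\|X\|_2>b)\to\mu(\cdot)$ vaguely as $b\to\infty$. $S_n=S_0+X_1+\cdots+X_n$, and $P_s$ is the law of $S=(S_n)_{n\ge0}$ with $S_0=s$. Target set. $v_1^*,\dots,v_m^*\in\mathbb R^d$ and $a_1^*,\dots,a_m^*>0$ are fixed with $\eta^Tv_j^*=-1$ for each $j$; $A^*=\bigcup_{j=1}^m\{y: y^Tv_j^*>a_j^*\}$;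 it is assumed that $\mu(A^* )>0$. For a set $C\subset\mathbb R^d$ and $b>0$, $bC=\{bx:x\in C\}$ and $T_{bC}=\inf\{n\ge0: S_n\in bC\}$. $P_s^*(S\in\cdot)=P(S\in\cdot\mid T_{bA^*}<\infty,S_0=s)$. Enlarged set. For $\delta\in(0,1)$, $\beta>0$, put $v_j=v_j^*$, $a_j=a_j^*$ for $1\le j\le m$; $v_{m+j}=(v_j^*+\delta\eta/\|\eta\|_2^2)/(1-\delta)$, $a_{m+j}=a_j^*$ for $1\le j\le m$; $v_{2m+i}=e_i$ (standard basis vector), $a_{2m+i}=\beta$ for $1\le i\le d$. Then $A=\bigcup_{j=1}^{2m+d}\{y:y^Tv_j>a_j\}$, $r_b(z)=\max_{1\le j\le 2m+d}(z^Tv_j-a_jb)$, $v_b(s)=\int_0^\infty P(X+t\eta+s\in bA)\,dt=E[r_b(s+X)^+]$. For $\gamma>0$, $\Gamma=\{y:y^T\eta\ge\gamma\}$. Approximating law. For $a,\theta,\delta_2\in(0,1)$ let $A_{b,a}(s)=\{s_1:\max_{1\le j\le 2m+d}[(s_1-s)^Tv_j-a(a_jb-s^Tv_j)]>0\}$, $p_b(s)=\min\bigl(\theta P(s+X\in A_{b,a}(s))/v_b(s),\,1\bigr)\,I(r_b(s)\le-\delta_2b)$, and $$\hat K(s_0,ds_1)=P(X+s_0\in ds_1)\Bigl\{\frac{p_b(s_0)\,I(s_1\in A_{b,a}(s_0))}{P(s_0+X\in A_{b,a}(s_0))}+(1-p_b(s_0))\Bigr\}.$$ $\hat P_s$ is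 the law of the process on path space started at $s$ whose transitions follow $\hat K$ up to time $T_{bA}\wedge T_{b\Gamma}$ and follow the original random walk kernel $K(s_0,ds_1)=P(X+s_0\in ds_1)$ for all increments from $T_{bA}\wedge T_{b\Gamma}+1$ on. *)

theory Defs
  imports "HOL-Probability.Probability"
begin

definition eta :: "real^'d" where
  "eta = (\<chi> i. - 1)"

text \<open>
  The compactification of \<open>real^'d\<close> is \<open>ereal^'d\<close> with the product topology. A measure on the
  punctured space is a measure on \<open>restrict_space borel (- {0})\<close>. That space is locally compact
  with a countable base, so a Borel measure on it is Radon iff it is finite on compact sets.
\<close>

definition emb :: "real^'d \<Rightarrow> ereal^'d" where
  "emb x = (\<chi> i. ereal (x $ i))"

definition punctured_radon :: "(ereal^'d) measure \<Rightarrow> bool" where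
  "punctured_radon \<mu> \<longleftrightarrow>
     sets \<mu> = sets (restrict_space borel (- {0})) \<and>
     (\<forall>C. compact C \<and> 0 \<notin> C \<longrightarrow> emeasure \<mu> C < \<infinity>)"

text \<open>
  Test functions of vague convergence: continuous functions with compact support in the punctured
  space. They vanish near \<open>0\<close>, so they are taken as functions on the whole of \<open>ereal^'d\<close>.
\<close>

definition punctured_test :: "(ereal^'d \<Rightarrow> real) \<Rightarrow> bool" where
  "punctured_test f \<longleftrightarrow>
     continuous_on UNIV f \<and> (\<exists>C. compact C \<and> 0 \<notin> C \<and> (\<forall>y. y \<notin> C \<longrightarrow> f y = 0))"

definition slowly_varying :: "(real \<Rightarrow> real) \<Rightarrow> bool" where
  "slowly_varying L \<longleftrightarrow> (\<forall>c>0. ((\<lambda>b. L (c * b) / L b) \<longlongrightarrow> 1) at_top)"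

definition mv_regularly_varying ::
    "(real^'d) measure \<Rightarrow> real \<Rightarrow> (ereal^'d) measure \<Rightarrow> bool" where
  "mv_regularly_varying D \<alpha> \<mu> \<longleftrightarrow>
     (\<exists>L. slowly_varying L \<and>
        (\<forall>b>0. \<P>(x in D. norm x > b) = b powr (- \<alpha>) * L b)) \<and>
     punctured_radon \<mu> \<and>
     emeasure \<mu> (space \<mu>) \<noteq> 0 \<and>
     emeasure \<mu> (space \<mu> - range emb) = 0 \<and>
     (\<forall>f. punctured_test f \<longrightarrow>
        ((\<lambda>b. (\<integral>x. f (emb (x /\<^sub>R b)) \<partial>D) / \<P>(x in D. norm x > b)) \<longlongrightarrow> (\<integral>y. f y \<partial>\<mu>)) at_top)"

text \<open>The random walk; \<open>D\<close> is the law of an increment.\<close>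

definition path_space :: "(nat \<Rightarrow> real^'d) measure" where
  "path_space = (\<Pi>\<^sub>M n\<in>UNIV. borel)"

definition walk_law :: "(real^'d) measure \<Rightarrow> real^'d \<Rightarrow> (nat \<Rightarrow> real^'d) measure" where
  "walk_law D s = distr (\<Pi>\<^sub>M n\<in>(UNIV::nat set). D) path_space (\<lambda>x n. s + (\<Sum>i<n. x i))"

definition hit_time :: "'a set \<Rightarrow> (nat \<Rightarrow> 'a) \<Rightarrow> enat" where
  "hit_time C S = (INF n\<in>{n. S n \<in> C}. enat n)"

definition dilate :: "real \<Rightarrow> (real^'d) set \<Rightarrow> (real^'d) set" where
  "dilate b C = (\<lambda>x. b *\<^sub>R x) ` C"

definition cond_walk_law ::
    "(real^'d) measure \<Rightarrow> (real^'d) set \<Rightarrow> real^'d \<Rightarrow> (nat \<Rightarrow> real^'d) measure" where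
  "cond_walk_law D C s =
     uniform_measure (walk_law D s) {S \<in> space (walk_law D s). hit_time C S < \<infinity>}"

text \<open>
  Finite families \<open>v\<close>, \<open>a\<close> of normals and levels over an arbitrary finite index type. The enlarged
  families are indexed by \<open>'m + 'm + 'd\<close>: the original ones, the tilted ones, the coordinate ones.
\<close>

definition halfspaces :: "('j::finite \<Rightarrow> real^'d) \<Rightarrow> ('j \<Rightarrow> real) \<Rightarrow> (real^'d) set" where
  "halfspaces v a = (\<Union>j. {y. y \<bullet> v j > a j})"

definition enlarged_normals ::
    "real \<Rightarrow> ('m \<Rightarrow> real^'d) \<Rightarrow> 'm + 'm + 'd \<Rightarrow> real^'d" where
  "enlarged_normals \<delta> v k = (case k of
       Inl j \<Rightarrow> v j
     | Inr (Inl j) \<Rightarrow> (v j + (\<delta> / (norm (eta :: real^'d))\<^sup>2) *\<^sub>R eta) /\<^sub>R (1 - \<delta>)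
     | Inr (Inr i) \<Rightarrow> axis i 1)"

definition enlarged_levels :: "real \<Rightarrow> ('m \<Rightarrow> real) \<Rightarrow> 'm + 'm + 'd \<Rightarrow> real" where
  "enlarged_levels \<beta> a k = (case k of
       Inl j \<Rightarrow> a j
     | Inr (Inl j) \<Rightarrow> a j
     | Inr (Inr i) \<Rightarrow> \<beta>)"

definition rfun ::
    "real \<Rightarrow> ('j::finite \<Rightarrow> real^'d) \<Rightarrow> ('j \<Rightarrow> real) \<Rightarrow> real^'d \<Rightarrow> real" where
  "rfun b v a z = (MAX j. z \<bullet> v j - a j * b)"

definition vfun ::
    "(real^'d) measure \<Rightarrow> real \<Rightarrow> ('j::finite \<Rightarrow> real^'d) \<Rightarrow> ('j \<Rightarrow> real) \<Rightarrow> real^'d \<Rightarrow> real" where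
  "vfun D b v a s =
     (LINT t:{0..}|lborel. \<P>(x in D. x + t *\<^sub>R eta + s \<in> dilate b (halfspaces v a)))"

definition jump_set ::
    "real \<Rightarrow> real \<Rightarrow> ('j::finite \<Rightarrow> real^'d) \<Rightarrow> ('j \<Rightarrow> real) \<Rightarrow> real^'d \<Rightarrow> (real^'d) set" where
  "jump_set b c v a s = {s1. (MAX j. (s1 - s) \<bullet> v j - c * (a j * b - s \<bullet> v j)) > 0}"

definition walk_kernel :: "(real^'d) measure \<Rightarrow> real^'d \<Rightarrow> (real^'d) measure" where
  "walk_kernel D s0 = distr D borel (\<lambda>x. x + s0)"

text \<open>
  In both quotients below the numerator vanishes whenever \<open>measure (walk_kernel D s) (jump_set b c v a s)\<close>
  does, so that then \<open>pfun = 0\<close> and \<open>mixed_kernel\<close> is \<open>walk_kernel\<close>. If the measure of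
  \<open>halfspaces v a\<close> under the limit measure of \<open>D\<close> is positive, then \<open>vfun\<close> is positive.
\<close>

definition pfun ::
    "(real^'d) measure \<Rightarrow> real \<Rightarrow> real \<Rightarrow> real \<Rightarrow> real \<Rightarrow>
     ('j::finite \<Rightarrow> real^'d) \<Rightarrow> ('j \<Rightarrow> real) \<Rightarrow> real^'d \<Rightarrow> real" where
  "pfun D b \<theta> c \<delta>2 v a s =
     min (\<theta> * measure (walk_kernel D s) (jump_set b c v a s) / vfun D b v a s) 1
     * (if rfun b v a s \<le> - \<delta>2 * b then 1 else 0)"

definition mixed_kernel ::
    "(real^'d) measure \<Rightarrow> real \<Rightarrow> real \<Rightarrow> real \<Rightarrow> real \<Rightarrow>
     ('j::finite \<Rightarrow> real^'d) \<Rightarrow> ('j \<Rightarrow> real) \<Rightarrow> real^'d \<Rightarrow> (real^'d) measure" where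
  "mixed_kernel D b \<theta> c \<delta>2 v a s0 =
     density (walk_kernel D s0) (\<lambda>s1. ennreal (
       pfun D b \<theta> c \<delta>2 v a s0 * indicator (jump_set b c v a s0) s1
         / measure (walk_kernel D s0) (jump_set b c v a s0)
       + (1 - pfun D b \<theta> c \<delta>2 v a s0)))"

text \<open>
  The kernel at step \<open>Suc n\<close> gives \<open>S (Suc n)\<close> from \<open>S 0, \<dots>, S n\<close>. It depends on the history only
  through \<open>S n\<close> and through whether a target was hit by time \<open>n\<close>; the latter is not affected by the
  values of the argument \<open>S\<close> at indices larger than \<open>n\<close>.
\<close>

definition step_kernel ::
    "(real^'d) measure \<Rightarrow> real \<Rightarrow> real \<Rightarrow> real \<Rightarrow> real \<Rightarrow>
     ('j::finite \<Rightarrow> real^'d) \<Rightarrow> ('j \<Rightarrow> real) \<Rightarrow> (real^'d) set \<Rightarrow> real^'d \<Rightarrow>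
     nat \<Rightarrow> (nat \<Rightarrow> real^'d) \<Rightarrow> (real^'d) measure" where
  "step_kernel D b \<theta> c \<delta>2 v a G s k S = (case k of
       0 \<Rightarrow> return borel s
     | Suc n \<Rightarrow>
         if enat n < min (hit_time (dilate b (halfspaces v a)) S) (hit_time (dilate b G) S)
         then mixed_kernel D b \<theta> c \<delta>2 v a (S n)
         else walk_kernel D (S n))"

text \<open>The law on path space with these successive kernels, by the Ionescu-Tulcea theorem, whose
  hypotheses (locale \<open>Ionescu_Tulcea\<close>) hold for \<open>b > 0\<close>, \<open>\<theta> \<ge> 0\<close>, Borel \<open>G\<close> and \<open>D\<close> a Borel probability measure.\<close>

definition approx_law ::
    "(real^'d) measure \<Rightarrow> real \<Rightarrow> real \<Rightarrow> real \<Rightarrow> real \<Rightarrow>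
     ('j::finite \<Rightarrow> real^'d) \<Rightarrow> ('j \<Rightarrow> real) \<Rightarrow> (real^'d) set \<Rightarrow> real^'d \<Rightarrow>
     (nat \<Rightarrow> real^'d) measure" where
  "approx_law D b \<theta> c \<delta>2 v a G s =
     projective_family.lim UNIV
       (Ionescu_Tulcea.CI (step_kernel D b \<theta> c \<delta>2 v a G s) (\<lambda>_. borel)) (\<lambda>_. borel)"

end

theory Submission
  imports Defs "HOL-Real_Asymp.Real_Asymp"
begin

text \<open>
  Write \<open>I\<close> for the integrated tail \<open>I u = E (r\<^sub>b X - u)\<^sup>+\<close>, \<open>g b = b P(\<parallel>X\<parallel> > b)\<close>, and call a path good if it stays
  within \<open>\<kappa> b\<close> of \<open>k \<eta>\<close> at the times \<open>k \<le> n\<close> and jumps into the original target at time \<open>n + 1\<close>, for some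
  \<open>n \<le> M b\<close>. On good paths the density of the approximating law with respect to the random walk is a
  product over the steps. A step before the jump contributes at least \<open>1 - p\<^sub>b(S\<^sub>k) \<ge> I k / I (k - 1)\<close> and
  the jump contributes \<open>\<theta> / v\<^sub>b(S\<^sub>n) \<ge> \<theta> / I n\<close>, up to shifts of the arguments that are small compared with
  \<open>b\<close>; so the product telescopes and is at least about \<open>\<theta> / I 0\<close>.

  The random walk hits the target off the good event with probability at most \<open>\<epsilon> g b\<close>: a deviation of
  order \<open>b\<close> without a big jump has polynomially small probability of any order by an exponential moment
  bound, and two separate deviations cost \<open>o(g b)\<close>. Since the hitting probability is at least
  \<open>I 0 - \<epsilon> g b\<close>, the approximating law dominates the conditional law up to \<open>\<epsilon>\<close> on every event. Applied to
  an event and to its complement, this one-sided bound controls the total variation distance.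
\<close>

section \<open>Regularly varying tails\<close>

text \<open>A multiplicative error in a single step would be compounded over order \<open>b\<close>
  steps. All errors are therefore moved into the argument of the integrated tail, as a shift by
  \<open>-1\<close> and by \<open>\<kappa>'' * b\<close>. With the same shift at all times the
  ratios telescope exactly, and the slack \<open>\<theta> < 1\<close> in the jump probability pays
  for comparing values at different shifts; so \<open>\<theta>\<close> is lost only once, at the
  jump. The normalising constant \<open>vfun\<close> refers to the enlarged target, the conditioning
  to the original one. The two integrated tails at 0 differ by a small multiple of
  \<open>g b\<close> once \<delta> is small and \<beta> is large. Tail bounds come from regular
  variation at fixed factors: iterating the factor 2 along a dyadic scale and interpolating by
  monotonicity gives the power bounds and integral bounds usually drawn from the theorems of Potter
  and Karamata. The constants are fixed in the order \<theta>, the time horizon \<open>M\<close>,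
  then \<delta> and \<beta>, then the shift \<open>\<kappa>''\<close>, the tube radius,
  \<open>c\<close>, \<open>\<delta>2\<close> and \<gamma>, and last of all \<open>b\<close>.\<close>

lemma dyadic_bracket:
  fixes x b :: real
  assumes "0 < b" "b < x"
  shows "\<exists>k. 2 ^ k * b < x \<and> x \<le> 2 ^ Suc k * b"
proof -
  obtain m where m: "x / b < 2 ^ m"
    using real_arch_pow[of 2 "x / b"] by auto
  define n where "n = (LEAST n. x \<le> 2 ^ n * b)"
  have ex: "x \<le> 2 ^ m * b"
    using m assms by (simp add: field_simps)
  have n: "x \<le> 2 ^ n * b"
    unfolding n_def by (rule LeastI[of "\<lambda>n. x \<le> 2 ^ n * b", OF ex])
  then have "n \<noteq> 0"
    using assms by (metis mult_1 not_le power_0)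
  then obtain k where k: "n = Suc k"
    by (cases n) auto
  have "\<not> x \<le> 2 ^ k * b"
    using not_less_Least[of k "\<lambda>n. x \<le> 2 ^ n * b"] k by (simp add: n_def)
  then show ?thesis
    using n k by (auto intro!: exI[of _ k])
qed

locale regvar_tail =
  fixes H :: "real \<Rightarrow> real" and \<alpha> :: real
  assumes H_antimono: "antimono H"
    and H_nonneg: "\<And>b. H b \<ge> 0"
    and H_regvar: "\<And>c. c > 0 \<Longrightarrow> ((\<lambda>b. H (c * b) / H b) \<longlongrightarrow> c powr (- \<alpha>)) at_top"
    and index_gt_1: "\<alpha> > 1"
begin

text \<open>The order of magnitude of the integrated tail and of the hitting probability; all error
  terms are measured against it.\<close>

definition g :: "real \<Rightarrow> real" where "g b = b * H b"

text \<open>Division by zero yields 0: an antitone tail that vanishes somewhere vanishes from there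
  on, and the ratio for the factor 1 would then be eventually 0 although its limit is 1.\<close>

lemma H_pos: "H b > 0"
proof (rule ccontr)
  assume "\<not> H b > 0"
  then have "H b = 0"
    using H_nonneg[of b] by linarith
  then have "H c = 0" if "c \<ge> b" for c
    using antimonoD[OF H_antimono that] H_nonneg[of c] by linarith
  then have "eventually (\<lambda>c. H (1 * c) / H c = 0) at_top"
    by (auto intro!: eventually_mono[OF eventually_ge_at_top[of b]])
  then have "((\<lambda>c. H (1 * c) / H c) \<longlongrightarrow> 0) at_top"
    by (rule tendsto_eventually)
  with H_regvar[of 1] have "(0::real) = 1 powr (- \<alpha>)"
    by (intro tendsto_unique[of at_top]) auto
  then show False by simp
qed

lemma H_mono: "x \<le> y \<Longrightarrow> H y \<le> H x"
  using H_antimono by (auto dest: antimonoD)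

lemma g_pos: "b > 0 \<Longrightarrow> g b > 0"
  by (simp add: g_def H_pos)

lemma g_regvar:
  assumes "c > 0"
  shows "((\<lambda>b. g (c * b) / g b) \<longlongrightarrow> c powr (1 - \<alpha>)) at_top"
proof -
  have "((\<lambda>b. c * (H (c * b) / H b)) \<longlongrightarrow> c * c powr (- \<alpha>)) at_top"
    by (intro tendsto_mult H_regvar assms tendsto_const)
  also have "c * c powr (- \<alpha>) = c powr (1 - \<alpha>)"
    using assms by (simp add: powr_diff powr_minus field_simps)
  finally have lim: "((\<lambda>b. c * (H (c * b) / H b)) \<longlongrightarrow> c powr (1 - \<alpha>)) at_top" .
  have "eventually (\<lambda>b. c * (H (c * b) / H b) = g (c * b) / g b) at_top"
    using eventually_gt_at_top[of 0] by eventually_elim (simp add: g_def)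
  with lim show ?thesis
    by (rule Lim_transform_eventually)
qed

lemma H_scale_le:
  assumes "c > 0"
  shows "\<exists>K>0. eventually (\<lambda>b. H (c * b) \<le> K * H b) at_top"
proof -
  have "eventually (\<lambda>b. H (c * b) / H b < c powr (- \<alpha>) + 1) at_top"
    by (rule order_tendstoD[OF H_regvar[OF assms]]) simp
  then have "eventually (\<lambda>b. H (c * b) \<le> (c powr (- \<alpha>) + 1) * H b) at_top"
    by eventually_elim (use H_pos in \<open>simp add: divide_simps split: if_splits\<close>)
  then show ?thesis
    by (intro exI[of _ "c powr (- \<alpha>) + 1"]) (auto intro: add_nonneg_pos)
qed

lemma H_scale_ge:
  assumes "c > 0"
  shows "\<exists>K>0. eventually (\<lambda>b. H (c * b) \<ge> K * H b) at_top"
proof -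
  have "eventually (\<lambda>b. H (c * b) / H b > c powr (- \<alpha>) / 2) at_top"
    by (rule order_tendstoD[OF H_regvar[OF assms]]) (use assms in auto)
  then have "eventually (\<lambda>b. H (c * b) \<ge> (c powr (- \<alpha>) / 2) * H b) at_top"
    by eventually_elim (metis H_pos less_le_not_le linorder_le_cases pos_less_divide_eq)
  then show ?thesis
    using assms by (intro exI[of _ "c powr (- \<alpha>) / 2"]) auto
qed

lemma g_scale_le:
  assumes "c > 0"
  shows "\<exists>K>0. eventually (\<lambda>b. g (c * b) \<le> K * g b) at_top"
proof -
  obtain K where K: "K > 0" "eventually (\<lambda>b. H (c * b) \<le> K * H b) at_top"
    using H_scale_le[OF assms] by auto
  have "eventually (\<lambda>b. g (c * b) \<le> (c * K) * g b) at_top"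
    using K(2) eventually_gt_at_top[of 0]
    by eventually_elim (use assms in \<open>simp add: g_def algebra_simps\<close>)
  then show ?thesis
    using K(1) assms by (intro exI[of _ "c * K"]) auto
qed

text \<open>As \<open>\<alpha> > 1\<close>, the index \<open>1 - \<alpha>\<close> of
  \<open>g\<close> is negative, so whatever happens beyond a horizon \<open>M * b\<close> is small
  on the scale of \<open>g b\<close>. The horizon is chosen before \<open>b\<close>, because the
  limit in \<open>b\<close> is taken for a fixed factor.\<close>

lemma g_scale_small:
  assumes "e > 0"
  shows "\<exists>M0>0. \<forall>M\<ge>M0. eventually (\<lambda>b. g (M * b) \<le> e * g b) at_top"
proof -
  have "((\<lambda>M::real. M powr (1 - \<alpha>)) \<longlongrightarrow> 0) at_top"
    using index_gt_1 by real_asymp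
  then have "eventually (\<lambda>M. M powr (1 - \<alpha>) < e) at_top"
    using assms by (rule order_tendstoD)
  then obtain M0 where M0: "\<And>M. M \<ge> M0 \<Longrightarrow> M powr (1 - \<alpha>) < e"
    by (auto simp: eventually_at_top_linorder)
  have "eventually (\<lambda>b. g (M * b) \<le> e * g b) at_top" if "M \<ge> max 1 M0" for M
  proof -
    have "eventually (\<lambda>b. g (M * b) / g b < e) at_top"
      by (rule order_tendstoD[OF g_regvar]) (use that M0 in auto)
    then show ?thesis
      using eventually_gt_at_top[of 0]
      by eventually_elim (use g_pos in \<open>simp add: divide_simps split: if_splits\<close>)
  qed
  then show ?thesis
    by (intro exI[of _ "max 1 M0"]) auto
qed

lemma g_doubling: "\<exists>\<rho> b1. 0 < \<rho> \<and> \<rho> < 1 \<and> 1 \<le> b1 \<and> (\<forall>b\<ge>b1. g (2 * b) \<le> \<rho> * g b)"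
proof -
  \<comment> \<open>The midpoint between 1 and the limit of \<open>g (2 * b) / g b\<close>.\<close>
  define \<rho> where "\<rho> = (1 + 2 powr (1 - \<alpha>)) / 2"
  have l: "2 powr (1 - \<alpha>) < 1"
    using index_gt_1 powr_less_cancel_iff[of 2 "1 - \<alpha>" 0] by simp
  have "(2::real) powr (1 - \<alpha>) > 0" by simp
  with l have \<rho>: "0 < \<rho>" "\<rho> < 1" "2 powr (1 - \<alpha>) < \<rho>"
    by (auto simp: \<rho>_def intro!: add_pos_pos)
  have "eventually (\<lambda>b. g (2 * b) / g b < \<rho>) at_top"
    by (rule order_tendstoD[OF g_regvar]) (use \<rho> in auto)
  then have "eventually (\<lambda>b. g (2 * b) \<le> \<rho> * g b) at_top"
    using eventually_gt_at_top[of 0]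
    by eventually_elim (use g_pos in \<open>simp add: divide_simps split: if_splits\<close>)
  then obtain b1 where "\<And>b. b \<ge> b1 \<Longrightarrow> g (2 * b) \<le> \<rho> * g b"
    by (auto simp: eventually_at_top_linorder)
  with \<rho> show ?thesis
    by (intro exI[of _ \<rho>] exI[of _ "max 1 b1"]) auto
qed

text \<open>Iterating one comparison at the factor 2 gives geometric decay with leading constant 1
  from every starting point beyond \<open>b1\<close>: the dyadic multiples stay beyond
  \<open>b1\<close>, so the comparison applies at each of them.\<close>

lemma g_dyadic: "\<exists>\<rho> b1. 0 < \<rho> \<and> \<rho> < 1 \<and> 1 \<le> b1 \<and> (\<forall>b\<ge>b1. \<forall>k. g (2 ^ k * b) \<le> \<rho> ^ k * g b)"
proof -
  obtain \<rho> b1 where \<rho>: "0 < \<rho>" "\<rho> < 1" "1 \<le> b1" and *: "\<And>b. b \<ge> b1 \<Longrightarrow> g (2 * b) \<le> \<rho> * g b"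
    using g_doubling by blast
  have "g (2 ^ k * b) \<le> \<rho> ^ k * g b" if "b \<ge> b1" for b k
  proof (induction k)
    case (Suc k)
    have "1 * b1 \<le> 2 ^ k * b"
      using that \<rho> by (intro mult_mono) auto
    then have "g (2 * (2 ^ k * b)) \<le> \<rho> * g (2 ^ k * b)"
      by (intro *) simp
    also have "\<dots> \<le> \<rho> * (\<rho> ^ k * g b)"
      using Suc \<rho> by (intro mult_left_mono) auto
    finally show ?case by (simp add: algebra_simps)
  qed simp
  with \<rho> show ?thesis by blast
qed

text \<open>Geometric decay of \<open>g\<close> along \<open>2 ^ k * b1\<close> is a power law with
  exponent \<open>q = - log 2 \<rho>\<close>; between dyadic points antitonicity of \<open>H\<close>
  costs a constant factor. The exponent above 1 is what yields a finite moment of order greater than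
  1.\<close>

lemma H_upper: "\<exists>r C. 1 < r \<and> 0 < C \<and> eventually (\<lambda>b. H b \<le> C * b powr (- r)) at_top"
proof -
  obtain \<rho> b1 where \<rho>: "0 < \<rho>" "\<rho> < 1" "1 \<le> b1"
    and *: "\<And>b k. b \<ge> b1 \<Longrightarrow> g (2 ^ k * b) \<le> \<rho> ^ k * g b"
    using g_dyadic by blast
  define q where "q = - log 2 \<rho>"
  have q: "q > 0" "2 powr (- q) = \<rho>"
    using \<rho> by (auto simp: q_def)
  have "H b \<le> (g b1 * (2 * b1) powr q * 2) * b powr (- (1 + q))" if "b > b1" for b
  proof -
    have "0 < b1" using \<rho> by simp
    then obtain k where k: "2 ^ k * b1 < b" "b \<le> 2 ^ Suc k * b1"
      using dyadic_bracket[of b1 b] \<open>b > b1\<close> by blast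
    have "b * H b \<le> b * H (2 ^ k * b1)"
      using k that \<rho> by (intro mult_left_mono H_mono) auto
    also have "\<dots> \<le> 2 ^ Suc k * b1 * H (2 ^ k * b1)"
      using k by (intro mult_right_mono H_nonneg) auto
    also have "\<dots> = 2 * g (2 ^ k * b1)"
      by (simp add: g_def)
    also have "\<dots> \<le> 2 * (\<rho> ^ k * g b1)"
      using *[of b1 k] by simp
    also have "\<rho> ^ k = (2 ^ k) powr (- q)"
      using q by (metis powr_powr powr_realpow zero_less_numeral mult.commute
          powr_gt_zero)
    also have "\<dots> \<le> (b / (2 * b1)) powr (- q)"
      using k \<rho> q that by (intro powr_mono2') (auto simp: field_simps)
    also have "\<dots> = b powr (- q) * (2 * b1) powr q"
      using that \<rho> by (simp add: powr_divide powr_minus field_simps)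
    finally have "b * H b \<le> 2 * (b powr (- q) * (2 * b1) powr q * g b1)"
      using g_pos[of b1] \<rho> by (simp add: mult_right_mono)
    also have "b powr (- q) = b * b powr (- (1 + q))"
      using that \<rho> powr_mult_base[of b "- (1 + q)"] by simp
    finally have "b * H b \<le> b * ((g b1 * (2 * b1) powr q * 2) * b powr (- (1 + q)))"
      by (simp only: mult_ac)
    then show ?thesis
      using that \<rho> by (subst (asm) mult_le_cancel_left_pos) auto
  qed
  moreover have "g b1 * (2 * b1) powr q * 2 > 0"
    using \<rho> g_pos[of b1] by simp
  ultimately show ?thesis
    using q(1) by (intro exI[of _ "1 + q"] exI[of _ "g b1 * (2 * b1) powr q * 2"])
      (auto intro!: eventually_mono[OF eventually_gt_at_top[of b1]])
qed

text \<open>The crude exponent \<open>\<alpha> + 1\<close> makes the ratio at the factor 2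
  eventually exceed \<open>2 powr (- p)\<close>. The bound serves to recognise probabilities of high
  polynomial order as negligible against \<open>g b\<close>.\<close>

lemma H_lower: "\<exists>p C. 0 < p \<and> 0 < C \<and> eventually (\<lambda>b. H b \<ge> C * b powr (- p)) at_top"
proof -
  define p where "p = \<alpha> + 1"
  have "eventually (\<lambda>b. H (2 * b) / H b > 2 powr (- p)) at_top"
    by (rule order_tendstoD[OF H_regvar]) (auto simp: p_def)
  then obtain b0 where b0: "\<And>b. b \<ge> b0 \<Longrightarrow> H (2 * b) / H b > 2 powr (- p)"
    by (auto simp: eventually_at_top_linorder)
  define b1 where "b1 = max 1 b0"
  have b1: "b1 \<ge> 1" and *: "H (2 * b) \<ge> 2 powr (- p) * H b" if "b \<ge> b1" for b
    using b0[of b] that H_pos[of b] by (auto simp: b1_def field_simps)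
  have **: "H (2 ^ k * b1) \<ge> (2 ^ k) powr (- p) * H b1" for k
  proof (induction k)
    case (Suc k)
    have "1 * b1 \<le> 2 ^ k * b1"
      using b1 by (intro mult_right_mono) (auto simp: b1_def)
    from *[of "2 ^ k * b1"] this
    have "2 powr (- p) * H (2 ^ k * b1) \<le> H (2 * (2 ^ k * b1))" by simp
    moreover have "2 powr (- p) * ((2 ^ k) powr (- p) * H b1) \<le> 2 powr (- p) * H (2 ^ k * b1)"
      using Suc by (intro mult_left_mono) auto
    ultimately have "2 powr (- p) * ((2 ^ k) powr (- p) * H b1) \<le> H (2 * (2 ^ k * b1))"
      by (rule order_trans[rotated])
    moreover have "2 powr (- p) * (2 ^ k) powr (- p) = (2 ^ Suc k) powr (- p)"
      using powr_mult[of 2 "2 ^ k" "- p"] by simp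
    ultimately show ?case by (simp add: mult.assoc [symmetric])
  qed simp
  have b1: "b1 \<ge> 1" by (simp add: b1_def)
  have "H b \<ge> ((2 / b1) powr (- p) * H b1) * b powr (- p)" if "b > b1" for b
  proof -
    have "0 < b1" using b1 by simp
    then obtain k where k: "2 ^ k * b1 < b" "b \<le> 2 ^ Suc k * b1"
      using dyadic_bracket[of b1 b] \<open>b > b1\<close> by blast
    have "(2 / b1 * b) powr (- p) * H b1 \<le> (2 ^ Suc k) powr (- p) * H b1"
    proof (intro mult_right_mono H_nonneg powr_mono2')
      show "2 ^ Suc k \<le> 2 / b1 * b" using k b1 by (simp add: field_simps)
    qed (use index_gt_1 in \<open>auto simp: p_def\<close>)
    also have "\<dots> \<le> H (2 ^ Suc k * b1)" by (rule **)
    also have "\<dots> \<le> H b" by (rule H_mono) fact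
    finally show ?thesis using b1 that by (simp add: powr_mult powr_divide mult_ac)
  qed
  moreover have "(2 / b1) powr (- p) * H b1 > 0"
    using b1 H_pos by simp
  ultimately show ?thesis
    using index_gt_1 by (intro exI[of _ p] exI[of _ "(2 / b1) powr (- p) * H b1"])
      (auto intro!: eventually_mono[OF eventually_gt_at_top[of b1]] simp: p_def)
qed

lemma g_tendsto_0: "(g \<longlongrightarrow> 0) at_top"
proof -
  obtain r C where r: "1 < r" "0 < C" "eventually (\<lambda>b. H b \<le> C * b powr (- r)) at_top"
    using H_upper by blast
  have "((\<lambda>b. C * b powr (1 - r)) \<longlongrightarrow> 0) at_top"
    using r(1,2) by real_asymp
  moreover have "eventually (\<lambda>b. norm (g b) \<le> C * b powr (1 - r)) at_top"
    using r(3) eventually_gt_at_top[of 0]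
  proof eventually_elim
    case (elim b)
    have "b * H b \<le> b * (C * b powr (- r))"
      using elim by (intro mult_left_mono) auto
    also have "\<dots> = C * b powr (1 - r)"
      using elim by (simp add: powr_diff powr_minus field_simps)
    finally show ?case using elim g_pos[of b] by (simp add: g_def)
  qed
  ultimately show ?thesis
    by (rule Lim_null_comparison[rotated])
qed

end

section \<open>Random walks with regularly varying increments\<close>

lemma exp_le_quadratic: "exp z \<le> 1 + z + z\<^sup>2 * exp \<bar>z\<bar>" for z :: real
proof -
  obtain t where t: "\<bar>t\<bar> \<le> \<bar>z\<bar>" "exp z = (\<Sum>m<2. z ^ m / fact m) + exp t / fact 2 * z ^ 2"
    using Maclaurin_exp_le[of z 2] by auto
  have "exp t / fact 2 * z ^ 2 \<le> exp \<bar>z\<bar> * z ^ 2"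
  proof (intro mult_right_mono)
    have "exp t \<le> exp \<bar>z\<bar>" using t(1) by simp
    then have "exp t \<le> 2 * exp \<bar>z\<bar>"
      using exp_gt_zero[of "\<bar>z\<bar>"] by linarith
    then show "exp t / fact 2 \<le> exp \<bar>z\<bar>"
      by simp
  qed simp
  then show ?thesis using t(2) by (simp add: numeral_2_eq_2 mult.commute)
qed

locale rv_increments = prob_space D for D :: "(real^'d) measure" +
  fixes \<alpha> :: real
  assumes sets_D: "sets D = sets borel"
    and integrable_id: "integrable D (\<lambda>x. x)"
    and mean: "(\<integral>x. x \<partial>D) = eta"
    and regvar: "regvar_tail (\<lambda>b. \<P>(x in D. norm x > b)) \<alpha>"
begin

definition tail :: "real \<Rightarrow> real" where "tail b = \<P>(x in D. norm x > b)"

sublocale regvar_tail tail \<alpha>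
  using regvar by (simp add: tail_def[abs_def])

sublocale seq: sequence_space D
  by unfold_locales

lemma space_D [simp]: "space D = UNIV"
  using sets_eq_imp_space_eq[OF sets_D] by simp

lemma emeasure_D_UNIV [simp]: "emeasure D UNIV = 1"
  using emeasure_space_1 by simp

declare sets_D [measurable_cong, simp]

lemma space_S [simp]: "space seq.S = UNIV"
  by (simp add: space_PiM PiE_UNIV_domain)

text \<open>The walk with its drift removed; staying in a tube around the drift line is a condition
  on \<open>W\<close>.\<close>

definition W :: "(nat \<Rightarrow> real^'d) \<Rightarrow> nat \<Rightarrow> real^'d" where
  "W x n = (\<Sum>i<n. x i - eta)"

lemma measurable_W [measurable]: "(\<lambda>x. W x n) \<in> borel_measurable seq.S"
  unfolding W_def by measurable

section \<open>Moments from dyadic shells\<close>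

lemma nn_integral_tail_le:
  assumes "b > 0" and mono: "\<And>x y. 0 \<le> x \<Longrightarrow> x \<le> y \<Longrightarrow> \<phi> x \<le> \<phi> y" and nonneg: "\<And>x. 0 \<le> x \<Longrightarrow> 0 \<le> \<phi> x"
  shows "(\<integral>\<^sup>+x. ennreal (\<phi> (norm x)) * indicator {x. norm x > b} x \<partial>D)
    \<le> (\<Sum>k. ennreal (\<phi> (2 ^ Suc k * b) * tail (2 ^ k * b)))"
proof -
  have "(\<integral>\<^sup>+x. ennreal (\<phi> (norm x)) * indicator {x. norm x > b} x \<partial>D)
    \<le> (\<integral>\<^sup>+x. (\<Sum>k. ennreal (\<phi> (2 ^ Suc k * b)) * indicator {x. norm x > 2 ^ k * b} x) \<partial>D)"
  proof (intro nn_integral_mono)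
    fix x :: "real^'d"
    show "ennreal (\<phi> (norm x)) * indicator {x. norm x > b} x
      \<le> (\<Sum>k. ennreal (\<phi> (2 ^ Suc k * b)) * indicator {x. norm x > 2 ^ k * b} x)"
    proof (cases "norm x > b")
      case True
      then obtain k where k: "2 ^ k * b < norm x" "norm x \<le> 2 ^ Suc k * b"
        using dyadic_bracket[of b "norm x"] assms(1) by blast
      have "ennreal (\<phi> (norm x)) * indicator {x. norm x > b} x
        \<le> ennreal (\<phi> (2 ^ Suc k * b)) * indicator {x. norm x > 2 ^ k * b} x"
        using k True mono[of "norm x" "2 ^ Suc k * b"] by (auto intro!: ennreal_leI)
      also have "\<dots> \<le> (\<Sum>k. ennreal (\<phi> (2 ^ Suc k * b)) * indicator {x. norm x > 2 ^ k * b} x)"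
        using sum_le_suminf[of "\<lambda>k. ennreal (\<phi> (2 ^ Suc k * b)) * indicator {x. norm x > 2 ^ k * b} x" "{k}"]
        by (simp del: power_Suc sum_mult_indicator)
      finally show ?thesis .
    qed simp
  qed
  also have "\<dots> = (\<Sum>k. \<integral>\<^sup>+x. ennreal (\<phi> (2 ^ Suc k * b)) * indicator {x. norm x > 2 ^ k * b} x \<partial>D)"
    by (intro nn_integral_suminf) measurable
  also have "\<dots> = (\<Sum>k. ennreal (\<phi> (2 ^ Suc k * b) * tail (2 ^ k * b)))"
    using assms(1)
    by (intro suminf_cong)
       (auto simp: nn_integral_cmult_indicator emeasure_eq_measure ennreal_mult nonneg tail_def)
  finally show ?thesis .
qed

text \<open>This moment replaces the variance, which may be infinite. The dyadic shells contribute
  terms \<open>2 powr (k * (s - r))\<close>, a convergent geometric series for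
  \<open>s < r\<close>.\<close>

lemma moment_gt_1: "\<exists>s. 1 < s \<and> s < 2 \<and> integrable D (\<lambda>x. norm x powr s)"
proof -
  obtain r C where r: "1 < r" "0 < C" "eventually (\<lambda>b. tail b \<le> C * b powr (- r)) at_top"
    using H_upper by blast
  from r(3) obtain b0 where b0: "\<And>b. b \<ge> b0 \<Longrightarrow> tail b \<le> C * b powr (- r)"
    by (auto simp: eventually_at_top_linorder)
  define b where "b = max 1 b0"
  have b: "b \<ge> 1" by (simp add: b_def)
  \<comment> \<open>The midpoint of 1 and \<open>min r 2\<close>, hence above 1 and below both
    \<open>r\<close> and 2. The gap \<open>2 - s\<close> becomes the power of the truncation level
    in the bound on the exponential moment.\<close>
  define s where "s = (1 + min r 2) / 2"
  have s: "1 < s" "s < 2" "s < r"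
    using r(1) by (auto simp: s_def min_def)
  define q where "q = (2::real) powr (s - r)"
  have q: "0 < q" "q < 1"
    using s powr_less_cancel_iff[of 2 "s - r" 0] by (auto simp: q_def)
  have term_le: "(2 ^ Suc k * b) powr s * tail (2 ^ k * b) \<le> (2 * b) powr s * C * b powr (- r) * q ^ k" for k
  proof -
    have "1 * b \<le> 2 ^ k * b" using b by (intro mult_right_mono) auto
    then have "b0 \<le> 2 ^ k * b" by (simp add: b_def)
    then have "(2 ^ Suc k * b) powr s * tail (2 ^ k * b) \<le> (2 ^ Suc k * b) powr s * (C * (2 ^ k * b) powr (- r))"
      by (intro mult_left_mono b0) auto
    also have "\<dots> = (2 * b) powr s * C * b powr (- r) * ((2 ^ k) powr (s + - r))"
    proof -
      have e: "(2 ^ Suc k * b) powr s = (2 ^ k) powr s * (2 * b) powr s"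
        using b powr_mult[of "2 ^ k" "2 * b" s] by (simp add: mult_ac)
      have e': "(2 ^ k * b) powr (- r) = (2 ^ k) powr (- r) * b powr (- r)"
        using b by (simp add: powr_mult)
      show ?thesis
        unfolding e e' by (simp only: powr_add mult_ac)
    qed
    also have "((2::real) ^ k) powr (s + - r) = q ^ k"
    proof -
      have "q ^ k = q powr real k"
        using q by (simp add: powr_realpow)
      also have "\<dots> = (2 powr real k) powr (s - r)"
        by (simp only: q_def powr_powr mult.commute)
      also have "2 powr real k = (2::real) ^ k"
        by (simp add: powr_realpow)
      finally show ?thesis by simp
    qed
    finally show ?thesis .
  qed
  have "(\<integral>\<^sup>+x. ennreal (norm x powr s) \<partial>D)
    \<le> (\<integral>\<^sup>+x. ennreal (b powr s) + ennreal (norm x powr s) * indicator {x. norm x > b} x \<partial>D)"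
  proof (intro nn_integral_mono)
    fix x :: "real^'d"
    show "ennreal (norm x powr s) \<le> ennreal (b powr s) + ennreal (norm x powr s) * indicator {x. norm x > b} x"
      using s by (cases "norm x > b") (auto intro!: ennreal_leI powr_mono2)
  qed
  also have "\<dots> = ennreal (b powr s) + (\<integral>\<^sup>+x. ennreal (norm x powr s) * indicator {x. norm x > b} x \<partial>D)"
    by (subst nn_integral_add) (auto simp: emeasure_space_1)
  also have "\<dots> \<le> ennreal (b powr s) + (\<Sum>k. ennreal ((2 ^ Suc k * b) powr s * tail (2 ^ k * b)))"
    using b s by (intro add_left_mono nn_integral_tail_le) (auto intro!: powr_mono2)
  also have "\<dots> \<le> ennreal (b powr s) + (\<Sum>k. ennreal ((2 * b) powr s * C * b powr (- r) * q ^ k))"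
    by (intro add_left_mono suminf_le ennreal_leI term_le) auto
  also have "(\<Sum>k. ennreal ((2 * b) powr s * C * b powr (- r) * q ^ k))
     = ennreal (\<Sum>k. (2 * b) powr s * C * b powr (- r) * q ^ k)"
    using q r by (intro suminf_ennreal2 summable_mult summable_geometric) auto
  also have "ennreal (b powr s) + \<dots> < \<infinity>"
    by simp
  finally have "integrable D (\<lambda>x. norm x powr s)"
    by (intro integrableI_nonneg) auto
  with s show ?thesis by blast
qed

lemma integrable_norm_id [simp]: "integrable D norm"
  using integrable_norm[OF integrable_id] by simp

text \<open>The upper half of Karamata's theorem: the shell above \<open>2 ^ k * b\<close>
  contributes at most \<open>2 * g (2 ^ k * b)\<close>, and these terms decay geometrically, which
  gives the constant \<open>2 / (1 - \<rho>)\<close>.\<close>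

lemma truncated_mean_le: "\<exists>K>0. eventually (\<lambda>b. (\<integral>x. norm x * indicator {x. norm x > b} x \<partial>D) \<le> K * g b) at_top"
proof -
  obtain \<rho> b1 where \<rho>: "0 < \<rho>" "\<rho> < 1" "1 \<le> b1"
    and *: "\<And>b k. b \<ge> b1 \<Longrightarrow> g (2 ^ k * b) \<le> \<rho> ^ k * g b"
    using g_dyadic by blast
  have "(\<integral>x. norm x * indicator {x. norm x > b} x \<partial>D) \<le> (2 / (1 - \<rho>)) * g b" if "b \<ge> b1" for b
  proof -
    have "ennreal (\<integral>x. norm x * indicator {x. norm x > b} x \<partial>D)
       = (\<integral>\<^sup>+x. ennreal (norm x * indicator {x. norm x > b} x) \<partial>D)"
      by (intro nn_integral_eq_integral[symmetric] integrable_real_mult_indicator) auto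
    also have "\<dots> = (\<integral>\<^sup>+x. ennreal (norm x) * indicator {x. norm x > b} x \<partial>D)"
      by (intro nn_integral_cong) (auto split: split_indicator)
    also have "\<dots> \<le> (\<Sum>k. ennreal (2 ^ Suc k * b * tail (2 ^ k * b)))"
      using that \<rho> by (intro nn_integral_tail_le) linarith+
    also have "\<dots> \<le> (\<Sum>k. ennreal (2 * g b * \<rho> ^ k))"
    proof (intro suminf_le ennreal_leI)
      fix k
      show "2 ^ Suc k * b * tail (2 ^ k * b) \<le> 2 * g b * \<rho> ^ k"
        using *[OF that, of k] by (simp add: g_def mult_ac)
    qed auto
    also have "\<dots> = ennreal (\<Sum>k. 2 * g b * \<rho> ^ k)"
      using \<rho> that g_pos[of b] by (intro suminf_ennreal2 summable_mult summable_geometric) auto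
    also have "(\<Sum>k. 2 * g b * \<rho> ^ k) = 2 * g b * (\<Sum>k. \<rho> ^ k)"
      using \<rho> by (intro suminf_mult summable_geometric) simp
    also have "(\<Sum>k. \<rho> ^ k) = 1 / (1 - \<rho>)"
      using \<rho> by (intro suminf_geometric) simp
    finally have "ennreal (\<integral>x. norm x * indicator {x. norm x > b} x \<partial>D) \<le> ennreal (2 * g b * (1 / (1 - \<rho>)))" .
    moreover have "0 \<le> 2 * g b * (1 / (1 - \<rho>))"
      using g_pos[of b] \<rho> that by (intro mult_nonneg_nonneg) auto
    ultimately have "(\<integral>x. norm x * indicator {x. norm x > b} x \<partial>D) \<le> 2 * g b * (1 / (1 - \<rho>))"
      using ennreal_le_iff by blast
    then show ?thesis by simp
  qed
  then have "eventually (\<lambda>b. (\<integral>x. norm x * indicator {x. norm x > b} x \<partial>D) \<le> (2 / (1 - \<rho>)) * g b) at_top"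
    unfolding eventually_at_top_linorder by blast
  moreover have "2 / (1 - \<rho>) > 0" using \<rho> by simp
  ultimately show ?thesis by blast
qed

section \<open>Exponential moments of the walk with bounded increments\<close>

lemma nn_integral_prod_iid:
  assumes [measurable]: "f \<in> borel_measurable D"
  shows "(\<integral>\<^sup>+x. (\<Prod>i<n. f (x i)) \<partial>seq.S) = (\<integral>\<^sup>+x. f x \<partial>D) ^ n"
proof (induction n)
  case 0
  then show ?case by (simp add: seq.P.emeasure_space_1 del: space_S)
next
  case (Suc n)
  have "(\<integral>\<^sup>+x. (\<Prod>i<Suc n. f (x i)) \<partial>seq.S)
      = (\<integral>\<^sup>+x. (\<Prod>i<Suc n. f (x i)) \<partial>distr (D \<Otimes>\<^sub>M seq.S) seq.S (\<lambda>(s, \<omega>). case_nat s \<omega>))"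
    by (simp only: seq.PiM_iter)
  also have "\<dots> = (\<integral>\<^sup>+z. (\<Prod>i<Suc n. f (case_nat (fst z) (snd z) i)) \<partial>(D \<Otimes>\<^sub>M seq.S))"
    by (subst nn_integral_distr) (auto simp: split_beta')
  also have "\<dots> = (\<integral>\<^sup>+z. f (fst z) * (\<Prod>i<n. f (snd z i)) \<partial>(D \<Otimes>\<^sub>M seq.S))"
    by (simp add: prod.lessThan_Suc_shift del: prod.lessThan_Suc)
  also have "\<dots> = (\<integral>\<^sup>+s. \<integral>\<^sup>+x. f s * (\<Prod>i<n. f (x i)) \<partial>seq.S \<partial>D)"
    by (subst seq.P.nn_integral_fst[symmetric]) (auto simp: split_beta')
  also have "\<dots> = (\<integral>\<^sup>+s. f s * (\<integral>\<^sup>+x. f x \<partial>D) ^ n \<partial>D)"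
    by (simp add: nn_integral_cmult Suc)
  also have "\<dots> = (\<integral>\<^sup>+x. f x \<partial>D) ^ Suc n"
    by (simp add: nn_integral_multc mult.commute)
  finally show ?case .
qed

text \<open>Markov's inequality for the product of the exponentials times the indicators of the
  ball. The truncation is part of the integrand, so the increments need neither conditioning nor
  recentring, and the factor \<open>m\<close> bounds an integral over the ball only.\<close>

lemma chernoff_truncated:
  fixes u :: "real^'d"
  assumes "0 < l" "0 \<le> m" and m: "(\<integral>x. exp (l * ((x - eta) \<bullet> u)) * indicator (cball 0 R) x \<partial>D) \<le> m"
  shows "\<P>(x in seq.S. (\<forall>i<n. norm (x i) \<le> R) \<and> W x n \<bullet> u \<ge> t) \<le> exp (- l * t) * m ^ n"
proof -
  define f where "f x = exp (l * ((x - eta) \<bullet> u)) * indicator (cball 0 R) x" for x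
  have [measurable]: "cball (0::real^'d) R \<in> sets borel"
    by (intro borel_closed closed_cball)
  have [measurable]: "f \<in> borel_measurable borel"
    unfolding f_def by measurable
  have f_nonneg: "0 \<le> f x" for x by (simp add: f_def)
  have "integrable D f"
  proof (rule integrable_const_bound[where B="exp (l * ((R + norm (eta::real^'d)) * norm u))"])
    have "f x \<le> exp (l * ((R + norm (eta::real^'d)) * norm u))" for x
    proof (cases "norm x \<le> R")
      case True
      have "(x - eta) \<bullet> u \<le> norm (x - eta) * norm u"
        by (rule norm_cauchy_schwarz)
      also have "\<dots> \<le> (R + norm (eta::real^'d)) * norm u"
        using True norm_triangle_ineq4[of x eta] by (intro mult_right_mono) auto
      finally show ?thesis using True assms(1) by (simp add: f_def)
    qed (simp add: f_def)
    then show "AE x in D. norm (f x) \<le> exp (l * ((R + norm (eta::real^'d)) * norm u))"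
      using f_nonneg by simp
  qed simp
  moreover have "expectation f \<le> m"
    using m unfolding f_def[abs_def] .
  ultimately have nn: "(\<integral>\<^sup>+x. ennreal (f x) \<partial>D) \<le> ennreal m"
    using f_nonneg by (subst nn_integral_eq_integral) (auto intro!: ennreal_leI)
  let ?E = "{x \<in> space seq.S. (\<forall>i<n. norm (x i) \<le> R) \<and> W x n \<bullet> u \<ge> t}"
  have "ennreal (measure seq.S ?E) = emeasure seq.S ?E"
    by (rule seq.P.emeasure_eq_measure[symmetric])
  also have "\<dots> = (\<integral>\<^sup>+x. indicator ?E x \<partial>seq.S)"
    by (rule nn_integral_indicator[symmetric]) measurable
  also have "\<dots> \<le> (\<integral>\<^sup>+x. ennreal (exp (- l * t)) * (\<Prod>i<n. ennreal (f (x i))) \<partial>seq.S)"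
  proof (intro nn_integral_mono)
    fix x
    show "indicator ?E x \<le> ennreal (exp (- l * t)) * (\<Prod>i<n. ennreal (f (x i)))"
    proof (cases "x \<in> ?E")
      case True
      then have "(\<Prod>i<n. f (x i)) = (\<Prod>i<n. exp (l * ((x i - eta) \<bullet> u)))"
        by (intro prod.cong) (auto simp: f_def)
      also have "\<dots> = exp (l * (W x n \<bullet> u))"
        by (simp add: exp_sum[symmetric] W_def inner_sum_left sum_distrib_left)
      finally have "exp (- l * t) * (\<Prod>i<n. f (x i)) = exp (l * (W x n \<bullet> u - t))"
        by (simp add: exp_add[symmetric] algebra_simps)
      also have "\<dots> \<ge> 1"
        using True assms(1) by simp
      finally have "ennreal 1 \<le> ennreal (exp (- l * t) * (\<Prod>i<n. f (x i)))"
        by (intro ennreal_leI)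
      then show ?thesis
        using True by (simp add: ennreal_mult prod_ennreal prod_nonneg f_nonneg)
    qed simp
  qed
  also have "\<dots> = ennreal (exp (- l * t)) * (\<integral>\<^sup>+x. ennreal (f x) \<partial>D) ^ n"
  proof -
    have fm: "(\<lambda>x. ennreal (f x)) \<in> borel_measurable D" by measurable
    show ?thesis
      by (subst nn_integral_cmult) (measurable, simp only: nn_integral_prod_iid[OF fm])
  qed
  also have "\<dots> \<le> ennreal (exp (- l * t)) * ennreal m ^ n"
    by (intro mult_left_mono power_mono nn) auto
  also have "\<dots> = ennreal (exp (- l * t) * m ^ n)"
    using assms by (simp add: ennreal_mult ennreal_power)
  finally show ?thesis
    using assms by (subst (asm) ennreal_le_iff) auto
qed

end

lemma powr_sum_le:
  fixes x c s :: real
  assumes "0 \<le> x" "0 \<le> c" "0 < s"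
  shows "(x + c) powr s \<le> 2 powr s * (x powr s + c powr s)"
proof -
  have "(x + c) powr s \<le> (2 * max x c) powr s"
    using assms by (intro powr_mono2) auto
  also have "\<dots> = 2 powr s * (max x c) powr s"
    using assms by (simp add: powr_mult)
  also have "(max x c) powr s \<le> x powr s + c powr s"
    by (auto simp: max_def)
  finally show ?thesis by simp
qed

lemma real_le_iff_le_nat_floor: "0 \<le> x \<Longrightarrow> real n \<le> x \<longleftrightarrow> n \<le> nat \<lfloor>x\<rfloor>"
  by (simp add: le_nat_iff le_floor_iff)

context rv_increments
begin

lemma expectation_centered: "(\<integral>x. (x - eta) \<bullet> u \<partial>D) = 0" "integrable D (\<lambda>x. (x - eta) \<bullet> u)"
proof -
  have "(\<integral>x. (x - eta) \<bullet> u \<partial>D) = (\<integral>x. x \<bullet> u \<partial>D) - (\<integral>x. eta \<bullet> u \<partial>D)"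
    unfolding inner_diff_left by (intro Bochner_Integration.integral_diff integrable_inner_left integrable_id) auto
  also have "(\<integral>x. x \<bullet> u \<partial>D) = eta \<bullet> u"
    using integral_inner_left[of u D "\<lambda>x. x"] integrable_id mean by simp
  finally show "(\<integral>x. (x - eta) \<bullet> u \<partial>D) = 0"
    using prob_space by simp
  show "integrable D (\<lambda>x. (x - eta) \<bullet> u)"
    by (intro integrable_inner_left Bochner_Integration.integrable_diff integrable_id) auto
qed

text \<open>Bounds the part of the mean of the centred increment, in any direction of norm at most
  1, that is lost when increments above \<open>R\<close> are discarded.\<close>

definition excess :: "real \<Rightarrow> real" where
  "excess R = (\<integral>x. (norm x + norm (eta::real^'d)) * indicator {x. norm x > R} x \<partial>D)"

lemma integrable_excess: "integrable D (\<lambda>x. (norm x + norm (eta::real^'d)) * indicator {x. norm x > R} x)"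
  by (intro integrable_real_mult_indicator) auto

lemma excess_nonneg: "0 \<le> excess R"
  unfolding excess_def by (intro integral_nonneg_AE) auto

lemma excess_tendsto_0: "(excess \<longlongrightarrow> 0) at_top"
proof -
  define c where "c = norm (eta::real^'d)"
  have c: "c \<ge> 0" by (simp add: c_def)
  obtain K where K: "K > 0" "eventually (\<lambda>b. (\<integral>x. norm x * indicator {x. norm x > b} x \<partial>D) \<le> K * g b) at_top"
    using truncated_mean_le by blast
  have ev: "eventually (\<lambda>R. norm (excess R) \<le> (1 + c) * (K * g R)) at_top"
    using K(2) eventually_ge_at_top[of 1]
  proof eventually_elim
    case (elim R)
    have "excess R \<le> (\<integral>x. (1 + c) * (norm x * indicator {x. norm x > R} x) \<partial>D)"
      unfolding excess_def
    proof (intro integral_mono integrable_excess)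
      show "integrable D (\<lambda>x. (1 + c) * (norm x * indicator {x. norm x > R} x))"
        by (intro integrable_mult_right integrable_real_mult_indicator) auto
      fix x :: "real^'d"
      \<comment> \<open>For \<open>R \<ge> 1\<close> the constant \<open>c\<close> is absorbed by
        the norm of a large increment.\<close>
      have "c * 1 \<le> c * norm x" if "norm x > R"
        using that elim c by (intro mult_left_mono) auto
      then show "(norm x + norm (eta::real^'d)) * indicator {x. norm x > R} x \<le> (1 + c) * (norm x * indicator {x. norm x > R} x)"
        by (auto simp: c_def[symmetric] indicator_def algebra_simps)
    qed
    also have "\<dots> = (1 + c) * (\<integral>x. norm x * indicator {x. norm x > R} x \<partial>D)"
      by simp
    also have "\<dots> \<le> (1 + c) * (K * g R)"
      using elim c by (intro mult_left_mono) auto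
    finally show ?case using excess_nonneg by simp
  qed
  have "((\<lambda>R. (1 + c) * (K * g R)) \<longlongrightarrow> (1 + c) * (K * 0)) at_top"
    by (intro tendsto_mult tendsto_const g_tendsto_0)
  then have "((\<lambda>R. (1 + c) * (K * g R)) \<longlongrightarrow> 0) at_top"
    by simp
  with ev show ?thesis
    by (rule Lim_null_comparison)
qed

text \<open>On the ball, \<open>exp_le_quadratic\<close> applies; the linear term has mean 0 over
  the whole space, so the truncation costs only \<open>l * excess R\<close> to first order. The
  quadratic term is controlled by the moment of order \<open>s\<close> and a power of the truncation
  level.\<close>

lemma mgf_truncated_le:
  fixes u :: "real^'d"
  assumes s: "1 < s" "s < 2" "integrable D (\<lambda>x. norm x powr s)"
    and "norm u \<le> 1" "0 < l" "0 \<le> R"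
  defines "c \<equiv> norm (eta::real^'d)"
  defines "K \<equiv> (\<integral>x. 2 powr s * (norm x powr s + c powr s) \<partial>D)"
  shows "(\<integral>x. exp (l * ((x - eta) \<bullet> u)) * indicator (cball 0 R) x \<partial>D)
    \<le> 1 + (l * excess R + l\<^sup>2 * exp (l * (R + c)) * (R + c) powr (2 - s) * K)"
proof -
  define A where "A = l\<^sup>2 * exp (l * (R + c)) * (R + c) powr (2 - s)"
  have [measurable]: "cball (0::real^'d) R \<in> sets borel"
    by (intro borel_closed closed_cball)
  have c: "c \<ge> 0" by (simp add: c_def)
  have A: "A \<ge> 0" by (simp add: A_def)
  \<comment> \<open>Off the ball the left side is 0 and the third summand outweighs a negative
    linear term. This lets the linear term be integrated over the whole space, where it
    vanishes.\<close>
  let ?h = "\<lambda>x::real^'d. 1 + l * ((x - eta) \<bullet> u) + l * ((norm x + c) * indicator {x. norm x > R} x)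
     + A * (2 powr s * (norm x powr s + c powr s))"
  have le: "exp (l * ((x - eta) \<bullet> u)) * indicator (cball 0 R) x \<le> ?h x" for x
  proof -
    define z where "z = (x - eta) \<bullet> u"
    have "\<bar>z\<bar> \<le> norm (x - eta) * norm u"
      unfolding z_def by (rule Cauchy_Schwarz_ineq2)
    also have "\<dots> \<le> norm (x - eta) * 1"
      using assms by (intro mult_left_mono) auto
    also have "\<dots> \<le> norm x + c"
      using norm_triangle_ineq4[of x eta] by (simp add: c_def)
    finally have z: "\<bar>z\<bar> \<le> norm x + c" .
    show ?thesis
    proof (cases "norm x \<le> R")
      case True
      have "exp (l * z) \<le> 1 + l * z + (l * z)\<^sup>2 * exp \<bar>l * z\<bar>"
        by (rule exp_le_quadratic)
      \<comment> \<open>The square is split as the power \<open>s\<close> times the power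
        \<open>2 - s\<close>: the first has a finite mean, the second is bounded on the
        ball.\<close>
      also have "(l * z)\<^sup>2 * exp \<bar>l * z\<bar> \<le> (l\<^sup>2 * (2 powr s * (norm x powr s + c powr s) * (R + c) powr (2 - s))) * exp (l * (R + c))"
      proof (intro mult_mono)
        have "z\<^sup>2 = \<bar>z\<bar> powr (s + (2 - s))"
          by (cases "z = 0") auto
        also have "\<dots> = \<bar>z\<bar> powr s * \<bar>z\<bar> powr (2 - s)"
          by (rule powr_add)
        also have "\<dots> \<le> (norm x + c) powr s * (R + c) powr (2 - s)"
          using z True s c by (intro mult_mono powr_mono2) auto
        also have "\<dots> \<le> (2 powr s * (norm x powr s + c powr s)) * (R + c) powr (2 - s)"
          using s c by (intro mult_right_mono powr_sum_le) auto
        finally show "(l * z)\<^sup>2 \<le> l\<^sup>2 * (2 powr s * (norm x powr s + c powr s) * (R + c) powr (2 - s))"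
          using assms by (simp add: power_mult_distrib)
        show "exp \<bar>l * z\<bar> \<le> exp (l * (R + c))"
          using z True assms by (auto simp: abs_mult intro!: mult_left_mono)
      qed auto
      finally show ?thesis
        using True by (simp add: z_def A_def mult_ac)
    next
      case False
      have "l * (- z) \<le> l * (norm x + c)"
        using z assms by (intro mult_left_mono) auto
      moreover have "0 \<le> A * (2 powr s * (norm x powr s + c powr s))"
        using A by simp
      ultimately show ?thesis
        using False by (simp add: z_def)
    qed
  qed
  have int: "integrable D (\<lambda>x. 2 powr s * (norm x powr s + c powr s))"
    using s by simp
  have inth: "integrable D ?h"
    using integrable_excess[of R] s(3) expectation_centered(2)[of u]
    by (intro Bochner_Integration.integrable_add integrable_mult_right) (auto simp: c_def)
  have "(\<integral>x. exp (l * ((x - eta) \<bullet> u)) * indicator (cball 0 R) x \<partial>D) \<le> (\<integral>x. ?h x \<partial>D)"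
  proof (intro integral_mono inth le)
    show "integrable D (\<lambda>x. exp (l * ((x - eta) \<bullet> u)) * indicator (cball 0 R) x)"
      by (rule Bochner_Integration.integrable_bound[OF inth])
         (auto intro!: AE_I2 order_trans[OF le abs_ge_self])
  qed
  also have "\<dots> = 1 + l * 0 + l * excess R + A * K"
  proof -
    have i1: "integrable D (\<lambda>x. l * ((x - eta) \<bullet> u))"
      by (intro integrable_mult_right expectation_centered(2))
    have i2: "integrable D (\<lambda>x. l * ((norm x + c) * indicator {x. norm x > R} x))"
      using integrable_excess[of R] unfolding c_def by (intro integrable_mult_right)
    have i3: "integrable D (\<lambda>x. A * (2 powr s * (norm x powr s + c powr s)))"
      by (intro integrable_mult_right int)
    have "(\<integral>x. ?h x \<partial>D) = (\<integral>x. 1 \<partial>D) + (\<integral>x. l * ((x - eta) \<bullet> u) \<partial>D)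
        + (\<integral>x. l * ((norm x + c) * indicator {x. norm x > R} x) \<partial>D)
        + (\<integral>x. A * (2 powr s * (norm x powr s + c powr s)) \<partial>D)"
      using i1 i2 i3
      by (subst Bochner_Integration.integral_add Bochner_Integration.integrable_add;
          (intro Bochner_Integration.integrable_add i1 i2 i3 integrable_const refl)?)+
    also have "(\<integral>x. l * ((x - eta) \<bullet> u) \<partial>D) = l * 0"
      using expectation_centered(1)[of u] by simp
    also have "(\<integral>x. l * ((norm x + c) * indicator {x. norm x > R} x) \<partial>D) = l * excess R"
      by (simp add: excess_def c_def)
    also have "(\<integral>x. A * (2 powr s * (norm x powr s + c powr s)) \<partial>D) = A * K"
      unfolding K_def by (rule integral_mult_right_zero)
    finally show ?thesis using prob_space by simp
  qed
  finally show ?thesis by (simp add: A_def add.assoc)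
qed

text \<open>Only jumps larger than \<open>\<delta> b\<close> can produce a deviation of order \<open>b\<close>: with jumps bounded by
  \<open>\<delta> b\<close>, the exponential moment at \<open>\<lambda> = q ln b / (\<delta> b)\<close> gives any polynomial rate when \<open>\<delta>\<close> is small.\<close>

lemma small_jumps_deviation:
  assumes "0 < \<kappa>" "0 < M"
  shows "\<exists>\<delta>>0. \<forall>e>0. eventually (\<lambda>b.
    \<P>(x in seq.S. \<exists>n. real n \<le> M * b \<and> (\<forall>i<n. norm (x i) \<le> \<delta> * b) \<and> norm (W x n) > \<kappa> * b) \<le> e * g b) at_top"
proof -
  obtain s where s: "1 < s" "s < 2" "integrable D (\<lambda>x. norm x powr s)"
    using moment_gt_1 by blast
  obtain p C where p: "0 < p" "0 < C" "eventually (\<lambda>b. tail b \<ge> C * b powr (- p)) at_top"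
    using H_lower by blast
  define c where "c = norm (eta::real^'d)"
  define K where "K = (\<integral>x. 2 powr s * (norm x powr s + c powr s) \<partial>D)"
  have c: "c \<ge> 0" by (simp add: c_def)
  have K: "K \<ge> 0" unfolding K_def by (intro integral_nonneg_AE) auto
  \<comment> \<open>With \<open>l = q * ln b / (\<delta> * b)\<close> the factor
    \<open>exp (l * \<delta> * b)\<close> is \<open>b powr q\<close>. The quadratic terms of order
    \<open>b\<close> steps then have size \<open>(ln b)^2 * b powr (1 - s + q)\<close>, and this
    choice makes the exponent \<open>- q\<close>.\<close>
  define q where "q = (s - 1) / 2"
  have q: "q > 0" using s by (simp add: q_def)
  \<comment> \<open>A vector of norm above \<open>\<kappa> * b\<close> has a coordinate of modulus
    at least \<open>\<kappa>' * b\<close>, so one-dimensional bounds in the signed coordinate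
    directions suffice.\<close>
  define \<kappa>' where "\<kappa>' = \<kappa> / real CARD('d)"
  have \<kappa>': "\<kappa>' > 0" using assms by (simp add: \<kappa>'_def)
  \<comment> \<open>Chosen such that half of the Chernoff exponent,
    \<open>l * \<kappa>' * b / 2\<close>, equals \<open>(p + 2) * ln b\<close>. Against
    \<open>g b\<close>, which is at least of order \<open>b powr (1 - p)\<close>, this leaves room
    for the union over order \<open>b\<close> times.\<close>
  define \<delta> where "\<delta> = q * \<kappa>' / (2 * (p + 2))"
  have \<delta>: "\<delta> > 0" using q \<kappa>' p by (simp add: \<delta>_def)
  define U where "U = {axis i (1::real) | i :: 'd. True} \<union> {- axis i (1::real) | i :: 'd. True}"
  have finU: "finite U"
    by (simp add: U_def full_SetCompr_eq)
  have normU: "norm u \<le> 1" if "u \<in> U" for u :: "real^'d"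
    using that by (auto simp: U_def norm_axis_1)
  define l where "l b = q * ln b / (\<delta> * b)" for b
  define E where "E b n u = {x \<in> space seq.S. (\<forall>i<n. norm (x i) \<le> \<delta> * b) \<and> W x n \<bullet> u \<ge> \<kappa>' * b}" for b n u
  have "((\<lambda>b. M * b * (q * ln b / (\<delta> * b))\<^sup>2 * exp (q * ln b / (\<delta> * b) * (\<delta> * b + c)) * (\<delta> * b + c) powr (2 - s) * K) \<longlongrightarrow> 0) at_top"
  proof -
    have "((\<lambda>b. b * (ln b / b)\<^sup>2 * b powr q * b powr (2 - s)) \<longlongrightarrow> 0) at_top"
    proof -
      have lim: "((\<lambda>b::real. (ln b)\<^sup>2 * b powr (- q)) \<longlongrightarrow> 0) at_top"
        using q by real_asymp
      have "eventually (\<lambda>b. (ln b)\<^sup>2 * b powr (- q) = b * (ln b / b)\<^sup>2 * b powr q * b powr (2 - s)) at_top"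
        using eventually_gt_at_top[of 0]
      proof eventually_elim
        case (elim b)
        have "b powr (- q) * b = b powr (- q + 1)"
          using elim powr_mult_base[of b "- q"] by (simp add: mult.commute add.commute)
        also have "- q + 1 = q + (2 - s)"
          by (simp add: q_def field_simps)
        finally have "b powr q * b powr (2 - s) = b powr (- q) * b"
          by (simp add: powr_add)
        then show ?case
          using elim by (simp add: power_divide power2_eq_square field_simps)
      qed
      with lim show ?thesis
        by (rule Lim_transform_eventually)
    qed
    moreover have "((\<lambda>b. exp (q * c * ln b / (\<delta> * b))) \<longlongrightarrow> 1) at_top"
      using \<delta> by real_asymp
    moreover have "((\<lambda>b. (\<delta> + c / b) powr (2 - s)) \<longlongrightarrow> (\<delta> + 0) powr (2 - s)) at_top"
    proof (intro tendsto_intros)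
      show "((\<lambda>b. c / b) \<longlongrightarrow> 0) at_top" by real_asymp
    qed (use \<delta> in auto)
    ultimately have "((\<lambda>b. M * (q / \<delta>)\<^sup>2 * K * ((b * (ln b / b)\<^sup>2 * b powr q * b powr (2 - s)) * exp (q * c * ln b / (\<delta> * b)) * (\<delta> + c / b) powr (2 - s)))
      \<longlongrightarrow> M * (q / \<delta>)\<^sup>2 * K * (0 * 1 * (\<delta> + 0) powr (2 - s))) at_top"
      by (intro tendsto_mult tendsto_const)
    then have "((\<lambda>b. M * (q / \<delta>)\<^sup>2 * K * ((b * (ln b / b)\<^sup>2 * b powr q * b powr (2 - s)) * exp (q * c * ln b / (\<delta> * b)) * (\<delta> + c / b) powr (2 - s)))
      \<longlongrightarrow> 0) at_top"
      by (simp only: mult_zero_left mult_zero_right)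
    then show ?thesis
    proof (rule Lim_transform_eventually)
      show "eventually (\<lambda>b. M * (q / \<delta>)\<^sup>2 * K * ((b * (ln b / b)\<^sup>2 * b powr q * b powr (2 - s)) * exp (q * c * ln b / (\<delta> * b)) * (\<delta> + c / b) powr (2 - s))
        = M * b * (q * ln b / (\<delta> * b))\<^sup>2 * exp (q * ln b / (\<delta> * b) * (\<delta> * b + c)) * (\<delta> * b + c) powr (2 - s) * K) at_top"
        using eventually_gt_at_top[of 1]
      proof eventually_elim
        case (elim b)
        have e1: "exp (q * ln b / (\<delta> * b) * (\<delta> * b + c)) = b powr q * exp (q * c * ln b / (\<delta> * b))"
        proof -
          have "q * ln b / (\<delta> * b) * (\<delta> * b + c) = q * ln b + q * c * ln b / (\<delta> * b)"
            using elim \<delta> by (simp add: field_simps)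
          then show ?thesis using elim by (simp add: exp_add powr_def)
        qed
        have "\<delta> * b + c = b * (\<delta> + c / b)"
          using elim by (simp add: field_simps)
        then have e2: "(\<delta> * b + c) powr (2 - s) = b powr (2 - s) * (\<delta> + c / b) powr (2 - s)"
          using elim c \<delta> by (simp add: powr_mult)
        have e3: "q * ln b / (\<delta> * b) = (q / \<delta>) * (ln b / b)" by simp
        show ?case unfolding e1 e2 unfolding e3 power_mult_distrib by (simp only: mult_ac)
      qed
    qed
  qed
  then have lim1: "((\<lambda>b. M * b * (l b)\<^sup>2 * exp (l b * (\<delta> * b + c)) * (\<delta> * b + c) powr (2 - s) * K) \<longlongrightarrow> 0) at_top"
    by (simp add: l_def)
  have ev1: "eventually (\<lambda>b. M * b * (l b)\<^sup>2 * exp (l b * (\<delta> * b + c)) * (\<delta> * b + c) powr (2 - s) * K < 1) at_top"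
    by (rule order_tendstoD[OF lim1]) simp
  have lim2: "((\<lambda>b. excess (\<delta> * b)) \<longlongrightarrow> 0) at_top"
    by (rule filterlim_compose[OF excess_tendsto_0]) (use \<delta> in real_asymp)
  have ev2: "eventually (\<lambda>b. excess (\<delta> * b) < \<kappa>' / (2 * M)) at_top"
    by (rule order_tendstoD[OF lim2]) (use \<kappa>' assms in simp)
  have single: "eventually (\<lambda>b. \<forall>n u. real n \<le> M * b \<longrightarrow> u \<in> U \<longrightarrow> measure seq.S (E b n u) \<le> exp 1 * b powr (- (p + 2))) at_top"
    using ev1 ev2 eventually_gt_at_top[of 1]
  proof eventually_elim
    case (elim b)
    show ?case
    proof (intro allI impI)
      fix n :: nat and u :: "real^'d"
      assume n: "real n \<le> M * b" and u: "u \<in> U"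
      define y where "y = l b * excess (\<delta> * b) + (l b)\<^sup>2 * exp (l b * (\<delta> * b + c)) * (\<delta> * b + c) powr (2 - s) * K"
      have l: "l b > 0" using elim q \<delta> by (simp add: l_def)
      have y: "y \<ge> 0" using l excess_nonneg K by (simp add: y_def)
      have "measure seq.S (E b n u) \<le> exp (- l b * (\<kappa>' * b)) * (1 + y) ^ n"
        unfolding E_def
      proof (rule chernoff_truncated[OF l])
        show "(\<integral>x. exp (l b * ((x - eta) \<bullet> u)) * indicator (cball 0 (\<delta> * b)) x \<partial>D) \<le> 1 + y"
          using mgf_truncated_le[OF s normU[OF u] l, of "\<delta> * b"] \<delta> elim by (simp add: y_def c_def K_def)
      qed (use y in auto)
      also have "(1 + y) ^ n \<le> exp y ^ n"
        using y exp_ge_add_one_self[of y] by (intro power_mono) auto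
      also have "exp y ^ n = exp (real n * y)"
        by (simp add: exp_of_nat_mult)
      also have "\<dots> \<le> exp (M * b * y)"
        using n y by (simp add: mult_right_mono)
      \<comment> \<open>The mean lost by truncation uses up at most half of the exponent
        \<open>l * \<kappa>' * b\<close>, and the quadratic terms of all steps together add at most
        1.\<close>
      also have "\<dots> \<le> exp (l b * \<kappa>' * b / 2 + 1)"
      proof -
        have "M * b * (l b * excess (\<delta> * b)) \<le> M * b * (l b * (\<kappa>' / (2 * M)))"
          using elim l assms by (intro mult_left_mono) auto
        also have "\<dots> = l b * \<kappa>' * b / 2" using assms by simp
        finally have "M * b * (l b * excess (\<delta> * b)) \<le> l b * \<kappa>' * b / 2" .
        moreover have "M * b * y = M * b * (l b * excess (\<delta> * b))
            + M * b * (l b)\<^sup>2 * exp (l b * (\<delta> * b + c)) * (\<delta> * b + c) powr (2 - s) * K"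
          unfolding y_def by (simp only: distrib_left mult.assoc)
        ultimately have "M * b * y \<le> l b * \<kappa>' * b / 2 + 1"
          using elim by linarith
        then show ?thesis by simp
      qed
      finally have "measure seq.S (E b n u) \<le> exp (- l b * (\<kappa>' * b)) * exp (l b * \<kappa>' * b / 2 + 1)"
        by simp
      also have "\<dots> = exp (1 - l b * \<kappa>' * b / 2)"
        by (simp add: exp_add[symmetric])
      also have "l b * \<kappa>' * b / 2 = (p + 2) * ln b"
        using q \<kappa>' p elim by (simp add: l_def \<delta>_def field_simps)
      also have "exp (1 - (p + 2) * ln b) = exp 1 * b powr (- (p + 2))"
      proof -
        have "b powr (- (p + 2)) = exp (- (p + 2) * ln b)"
          using elim by (simp add: powr_def)
        then show ?thesis
          by (simp only: diff_conv_add_uminus exp_add mult_minus_left)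
      qed
      finally show "measure seq.S (E b n u) \<le> exp 1 * b powr (- (p + 2))"
        by simp
    qed
  qed
  have final: "eventually (\<lambda>b.
    \<P>(x in seq.S. \<exists>n. real n \<le> M * b \<and> (\<forall>i<n. norm (x i) \<le> \<delta> * b) \<and> norm (W x n) > \<kappa> * b) \<le> e * g b) at_top"
    if e: "e > 0" for e
  proof -
    have lim3: "((\<lambda>b. (M * b + 1) * real (card U) * exp 1 * b powr (- (p + 2)) / (C * (b * b powr (- p)))) \<longlongrightarrow> 0) at_top"
    proof -
      have "((\<lambda>b. real (card U) * exp 1 / C * ((M * b + 1) / b ^ 3)) \<longlongrightarrow> 0) at_top"
        using assms by real_asymp
      then show ?thesis
      proof (rule Lim_transform_eventually)
        show "eventually (\<lambda>b. real (card U) * exp 1 / C * ((M * b + 1) / b ^ 3)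
           = (M * b + 1) * real (card U) * exp 1 * b powr (- (p + 2)) / (C * (b * b powr (- p)))) at_top"
          using eventually_gt_at_top[of 1]
        proof eventually_elim
          case (elim b)
          have e1: "b powr (- (p + 2)) = b powr (- p) / b ^ 2"
            using elim powr_realpow[of b 2] by (simp add: powr_diff)
          have "b powr (- p) > 0" using elim by simp
          then show ?case
            unfolding e1 using elim p(2)
            by (simp add: field_simps power2_eq_square power3_eq_cube)
        qed
      qed
    qed
    have "eventually (\<lambda>b. (M * b + 1) * real (card U) * exp 1 * b powr (- (p + 2)) / (C * (b * b powr (- p))) < e) at_top"
      by (rule order_tendstoD(2)[OF lim3 e])
    then show ?thesis
      using single p(3) eventually_gt_at_top[of 1]
    proof eventually_elim
      case (elim b)
      define N where "N = nat \<lfloor>M * b\<rfloor>"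
      have N: "real n \<le> M * b \<longleftrightarrow> n \<le> N" for n
        using elim assms unfolding N_def by (intro real_le_iff_le_nat_floor) auto
      have NM: "real N \<le> M * b" by (simp add: N[of N])
      let ?B = "{x \<in> space seq.S. \<exists>n. real n \<le> M * b \<and> (\<forall>i<n. norm (x i) \<le> \<delta> * b) \<and> norm (W x n) > \<kappa> * b}"
      have Em: "E b n u \<in> sets seq.S" for n u
        unfolding E_def by measurable
      have "?B \<subseteq> (\<Union>(n, u)\<in>{..N} \<times> U. E b n u)"
      proof
        fix x assume "x \<in> ?B"
        then obtain n where n: "n \<le> N" "\<forall>i<n. norm (x i) \<le> \<delta> * b" "norm (W x n) > \<kappa> * b"
          by (auto simp: N)
        have "\<exists>i. \<bar>W x n $ i\<bar> \<ge> \<kappa>' * b"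
        proof (rule ccontr)
          assume "\<nexists>i. \<bar>W x n $ i\<bar> \<ge> \<kappa>' * b"
          then have "(\<Sum>i\<in>UNIV. \<bar>W x n $ i\<bar>) \<le> (\<Sum>i\<in>(UNIV::'d set). \<kappa>' * b)"
            by (intro sum_mono) (auto simp: not_le less_imp_le)
          also have "\<dots> = \<kappa> * b" by (simp add: \<kappa>'_def)
          finally show False using n(3) norm_le_l1_cart[of "W x n"] by simp
        qed
        then obtain i where "\<bar>W x n $ i\<bar> \<ge> \<kappa>' * b" by blast
        then have "W x n \<bullet> axis i 1 \<ge> \<kappa>' * b \<or> W x n \<bullet> (- axis i 1) \<ge> \<kappa>' * b"
          by (auto simp: inner_axis abs_if split: if_splits)
        then obtain u where "u \<in> U" "W x n \<bullet> u \<ge> \<kappa>' * b"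
          unfolding U_def by blast
        then have "x \<in> E b n u" "(n, u) \<in> {..N} \<times> U"
          using n by (auto simp: E_def)
        then show "x \<in> (\<Union>(n, u)\<in>{..N} \<times> U. E b n u)" by blast
      qed
      then have "measure seq.S ?B \<le> measure seq.S (\<Union>(n, u)\<in>{..N} \<times> U. E b n u)"
        by (intro seq.P.finite_measure_mono sets.finite_UN) (auto simp: finU Em)
      also have "\<dots> \<le> (\<Sum>(n, u)\<in>{..N} \<times> U. measure seq.S (E b n u))"
        using measure_UNION_le[of "{..N} \<times> U" "\<lambda>(n, u). E b n u" seq.S] by (auto simp: finU Em split_beta')
      also have "\<dots> \<le> (\<Sum>(n, u)\<in>{..N} \<times> U. exp 1 * b powr (- (p + 2)))"
        using elim by (intro sum_mono) (auto simp: N)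
      also have "\<dots> = (real N + 1) * real (card U) * (exp 1 * b powr (- (p + 2)))"
        by (simp add: card_cartesian_product split_beta' algebra_simps)
      also have "\<dots> \<le> (M * b + 1) * real (card U) * (exp 1 * b powr (- (p + 2)))"
        using NM by (intro mult_right_mono) auto
      also have "\<dots> \<le> e * (C * (b * b powr (- p)))"
        using elim p by (simp add: divide_simps mult_ac split: if_splits)
      also have "\<dots> \<le> e * g b"
        using elim e by (simp add: g_def mult_ac)
      finally show ?case .
    qed
  qed
  show ?thesis
    using \<delta> final by blast
qed

section \<open>Independence, and deviations of order \<open>b\<close>\<close>

lemma prob_component: "Measurable.pred borel P \<Longrightarrow> \<P>(x in seq.S. P (x i)) = \<P>(x in D. P x)"
proof -
  assume [measurable]: "Measurable.pred borel P"
  have "\<P>(x in D. P x) = measure (distr seq.S D (\<lambda>x. x i)) {x \<in> space D. P x}"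
    by (subst seq.PiM_component) auto
  also have "\<dots> = \<P>(x in seq.S. P (x i))"
    by (subst measure_distr) (auto simp: vimage_def)
  finally show ?thesis ..
qed

text \<open>Gluing the first \<open>n\<close> entries of one sequence to an independent second
  sequence preserves the law. Under the gluing map the preimage of the joint event is a rectangle,
  whose measure factors.\<close>

lemma prob_indep_prefix:
  assumes [measurable]: "Measurable.pred seq.S A" "Measurable.pred seq.S B"
    and prefix: "\<And>x y. (\<And>i. i < n \<Longrightarrow> x i = y i) \<Longrightarrow> A x = A y"
  shows "\<P>(x in seq.S. A x \<and> B (\<lambda>i. x (n + i))) = \<P>(x in seq.S. A x) * \<P>(x in seq.S. B x)"
proof -
  have shift: "(\<lambda>x. (\<lambda>i. x (n + i))) \<in> seq.S \<rightarrow>\<^sub>M seq.S"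
    by (rule measurable_PiM_single') auto
  have [measurable]: "Measurable.pred seq.S (\<lambda>x. B (\<lambda>i. x (n + i)))"
    by (rule measurable_compose[OF shift assms(2)])
  have AA: "A (comb_seq n x y) = A x" for x y
    by (rule prefix) (simp add: comb_seq_less)
  have BB: "B (\<lambda>i. comb_seq n x y (n + i)) = B y" for x y
  proof -
    have "(\<lambda>i. comb_seq n x y (n + i)) = y"
      by (rule ext) (simp add: comb_seq_add add.commute[of n])
    then show ?thesis by simp
  qed
  have "emeasure seq.S {x \<in> space seq.S. A x \<and> B (\<lambda>i. x (n + i))}
      = emeasure (distr (seq.S \<Otimes>\<^sub>M seq.S) seq.S (\<lambda>(\<omega>, \<omega>'). comb_seq n \<omega> \<omega>')) {x \<in> space seq.S. A x \<and> B (\<lambda>i. x (n + i))}"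
    by (simp only: seq.PiM_comb_seq)
  also have "\<dots> = emeasure (seq.S \<Otimes>\<^sub>M seq.S) ((\<lambda>(\<omega>, \<omega>'). comb_seq n \<omega> \<omega>') -` {x \<in> space seq.S. A x \<and> B (\<lambda>i. x (n + i))} \<inter> space (seq.S \<Otimes>\<^sub>M seq.S))"
    by (intro emeasure_distr measurable_comb_seq) measurable
  also have "(\<lambda>(\<omega>, \<omega>'). comb_seq n \<omega> \<omega>') -` {x \<in> space seq.S. A x \<and> B (\<lambda>i. x (n + i))} \<inter> space (seq.S \<Otimes>\<^sub>M seq.S)
     = {x \<in> space seq.S. A x} \<times> {x \<in> space seq.S. B x}"
    by (auto simp: space_pair_measure AA BB)
  also have "emeasure (seq.S \<Otimes>\<^sub>M seq.S) \<dots> = emeasure seq.S {x \<in> space seq.S. A x} * emeasure seq.S {x \<in> space seq.S. B x}"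
    by (rule seq.P.emeasure_pair_measure_Times) measurable
  finally show ?thesis
    by (simp add: seq.P.emeasure_eq_measure ennreal_mult[symmetric] del: space_S)
qed

text \<open>Either all increments are below \<open>\<delta> * b\<close>, which is negligible, or one
  of order \<open>b\<close> many increments is above it, which costs at most order
  \<open>b * tail (\<delta> * b)\<close> and hence order \<open>g b\<close>.\<close>

lemma prob_deviation_le:
  assumes "0 < \<kappa>" "0 < M"
  shows "\<exists>K>0. eventually (\<lambda>b. \<P>(x in seq.S. \<exists>n. real n \<le> M * b \<and> norm (W x n) > \<kappa> * b) \<le> K * g b) at_top"
proof -
  obtain \<delta> where \<delta>: "\<delta> > 0" and *: "\<And>e. e > 0 \<Longrightarrow> eventually (\<lambda>b.
    \<P>(x in seq.S. \<exists>n. real n \<le> M * b \<and> (\<forall>i<n. norm (x i) \<le> \<delta> * b) \<and> norm (W x n) > \<kappa> * b) \<le> e * g b) at_top"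
    using small_jumps_deviation[OF assms] by blast
  obtain K where K: "K > 0" "eventually (\<lambda>b. tail (\<delta> * b) \<le> K * tail b) at_top"
    using H_scale_le[OF \<delta>] by blast
  have "eventually (\<lambda>b. \<P>(x in seq.S. \<exists>n. real n \<le> M * b \<and> norm (W x n) > \<kappa> * b) \<le> (1 + 2 * M * K) * g b) at_top"
    \<comment> \<open>From \<open>b > 1 / M\<close> follows \<open>1 \<le> M * b\<close>, so there
      are at most \<open>2 * M * b\<close> indices up to \<open>M * b\<close>.\<close>
    using *[OF zero_less_one] K(2) eventually_gt_at_top[of "1 / M"]
  proof eventually_elim
    case (elim b)
    have "0 < 1 / M" using assms by simp
    also have "1 / M < b" by fact
    finally have "0 < b" .
    moreover have "1 \<le> M * b" using elim assms by (simp add: field_simps)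
    ultimately have b: "b > 0" "1 \<le> M * b" by auto
    define N where "N = nat \<lfloor>M * b\<rfloor>"
    have N: "real n \<le> M * b \<longleftrightarrow> n \<le> N" for n
      using b unfolding N_def by (intro real_le_iff_le_nat_floor) auto
    have NM: "real N \<le> M * b" by (simp add: N[of N])
    let ?A = "{x \<in> space seq.S. \<exists>n. real n \<le> M * b \<and> (\<forall>i<n. norm (x i) \<le> \<delta> * b) \<and> norm (W x n) > \<kappa> * b}"
    let ?B = "\<lambda>i. {x \<in> space seq.S. norm (x i) > \<delta> * b}"
    have "{x \<in> space seq.S. \<exists>n. real n \<le> M * b \<and> norm (W x n) > \<kappa> * b} \<subseteq> ?A \<union> (\<Union>i\<in>{..N}. ?B i)"
    proof
      fix x assume "x \<in> {x \<in> space seq.S. \<exists>n. real n \<le> M * b \<and> norm (W x n) > \<kappa> * b}"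
      then obtain n where n: "x \<in> space seq.S" "real n \<le> M * b" "norm (W x n) > \<kappa> * b"
        by blast
      show "x \<in> ?A \<union> (\<Union>i\<in>{..N}. ?B i)"
      proof (cases "\<forall>i<n. norm (x i) \<le> \<delta> * b")
        case True
        with n show ?thesis by blast
      next
        case False
        then obtain i where "i < n" "norm (x i) > \<delta> * b" by (auto simp: not_le)
        moreover from this n(2) have "i \<le> N" by (simp add: N)
        ultimately show ?thesis using n(1) by blast
      qed
    qed
    then have "\<P>(x in seq.S. \<exists>n. real n \<le> M * b \<and> norm (W x n) > \<kappa> * b) \<le> measure seq.S (?A \<union> (\<Union>i\<in>{..N}. ?B i))"
      by (intro seq.P.finite_measure_mono) measurable
    also have "\<dots> \<le> measure seq.S ?A + measure seq.S (\<Union>i\<in>{..N}. ?B i)"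
      by (intro measure_Un_le) measurable
    also have "measure seq.S (\<Union>i\<in>{..N}. ?B i) \<le> (\<Sum>i\<in>{..N}. measure seq.S (?B i))"
      by (intro measure_UNION_le) (auto simp del: space_S)
    also have "\<dots> = (real N + 1) * tail (\<delta> * b)"
      using prob_component[of "\<lambda>x. norm x > \<delta> * b"] by (simp add: tail_def)
    also have "\<dots> \<le> (2 * M * b) * (K * tail b)"
      using elim b NM H_nonneg K by (intro mult_mono) auto
    also have "\<dots> = 2 * M * K * g b" by (simp add: g_def)
    finally show ?case using elim by (simp add: algebra_simps)
  qed
  then show ?thesis
    using K assms by (intro exI[of _ "1 + 2 * M * K"]) (auto intro: add_pos_pos)
qed

lemma prob_deviation_small:
  assumes "0 < \<kappa>" "0 < M" "0 < e"
  shows "eventually (\<lambda>b. \<P>(x in seq.S. \<exists>n. real n \<le> M * b \<and> norm (W x n) > \<kappa> * b) \<le> e) at_top"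
proof -
  obtain K where K: "K > 0" "eventually (\<lambda>b. \<P>(x in seq.S. \<exists>n. real n \<le> M * b \<and> norm (W x n) > \<kappa> * b) \<le> K * g b) at_top"
    using prob_deviation_le[OF assms(1,2)] by blast
  have "eventually (\<lambda>b. g b < e / K) at_top"
    by (rule order_tendstoD[OF g_tendsto_0]) (use K assms in simp)
  with K(2) show ?thesis
    by eventually_elim (use K(1) in \<open>simp add: field_simps\<close>)
qed

text \<open>Controls hits at late times. Times beyond \<open>R\<close> are cut into dyadic blocks;
  on the block from \<open>2 ^ j * R\<close> to twice that, a deviation proportional to time is a
  deviation of the order of the block, and the resulting bounds sum geometrically.\<close>

lemma prob_far_deviation_le:
  assumes "0 < c"
  shows "\<exists>K>0. eventually (\<lambda>R. \<P>(x in seq.S. \<exists>n. real n > R \<and> norm (W x n) > c * real n) \<le> K * g R) at_top"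
proof -
  obtain K where K: "K > 0" "eventually (\<lambda>b. \<P>(x in seq.S. \<exists>n. real n \<le> 2 * b \<and> norm (W x n) > c * b) \<le> K * g b) at_top"
    using prob_deviation_le[OF assms, of 2] by auto
  obtain b0 where b0: "\<And>b. b \<ge> b0 \<Longrightarrow> \<P>(x in seq.S. \<exists>n. real n \<le> 2 * b \<and> norm (W x n) > c * b) \<le> K * g b"
    using K(2) by (auto simp: eventually_at_top_linorder)
  obtain \<rho> b1 where \<rho>: "0 < \<rho>" "\<rho> < 1" "1 \<le> b1"
    and *: "\<And>b k. b \<ge> b1 \<Longrightarrow> g (2 ^ k * b) \<le> \<rho> ^ k * g b"
    using g_dyadic by blast
  have "\<P>(x in seq.S. \<exists>n. real n > R \<and> norm (W x n) > c * real n) \<le> (K / (1 - \<rho>)) * g R"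
    if R: "R \<ge> max b0 b1" for R
  proof -
    define E where "E j = {x \<in> space seq.S. \<exists>n. real n \<le> 2 * (2 ^ j * R) \<and> norm (W x n) > c * (2 ^ j * R)}" for j :: nat
    have R0: "R > 0" using R \<rho> by simp
    have Em: "E j \<in> sets seq.S" for j
      unfolding E_def by measurable
    have E_le: "measure seq.S (E j) \<le> K * g R * \<rho> ^ j" for j
    proof -
      have "1 * R \<le> 2 ^ j * R" using R0 by (intro mult_right_mono) auto
      then have "measure seq.S (E j) \<le> K * g (2 ^ j * R)"
        unfolding E_def using R by (intro b0) simp
      also have "\<dots> \<le> K * (\<rho> ^ j * g R)"
        using *[of R j] R K(1) by (intro mult_left_mono) auto
      finally show ?thesis by (simp add: mult_ac)
    qed
    have summ: "summable (\<lambda>j. K * g R * \<rho> ^ j)"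
      using \<rho> by (intro summable_mult summable_geometric) simp
    then have summE: "summable (\<lambda>j. measure seq.S (E j))"
      by (rule summable_comparison_test'[where N = 0]) (simp add: E_le)
    have "{x \<in> space seq.S. \<exists>n. real n > R \<and> norm (W x n) > c * real n} \<subseteq> (\<Union>j. E j)"
    proof safe
      fix x n assume n: "x \<in> space seq.S" "real n > R" "norm (W x n) > c * real n"
      obtain k where k: "2 ^ k * R < real n" "real n \<le> 2 ^ Suc k * R"
        using dyadic_bracket[OF R0 n(2)] by blast
      have "c * (2 ^ k * R) \<le> c * real n"
        using k assms by (intro mult_left_mono) auto
      with n(3) have "norm (W x n) > c * (2 ^ k * R)" by linarith
      moreover have "real n \<le> 2 * (2 ^ k * R)" using k by simp
      ultimately have "x \<in> E k" using n(1) unfolding E_def by blast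
      then show "x \<in> (\<Union>j. E j)" by blast
    qed
    then have "\<P>(x in seq.S. \<exists>n. real n > R \<and> norm (W x n) > c * real n) \<le> measure seq.S (\<Union>j. E j)"
      using Em by (intro seq.P.finite_measure_mono) auto
    also have "\<dots> \<le> (\<Sum>j. measure seq.S (E j))"
      using Em summE by (intro seq.P.finite_measure_subadditive_countably) auto
    also have "\<dots> \<le> (\<Sum>j. K * g R * \<rho> ^ j)"
      by (intro suminf_le E_le summE summ)
    also have "\<dots> = K * g R * (\<Sum>j. \<rho> ^ j)"
      using \<rho> by (intro suminf_mult summable_geometric) simp
    also have "(\<Sum>j. \<rho> ^ j) = 1 / (1 - \<rho>)"
      using \<rho> by (intro suminf_geometric) simp
    finally show ?thesis by simp
  qed
  moreover have "K / (1 - \<rho>) > 0" using K \<rho> by simp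
  ultimately show ?thesis
    unfolding eventually_at_top_linorder by blast
qed

end

section \<open>The target set and the integrated tail\<close>

lemma rfun_gt_iff: "rfun b v a z > u \<longleftrightarrow> (\<exists>j. z \<bullet> v j - a j * b > u)"
  unfolding rfun_def by (subst Max_gr_iff) auto

lemma rfun_le_iff: "rfun b v a z \<le> u \<longleftrightarrow> (\<forall>j. z \<bullet> v j - a j * b \<le> u)"
  unfolding rfun_def by (subst Max_le_iff) auto

lemma rfun_ge: "z \<bullet> v j - a j * b \<le> rfun b v a z"
  using rfun_le_iff[of b v a z "rfun b v a z"] by simp

text \<open>A Lipschitz constant of \<open>rfun b v a\<close>, the same for all
  \<open>b\<close>.\<close>

definition vmax :: "('j::finite \<Rightarrow> real^'d) \<Rightarrow> real" where
  "vmax v = (MAX j. norm (v j))"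

lemma norm_le_vmax: "norm (v j) \<le> vmax v"
  unfolding vmax_def by (intro Max_ge) auto

lemma vmax_nonneg: "0 \<le> vmax v"
  using norm_le_vmax[of v] norm_ge_zero order_trans by blast

lemma inner_le_vmax: "w \<bullet> v j \<le> vmax v * norm w"
proof -
  have "w \<bullet> v j \<le> norm w * norm (v j)" by (rule norm_cauchy_schwarz)
  also have "\<dots> \<le> norm w * vmax v" by (intro mult_left_mono norm_le_vmax) auto
  finally show ?thesis by (simp add: mult.commute)
qed

lemma rfun_add_le: "rfun b v a (z + w) \<le> rfun b v a z + vmax v * norm w"
  unfolding rfun_le_iff
proof
  fix j
  show "(z + w) \<bullet> v j - a j * b \<le> rfun b v a z + vmax v * norm w"
    using rfun_ge[of z v j a b] inner_le_vmax[of w v j] by (simp add: inner_add_left)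
qed

lemma rfun_add_ge: "rfun b v a z - vmax v * norm w \<le> rfun b v a (z + w)"
  using rfun_add_le[of b v a "z + w" "- w"] by simp

text \<open>Since every normal has inner product \<open>-1\<close> with the drift, the drift lowers
  all the half-space functionals at unit speed and hence their maximum. Time and level are thus
  measured in the same unit.\<close>

lemma rfun_shift:
  assumes "\<And>j. eta \<bullet> v j = -1"
  shows "rfun b v a (z + t *\<^sub>R eta) = rfun b v a z - t"
proof -
  have "rfun b v a (z + t *\<^sub>R eta) \<le> u \<longleftrightarrow> rfun b v a z - t \<le> u" for u
    using rfun_le_iff[of b v a z "u + t"]
    by (simp add: rfun_le_iff inner_add_left assms algebra_simps)
  from this[of "rfun b v a (z + t *\<^sub>R eta)"] this[of "rfun b v a z - t"] show ?thesis by simp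
qed

lemma mem_dilate_iff:
  assumes "b > 0"
  shows "z \<in> dilate b (halfspaces v a) \<longleftrightarrow> rfun b v a z > 0"
proof -
  have "z \<in> dilate b (halfspaces v a) \<longleftrightarrow> (1 / b) *\<^sub>R z \<in> halfspaces v a"
    using assms by (auto simp: dilate_def image_iff intro!: bexI[of _ "(1 / b) *\<^sub>R z"])
  also have "\<dots> \<longleftrightarrow> rfun b v a z > 0"
    using assms by (simp add: halfspaces_def rfun_gt_iff field_simps)
  finally show ?thesis .
qed

lemma measurable_rfun [measurable]: "rfun b v a \<in> borel_measurable borel"
  unfolding rfun_def by measurable

lemma card_nat_interval_le:
  assumes "0 \<le> w"
  shows "finite {k::nat. u \<le> real k \<and> real k < u + w}" "real (card {k::nat. u \<le> real k \<and> real k < u + w}) \<le> w + 1"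
proof -
  let ?A = "{k::nat. u \<le> real k \<and> real k < u + w}"
  have fin: "finite ?A"
  proof (rule finite_subset)
    show "?A \<subseteq> {..nat \<lceil>u + w\<rceil>}"
      by (auto, linarith)
  qed simp
  then show "finite ?A" .
  show "real (card ?A) \<le> w + 1"
  proof (cases "?A = {}")
    case True
    show ?thesis unfolding True using assms by simp
  next
    case False
    define k0 where "k0 = Min ?A"
    have "k0 \<in> ?A" unfolding k0_def using fin False by (rule Min_in)
    have "?A \<subseteq> {k0..<k0 + nat \<lceil>w\<rceil>}"
    proof
      fix k assume k: "k \<in> ?A"
      then have "k0 \<le> k" unfolding k0_def using fin by (intro Min_le)
      moreover have "real k < real k0 + w" using k \<open>k0 \<in> ?A\<close> by simp
      then have "k < k0 + nat \<lceil>w\<rceil>" by linarith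
      ultimately show "k \<in> {k0..<k0 + nat \<lceil>w\<rceil>}" by simp
    qed
    then have "card ?A \<le> card {k0..<k0 + nat \<lceil>w\<rceil>}"
      by (intro card_mono) auto
    then have "real (card ?A) \<le> real (nat \<lceil>w\<rceil>)" by simp
    also have "\<dots> \<le> w + 1" using assms by linarith
    finally show ?thesis .
  qed
qed

section \<open>Truncated mean and integrated tail\<close>

context rv_increments
begin

definition trunc_mean :: "real \<Rightarrow> real" where
  "trunc_mean R = (\<integral>x. norm x * indicator {x. norm x > R} x \<partial>D)"

lemma integrable_trunc_mean: "integrable D (\<lambda>x. norm x * indicator {x. norm x > R} x)"
  by (intro integrable_real_mult_indicator) auto

lemma trunc_mean_le: "\<exists>K>0. eventually (\<lambda>b. trunc_mean b \<le> K * g b) at_top"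
  using truncated_mean_le by (simp add: trunc_mean_def)

lemma trunc_mean_nonneg: "0 \<le> trunc_mean R"
  unfolding trunc_mean_def by (intro integral_nonneg_AE) auto

lemma trunc_mean_scale_le:
  assumes "c > 0"
  shows "\<exists>K>0. eventually (\<lambda>b. trunc_mean (c * b) \<le> K * g b) at_top"
proof -
  obtain K where K: "K > 0" "eventually (\<lambda>b. trunc_mean b \<le> K * g b) at_top"
    using trunc_mean_le by blast
  obtain K' where K': "K' > 0" "eventually (\<lambda>b. g (c * b) \<le> K' * g b) at_top"
    using g_scale_le[OF assms] by blast
  have "filterlim (\<lambda>b. c * b) at_top at_top"
    using assms by real_asymp
  with K(2) have "eventually (\<lambda>b. trunc_mean (c * b) \<le> K * g (c * b)) at_top"
    by (rule eventually_compose_filterlim)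
  with K'(2) have "eventually (\<lambda>b. trunc_mean (c * b) \<le> (K * K') * g b) at_top"
  proof eventually_elim
    case (elim b)
    have "K * g (c * b) \<le> K * (K' * g b)"
      using elim K(1) by (intro mult_left_mono) auto
    then show ?case using elim by simp
  qed
  then show ?thesis using K(1) K'(1) by (intro exI[of _ "K * K'"]) simp
qed

lemma trunc_mean_scale_small:
  assumes "e > 0"
  shows "\<exists>M0>0. \<forall>M\<ge>M0. eventually (\<lambda>b. trunc_mean (M * b) \<le> e * g b) at_top"
proof -
  obtain K where K: "K > 0" "eventually (\<lambda>b. trunc_mean b \<le> K * g b) at_top"
    using trunc_mean_le by blast
  obtain M0 where M0: "M0 > 0" "\<And>M. M \<ge> M0 \<Longrightarrow> eventually (\<lambda>b. g (M * b) \<le> (e / K) * g b) at_top"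
    using g_scale_small[of "e / K"] assms K by auto
  have "eventually (\<lambda>b. trunc_mean (M * b) \<le> e * g b) at_top" if "M \<ge> M0" for M
  proof -
    have "M > 0" using that M0 by simp
    then have "filterlim (\<lambda>b. M * b) at_top at_top"
      by real_asymp
    with K(2) have "eventually (\<lambda>b. trunc_mean (M * b) \<le> K * g (M * b)) at_top"
      by (rule eventually_compose_filterlim)
    with M0(2)[OF that] show ?thesis
    proof eventually_elim
      case (elim b)
      have "K * g (M * b) \<le> K * (e / K * g b)"
        using elim K(1) by (intro mult_left_mono) auto
      then show ?case using elim K(1) by simp
    qed
  qed
  then show ?thesis using M0(1) by blast
qed

text \<open>The integral of \<open>P(r > t)\<close> over \<open>t > u\<close>. The level
  \<open>u\<close> counts steps of the walk, as the drift lowers \<open>r\<close> by one per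
  step.\<close>

definition Iex :: "('j::finite \<Rightarrow> real^'d) \<Rightarrow> ('j \<Rightarrow> real) \<Rightarrow> real \<Rightarrow> real \<Rightarrow> real" where
  "Iex v a b u = (\<integral>x. max 0 (rfun b v a x - u) \<partial>D)"

lemma integrable_rfun: "integrable D (\<lambda>x. rfun b v a (x + s))"
proof (rule Bochner_Integration.integrable_bound)
  show "integrable D (\<lambda>x. \<bar>rfun b v a s\<bar> + vmax v * norm x)"
    by (intro Bochner_Integration.integrable_add integrable_mult_right) auto
  have "\<bar>rfun b v a (x + s)\<bar> \<le> \<bar>rfun b v a s\<bar> + vmax v * norm x" for x
    using rfun_add_le[of b v a s x] rfun_add_ge[of b v a s x]
      abs_ge_self[of "rfun b v a s"] abs_ge_minus_self[of "rfun b v a s"]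
    unfolding add.commute[of x s] abs_le_iff by linarith
  then show "AE x in D. norm (rfun b v a (x + s)) \<le> norm (\<bar>rfun b v a s\<bar> + vmax v * norm x)"
    using vmax_nonneg[of v] by simp
qed simp

lemma integrable_Iex: "integrable D (\<lambda>x. max 0 (rfun b v a x - u))"
  using integrable_rfun[of b v a 0] by (intro integrable_max Bochner_Integration.integrable_diff) auto

lemma Iex_nonneg: "0 \<le> Iex v a b u"
  unfolding Iex_def by (intro integral_nonneg_AE) auto

lemma integrable_indicator_gt: "integrable D (\<lambda>x. c * indicator {x. rfun b v a x > u} x :: real)"
  by (intro integrable_mult_right integrable_real_indicator) (auto simp: emeasure_eq_measure)

text \<open>The function is convex in \<open>u\<close> with slope \<open>- P(r > u)\<close>, so a
  difference lies between the length of the interval times the tail at its two ends. This bound and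
  its counterpart \<open>Iex_diff_ge\<close> take the place of differentiation.\<close>

lemma Iex_diff_le:
  assumes "u \<le> u'"
  shows "Iex v a b u - Iex v a b u' \<le> (u' - u) * \<P>(x in D. rfun b v a x > u)"
proof -
  have "Iex v a b u - Iex v a b u' = (\<integral>x. max 0 (rfun b v a x - u) - max 0 (rfun b v a x - u') \<partial>D)"
    unfolding Iex_def by (intro Bochner_Integration.integral_diff[symmetric] integrable_Iex)
  also have "\<dots> \<le> (\<integral>x. (u' - u) * indicator {x. rfun b v a x > u} x \<partial>D)"
    using assms
    by (intro integral_mono Bochner_Integration.integrable_diff integrable_Iex integrable_indicator_gt)
       (auto simp: indicator_def)
  also have "\<dots> = (u' - u) * \<P>(x in D. rfun b v a x > u)"
    by simp
  finally show ?thesis .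
qed

lemma Iex_diff_ge:
  assumes "u \<le> u'"
  shows "(u' - u) * \<P>(x in D. rfun b v a x > u') \<le> Iex v a b u - Iex v a b u'"
proof -
  have "(u' - u) * \<P>(x in D. rfun b v a x > u') = (\<integral>x. (u' - u) * indicator {x. rfun b v a x > u'} x \<partial>D)"
    by simp
  also have "\<dots> \<le> (\<integral>x. max 0 (rfun b v a x - u) - max 0 (rfun b v a x - u') \<partial>D)"
    using assms
    by (intro integral_mono Bochner_Integration.integrable_diff integrable_Iex integrable_indicator_gt)
       (auto simp: indicator_def)
  also have "\<dots> = Iex v a b u - Iex v a b u'"
    unfolding Iex_def by (intro Bochner_Integration.integral_diff integrable_Iex)
  finally show ?thesis .
qed

lemma Iex_antimono:
  assumes "u \<le> u'"
  shows "Iex v a b u' \<le> Iex v a b u"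
proof -
  have "0 \<le> (u' - u) * \<P>(x in D. rfun b v a x > u')"
    using assms by (intro mult_nonneg_nonneg) auto
  with Iex_diff_ge[OF assms, of b v a] show ?thesis by linarith
qed

end

section \<open>Targets made of half-spaces adapted to the drift\<close>

locale rv_target = rv_increments D \<alpha> for D :: "(real^'d) measure" and \<alpha> :: real +
  fixes v :: "'m::finite \<Rightarrow> real^'d" and a :: "'m \<Rightarrow> real"
  assumes eta_v: "\<And>j. eta \<bullet> v j = -1"
    and a_pos: "\<And>j. a j > 0"
begin

abbreviation r :: "real \<Rightarrow> real^'d \<Rightarrow> real" where "r b \<equiv> rfun b v a"

text \<open>For \<open>b \<ge> 0\<close> one has \<open>r b 0 = - amin * b\<close>: this is how far
  below the target the walk starts.\<close>

definition amin :: real where "amin = (MIN j. a j)"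

abbreviation L :: real where "L \<equiv> vmax v"

lemma amin_le: "amin \<le> a j"
  unfolding amin_def by (intro Min_le) auto

lemma amin_pos: "amin > 0"
  unfolding amin_def using a_pos by (subst Min_gr_iff) auto

lemma L_pos: "L > 0"
proof -
  have "v undefined \<noteq> 0" using eta_v[of undefined] by auto
  then show ?thesis using norm_le_vmax[of v undefined] by (meson less_le_trans zero_less_norm_iff)
qed

lemma r_le:
  assumes "b \<ge> 0"
  shows "r b x \<le> L * norm x - amin * b"
  unfolding rfun_le_iff
proof
  fix j
  show "x \<bullet> v j - a j * b \<le> L * norm x - amin * b"
    using inner_le_vmax[of x v j] mult_right_mono[OF amin_le[of j] assms] by linarith
qed

lemma prob_r_le:
  assumes "b \<ge> 0"
  shows "\<P>(x in D. r b x > - w) \<le> tail ((amin * b - w) / L)"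
  unfolding tail_def
proof (intro finite_measure_mono)
  show "{x \<in> space D. r b x > - w} \<subseteq> {x \<in> space D. norm x > (amin * b - w) / L}"
  proof safe
    fix x assume "- w < r b x"
    then have "amin * b - w < L * norm x" using r_le[OF assms, of x] by linarith
    then show "(amin * b - w) / L < norm x" using L_pos by (simp add: field_simps)
  qed
qed measurable

text \<open>By \<open>r_le\<close>, exceeding the level \<open>u\<close> requires an increment of
  norm above \<open>(amin * b + u) / L\<close>, and the excess is then at most \<open>L\<close>
  times that norm.\<close>

lemma Iex_le_trunc_mean:
  assumes "b \<ge> 0" "u \<ge> 0"
  shows "Iex v a b u \<le> L * trunc_mean ((amin * b + u) / L)"
proof -
  have "Iex v a b u \<le> (\<integral>x. L * (norm x * indicator {x. norm x > (amin * b + u) / L} x) \<partial>D)"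
    unfolding Iex_def
  proof (intro integral_mono integrable_Iex integrable_mult_right integrable_trunc_mean)
    fix x
    show "max 0 (r b x - u) \<le> L * (norm x * indicator {x. norm x > (amin * b + u) / L} x)"
    proof (cases "norm x > (amin * b + u) / L")
      case True
      have "r b x \<le> L * norm x"
        using r_le[OF assms(1), of x] mult_nonneg_nonneg[of amin b] amin_pos assms by linarith
      moreover have "0 \<le> L * norm x" using L_pos by simp
      ultimately show ?thesis using True assms by simp
    next
      case False
      then have "L * norm x \<le> amin * b + u" using L_pos by (simp add: field_simps not_less)
      then show ?thesis using False r_le[OF assms(1), of x] by simp
    qed
  qed
  also have "\<dots> = L * trunc_mean ((amin * b + u) / L)"
    by (simp add: trunc_mean_def)
  finally show ?thesis .
qed

lemma Iex_le_g: "\<exists>K>0. eventually (\<lambda>b. Iex v a b 0 \<le> K * g b) at_top"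
proof -
  have "amin / L > 0" using amin_pos L_pos by simp
  then obtain K where K: "K > 0" "eventually (\<lambda>b. trunc_mean (amin / L * b) \<le> K * g b) at_top"
    using trunc_mean_scale_le by blast
  have "eventually (\<lambda>b. Iex v a b 0 \<le> (L * K) * g b) at_top"
    using K(2) eventually_ge_at_top[of 0]
  proof eventually_elim
    case (elim b)
    have "Iex v a b 0 \<le> L * trunc_mean (amin / L * b)"
      using Iex_le_trunc_mean[of b 0] elim by simp
    also have "\<dots> \<le> L * (K * g b)" using elim L_pos by (intro mult_left_mono) auto
    finally show ?case by simp
  qed
  then show ?thesis using K L_pos by (intro exI[of _ "L * K"]) simp
qed

lemma Iex_small:
  assumes "e > 0"
  shows "\<exists>M0>0. \<forall>M\<ge>M0. eventually (\<lambda>b. Iex v a b (M * b) \<le> e * g b) at_top"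
proof -
  obtain M0 where M0: "M0 > 0" "\<And>M. M \<ge> M0 \<Longrightarrow> eventually (\<lambda>b. trunc_mean (M * b) \<le> (e / L) * g b) at_top"
    using trunc_mean_scale_small[of "e / L"] assms L_pos by auto
  have "eventually (\<lambda>b. Iex v a b (M * b) \<le> e * g b) at_top" if "M \<ge> L * M0" for M
  proof -
    have M: "(amin + M) / L \<ge> M0" using that L_pos amin_pos by (simp add: field_simps)
    have "M > 0" using that L_pos M0(1) by (meson less_le_trans mult_pos_pos)
    show ?thesis
      using M0(2)[OF M] eventually_ge_at_top[of 0]
    proof eventually_elim
      case (elim b)
      have "Iex v a b (M * b) \<le> L * trunc_mean ((amin + M) / L * b)"
        using Iex_le_trunc_mean[of b "M * b"] elim \<open>M > 0\<close> by (simp add: algebra_simps)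
      also have "\<dots> \<le> L * (e / L * g b)" using elim L_pos by (intro mult_left_mono) auto
      finally show ?case using L_pos by simp
    qed
  qed
  then show ?thesis using M0(1) L_pos by (intro exI[of _ "L * M0"]) simp
qed

end

section \<open>The hitting probability\<close>

context rv_increments
begin

definition walk :: "(nat \<Rightarrow> real^'d) \<Rightarrow> nat \<Rightarrow> real^'d" where
  "walk x n = (\<Sum>i<n. x i)"

lemma walk_eq: "walk x n = W x n + real n *\<^sub>R eta"
  by (simp add: walk_def W_def sum_subtractf sum_constant_scaleR del: sum_constant)

text \<open>The last increment is left uncentred: a big jump is added to the position in the tube at
  time \<open>n\<close>, so only \<open>n\<close> steps of drift are split off.\<close>

lemma walk_Suc: "walk x (Suc n) = x n + W x n + real n *\<^sub>R eta"
  by (simp add: walk_def W_def sum_subtractf sum_constant_scaleR del: sum_constant)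

lemma walk_add: "walk x (n + m) = walk x n + walk (\<lambda>i. x (n + i)) m"
  by (induction m) (simp_all add: walk_def algebra_simps)

lemma measurable_walk [measurable]: "(\<lambda>x. walk x n) \<in> borel_measurable seq.S"
  unfolding walk_def by measurable

end

context rv_target
begin

definition hit :: "real \<Rightarrow> (nat \<Rightarrow> real^'d) set" where
  "hit b = {x \<in> space seq.S. \<exists>n. r b (walk x n) > 0}"

text \<open>The size of the last increment is not prescribed: when
  \<open>L * \<kappa> < amin\<close> the tube misses the target, so entering the target at time
  \<open>Suc n\<close> is itself the big jump, and at most one \<open>n\<close> applies to a given
  path.\<close>

definition good :: "real \<Rightarrow> real \<Rightarrow> nat \<Rightarrow> (nat \<Rightarrow> real^'d) set" where
  "good \<kappa> b n = {x \<in> space seq.S. (\<forall>k\<le>n. norm (W x k) \<le> \<kappa> * b) \<and> r b (walk x (Suc n)) > 0}"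

lemma sets_hit [measurable]: "hit b \<in> sets seq.S"
  unfolding hit_def by measurable

lemma sets_good [measurable]: "good \<kappa> b n \<in> sets seq.S"
  unfolding good_def by measurable

lemma good_subset_hit: "good \<kappa> b n \<subseteq> hit b"
  by (auto simp: good_def hit_def)

lemma r_walk: "r b (walk x n) = r b (W x n) - real n"
  unfolding walk_eq by (rule rfun_shift[OF eta_v])

lemma r_walk_le: "b \<ge> 0 \<Longrightarrow> r b (walk x n) \<le> L * norm (W x n) - amin * b - real n"
  using r_le[of b "W x n"] by (simp add: r_walk)

lemma tube_r_neg:
  assumes "b > 0" "L * \<kappa> < amin" "norm (W x n) \<le> \<kappa> * b"
  shows "r b (walk x n) < 0"
proof -
  have "L * norm (W x n) \<le> L * (\<kappa> * b)" using assms L_pos by (intro mult_left_mono) auto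
  also have "\<dots> < amin * b" using assms by simp
  finally show ?thesis using r_walk_le[of b x n] assms by simp
qed

lemma disjoint_good:
  assumes "b > 0" "L * \<kappa> < amin"
  shows "disjoint_family (good \<kappa> b)"
proof -
  have False if "x \<in> good \<kappa> b n" "x \<in> good \<kappa> b m" "n < m" for x n m
    using that tube_r_neg[OF assms, of x "Suc n"] by (auto simp: good_def)
  then show ?thesis
    unfolding disjoint_family_on_def by (metis disjoint_iff linorder_neqE_nat)
qed

text \<open>Summation and expectation are exchanged: a fixed \<open>x\<close> lies in the
  \<open>k\<close>-th strip for at most \<open>\<rho> + \<rho>' + 1\<close> values of
  \<open>k\<close>, and for none unless \<open>r b x > - \<rho>\<close>. Hence the bound does not
  grow with \<open>N\<close>.\<close>

lemma sum_prob_strip_le: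
  assumes "0 \<le> \<rho>" "0 \<le> \<rho>'"
  shows "(\<Sum>k\<le>N. \<P>(x in D. - \<rho> < r b x - real k \<and> r b x - real k \<le> \<rho>'))
    \<le> (\<rho> + \<rho>' + 1) * \<P>(x in D. r b x > - \<rho>)"
proof -
  have "(\<Sum>k\<le>N. \<P>(x in D. - \<rho> < r b x - real k \<and> r b x - real k \<le> \<rho>'))
    = (\<integral>x. (\<Sum>k\<le>N. indicator {x. - \<rho> < r b x - real k \<and> r b x - real k \<le> \<rho>'} x) \<partial>D)"
    by (subst Bochner_Integration.integral_sum) (auto simp: emeasure_eq_measure)
  also have "\<dots> \<le> (\<integral>x. (\<rho> + \<rho>' + 1) * indicator {x. r b x > - \<rho>} x \<partial>D)"
  proof (rule integral_mono)
    fix x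
    have "(\<Sum>k\<le>N. indicator {x. - \<rho> < r b x - real k \<and> r b x - real k \<le> \<rho>'} x)
       = real (card {k\<in>{..N}. - \<rho> < r b x - real k \<and> r b x - real k \<le> \<rho>'})"
      by (simp add: indicator_def sum.If_cases Int_def)
    also have "\<dots> \<le> real (card {k::nat. r b x - \<rho>' \<le> real k \<and> real k < (r b x - \<rho>') + (\<rho> + \<rho>')})"
      using assms by (intro of_nat_mono card_mono card_nat_interval_le) auto
    also have "\<dots> \<le> \<rho> + \<rho>' + 1"
      using assms by (intro card_nat_interval_le) auto
    finally have le: "(\<Sum>k\<le>N. indicator {x. - \<rho> < r b x - real k \<and> r b x - real k \<le> \<rho>'} x) \<le> \<rho> + \<rho>' + 1" .
    show "(\<Sum>k\<le>N. indicator {x. - \<rho> < r b x - real k \<and> r b x - real k \<le> \<rho>'} x) \<le> (\<rho> + \<rho>' + 1) * indicator {x. r b x > - \<rho>} x"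
    proof (cases "r b x > - \<rho>")
      case False
      then have "(\<Sum>k\<le>N. indicator {x. - \<rho> < r b x - real k \<and> r b x - real k \<le> \<rho>'} x) = (0::real)"
        by (intro sum.neutral) auto
      then show ?thesis using False by simp
    qed (use le in simp)
  qed (auto simp: emeasure_eq_measure intro!: integrable_mult_right)
  also have "\<dots> = (\<rho> + \<rho>' + 1) * \<P>(x in D. r b x > - \<rho>)"
    by simp
  finally show ?thesis .
qed

text \<open>A path that hits the target off the good event either hits it late, or deviates without a big
  jump, or makes its first big jump to a place close to the boundary of the target, or deviates
  once more after its first big jump.\<close>

lemma hit_diff_good_subset:
  assumes b: "b > 0" and M: "M > 0" and \<kappa>: "0 \<le> \<kappa>'" "\<kappa>' \<le> \<kappa>" "L * \<kappa>' \<le> \<rho>" "2 * \<rho> < amin"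
  shows "hit b - (\<Union>n\<in>{n. real n \<le> M * b}. good \<kappa> b n) \<subseteq>
      {x \<in> space seq.S. \<exists>n. real n > M * b \<and> norm (W x n) > (1 / (2 * L)) * real n}
    \<union> {x \<in> space seq.S. \<exists>n. real n \<le> M * b \<and> (\<forall>i<n. norm (x i) \<le> \<delta> * b) \<and> norm (W x n) > \<kappa>' * b}
    \<union> (\<Union>k\<in>{..nat \<lfloor>M * b\<rfloor>}. {x \<in> space seq.S. - (2 * \<rho> * b) < r b (x k) - real k \<and> r b (x k) - real k \<le> \<rho> * b})
    \<union> (\<Union>k\<in>{..nat \<lfloor>M * b\<rfloor>}. {x \<in> space seq.S. norm (x k) > \<delta> * b \<and>
          (\<exists>n. real n \<le> M * b \<and> norm (W (\<lambda>i. x (Suc k + i)) n) > (\<rho> / L) * b)})"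
    (is "_ \<subseteq> ?E1 \<union> ?E2 \<union> ?E3 \<union> ?E4")
proof
  fix x assume x: "x \<in> hit b - (\<Union>n\<in>{n. real n \<le> M * b}. good \<kappa> b n)"
  have sp: "x \<in> space seq.S" by simp
  have N: "real n \<le> M * b \<longleftrightarrow> n \<le> nat \<lfloor>M * b\<rfloor>" for n
    using b M by (intro real_le_iff_le_nat_floor) simp
  define n0 where "n0 = (LEAST n. r b (walk x n) > 0)"
  have n0: "r b (walk x n0) > 0"
    using x unfolding hit_def n0_def by (auto intro: LeastI)
  have before: "r b (walk x n) \<le> 0" if "n < n0" for n
    using not_less_Least[of n "\<lambda>n. r b (walk x n) > 0"] that unfolding n0_def by auto
  have \<rho>: "\<rho> \<ge> 0" using \<kappa> L_pos by (meson less_imp_le mult_nonneg_nonneg order_trans)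
  have Wn0: "L * norm (W x n0) > amin * b + real n0"
    using r_walk_le[of b x n0] n0 b by simp
  show "x \<in> ?E1 \<union> ?E2 \<union> ?E3 \<union> ?E4"
  proof (cases "real n0 > M * b")
    case True
    have "amin * b > 0" using b amin_pos by simp
    then have "real n0 < L * norm (W x n0)" using Wn0 by linarith
    then have "real n0 < 2 * (L * norm (W x n0))"  by linarith
    then have "norm (W x n0) > (1 / (2 * L)) * real n0"
      using L_pos by (simp add: field_simps)
    then have "x \<in> ?E1" using True sp by blast
    then show ?thesis by blast
  next
    case False
    then have n0M: "real n0 \<le> M * b" by simp
    show ?thesis
    proof (cases "x \<in> ?E2")
      case notE2: False
      have small: "norm (W x n) \<le> \<kappa>' * b" if "real n \<le> M * b" "\<forall>i<n. norm (x i) \<le> \<delta> * b" for n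
        using notE2 that sp not_le by blast
      have "\<exists>i<n0. norm (x i) > \<delta> * b"
      proof (rule ccontr)
        assume "\<not> (\<exists>i<n0. norm (x i) > \<delta> * b)"
        then have "\<forall>i<n0. norm (x i) \<le> \<delta> * b" by (meson not_less)
        then have "norm (W x n0) \<le> \<kappa>' * b" by (rule small[OF n0M])
        then have "r b (walk x n0) < 0"
        proof (rule tube_r_neg[OF b, rotated])
          show "L * \<kappa>' < amin" using \<kappa> \<rho> amin_pos by linarith
        qed
        then show False using n0 by simp
      qed
      then have exk: "\<exists>k. k < n0 \<and> norm (x k) > \<delta> * b" by blast
      \<comment> \<open>The first big jump leads from time \<open>k\<close> to \<open>Suc k\<close>.
        All increments before it are small, so the path is still in the narrow tube at time
        \<open>k\<close>.\<close>
      define k where "k = (LEAST k. k < n0 \<and> norm (x k) > \<delta> * b)"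
      have k: "k < n0" "norm (x k) > \<delta> * b"
        using LeastI_ex[OF exk] unfolding k_def by auto
      have before_k: "norm (x i) \<le> \<delta> * b" if "i < k" for i
        using not_less_Least[of i "\<lambda>k. k < n0 \<and> norm (x k) > \<delta> * b"] that k unfolding k_def by auto
      have tube: "norm (W x j) \<le> \<kappa>' * b" if "j \<le> k" for j
      proof (rule small)
        show "real j \<le> M * b" using that k n0M by simp
      qed (use that before_k in auto)
      have kN: "k \<le> nat \<lfloor>M * b\<rfloor>" using k n0M by (simp add: N)
      have "n0 \<noteq> Suc k"
      proof
        assume "n0 = Suc k"
        moreover have "\<kappa>' * b \<le> \<kappa> * b" using \<kappa> b by simp
        ultimately have "x \<in> good \<kappa> b k"
          using tube n0 sp order_trans unfolding good_def by blast
        moreover have "real k \<le> M * b" using kN by (simp add: N)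
        ultimately show False using x by blast
      qed
      then have kn0: "Suc k < n0" using k by simp
      have Wk: "L * norm (W x k) \<le> \<rho> * b"
      proof -
        have "L * norm (W x k) \<le> L * (\<kappa>' * b)" using tube[of k] L_pos by (intro mult_left_mono) auto
        also have "\<dots> \<le> \<rho> * b" using \<kappa> b by simp
        finally show ?thesis .
      qed
      have rS: "r b (walk x (Suc k)) = r b (x k + W x k) - real k"
        unfolding walk_Suc by (rule rfun_shift[OF eta_v])
      \<comment> \<open>At time \<open>Suc k\<close> the target has not been hit. If the walk is
        then within \<open>\<rho> * b\<close> of the boundary, the increment lies in a strip;
        removing \<open>W x k\<close> costs another \<open>\<rho> * b\<close>, hence the bound
        \<open>2 * \<rho> * b\<close>. Otherwise \<open>r\<close> must still be raised by
        \<open>\<rho> * b\<close> after the jump, which is a second deviation.\<close>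
      show ?thesis
      proof (cases "r b (walk x (Suc k)) > - (\<rho> * b)")
        case True
        have "x \<in> ?E3"
        proof -
          have "r b (x k) \<le> r b (x k + W x k) + \<rho> * b" "r b (x k + W x k) \<le> r b (x k) + \<rho> * b"
            using rfun_add_ge[of b v a "x k" "W x k"] rfun_add_le[of b v a "x k" "W x k"] Wk by auto
          then have "- (2 * \<rho> * b) < r b (x k) - real k" "r b (x k) - real k \<le> \<rho> * b"
            using True rS before[OF kn0] by auto
          then show ?thesis using kN sp by blast
        qed
        then show ?thesis by blast
      next
        case False
        define m where "m = n0 - Suc k"
        have m: "n0 = Suc k + m" using kn0 by (simp add: m_def)
        define Y where "Y = W (\<lambda>i. x (Suc k + i)) m"
        have "walk x n0 = walk x (Suc k) + walk (\<lambda>i. x (Suc k + i)) m"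
          unfolding m by (rule walk_add)
        also have "walk (\<lambda>i. x (Suc k + i)) m = Y + real m *\<^sub>R eta"
          unfolding Y_def by (rule walk_eq)
        finally have "r b (walk x n0) = r b (walk x (Suc k) + Y) - real m"
          by (simp add: rfun_shift[OF eta_v] add.assoc[symmetric])
        then have "L * norm Y > \<rho> * b"
          using rfun_add_le[of b v a "walk x (Suc k)" Y] n0 False by simp
        then have "norm Y > (\<rho> / L) * b"
          using L_pos by (simp add: field_simps)
        moreover have "real m \<le> M * b" using n0M m by simp
        ultimately have "x \<in> ?E4"
          using k kN sp unfolding Y_def by blast
        then show ?thesis by blast
      qed
    qed blast
  qed
qed

text \<open>Each of the four exceptional events receives a quarter of \<open>e\<close>. The horizon
  is found before the tube radius, which is still free when the density bounds dictate how narrow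
  the tube must be.\<close>

lemma prob_hit_diff_good_le:
  assumes e: "e > 0"
  shows "\<exists>M0>0. \<forall>M\<ge>M0. \<forall>\<kappa>>0. eventually (\<lambda>b.
    measure seq.S (hit b - (\<Union>n\<in>{n. real n \<le> M * b}. good \<kappa> b n)) \<le> e * g b) at_top"
proof -
  define e4 where "e4 = e / 4"
  have e4: "e4 > 0" using e by (simp add: e4_def)
  have "1 / (2 * L) > 0" using L_pos by simp
  then obtain K1 where K1: "K1 > 0"
    "eventually (\<lambda>R. \<P>(x in seq.S. \<exists>n. real n > R \<and> norm (W x n) > (1 / (2 * L)) * real n) \<le> K1 * g R) at_top"
    using prob_far_deviation_le by blast
  obtain M0 where M0: "M0 > 0" "\<And>M. M \<ge> M0 \<Longrightarrow> eventually (\<lambda>b. g (M * b) \<le> (e4 / K1) * g b) at_top"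
    using g_scale_small[of "e4 / K1"] e4 K1 by auto
  have "amin / (2 * L) > 0" using amin_pos L_pos by simp
  then obtain K3 where K3: "K3 > 0" "eventually (\<lambda>b. tail (amin / (2 * L) * b) \<le> K3 * tail b) at_top"
    using H_scale_le by blast
  have "eventually (\<lambda>b. measure seq.S (hit b - (\<Union>n\<in>{n. real n \<le> M * b}. good \<kappa> b n)) \<le> e * g b) at_top"
    if MM: "M \<ge> M0" and \<kappa>: "\<kappa> > 0" for M \<kappa>
  proof -
    have M: "M > 0" using MM M0 by simp
    \<comment> \<open>The sum over the strips is at most \<open>4 * \<rho> * b\<close> times a tail,
      that is \<open>4 * \<rho> * K3 * g b\<close>; the other bound keeps the strips well above the
      level \<open>- amin * b\<close> of the origin.\<close>
    define \<rho> where "\<rho> = min (amin / 8) (e4 / (4 * K3))"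
    have \<rho>: "\<rho> > 0" "4 * \<rho> < amin" "4 * \<rho> * K3 \<le> e4"
      using amin_pos e4 K3 by (auto simp: \<rho>_def min_def field_simps)
    \<comment> \<open>Within this narrower tube the position moves \<open>r\<close> by at most
      \<open>\<rho> * b\<close>.\<close>
    define \<kappa>' where "\<kappa>' = min \<kappa> (\<rho> / L)"
    have \<kappa>': "\<kappa>' > 0" "\<kappa>' \<le> \<kappa>" "L * \<kappa>' \<le> \<rho>"
      using \<kappa> \<rho> L_pos by (auto simp: \<kappa>'_def min_def field_simps)
    obtain \<delta> where \<delta>: "\<delta> > 0" and E2: "\<And>e. e > 0 \<Longrightarrow> eventually (\<lambda>b.
      \<P>(x in seq.S. \<exists>n. real n \<le> M * b \<and> (\<forall>i<n. norm (x i) \<le> \<delta> * b) \<and> norm (W x n) > \<kappa>' * b) \<le> e * g b) at_top"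
      using small_jumps_deviation[OF \<kappa>'(1) M] by blast
    obtain K4 where K4: "K4 > 0" "eventually (\<lambda>b. tail (\<delta> * b) \<le> K4 * tail b) at_top"
      using H_scale_le[OF \<delta>] by blast
    have E1: "eventually (\<lambda>b. \<P>(x in seq.S. \<exists>n. real n > M * b \<and> norm (W x n) > (1 / (2 * L)) * real n) \<le> K1 * g (M * b)) at_top"
    proof (rule eventually_compose_filterlim[OF K1(2)])
      show "filterlim (\<lambda>b. M * b) at_top at_top" using M by real_asymp
    qed
    have \<rho>L: "\<rho> / L > 0" using \<rho> L_pos by simp
    \<comment> \<open>The denominator cancels the at most \<open>2 * M * b\<close> possible times of
      the first big jump and the constant in its tail.\<close>
    have e4': "e4 / (2 * M * K4) > 0" using e4 M K4 by simp
    show ?thesis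
      using E1 E2[OF e4] K3(2) K4(2) M0(2)[OF MM] prob_deviation_small[OF \<rho>L M e4']
        eventually_ge_at_top[of "max 1 (max (1 / M) (1 / \<rho>))"]
    proof eventually_elim
      case (elim b)
      have b: "b > 0" "1 \<le> M * b" "1 \<le> \<rho> * b"
        using elim M \<rho> by (auto simp: field_simps)
      define N where "N = nat \<lfloor>M * b\<rfloor>"
      have NM: "real N \<le> M * b"
        unfolding N_def using b by (simp add: real_le_iff_le_nat_floor)
      let ?E1 = "{x \<in> space seq.S. \<exists>n. real n > M * b \<and> norm (W x n) > (1 / (2 * L)) * real n}"
      let ?E2 = "{x \<in> space seq.S. \<exists>n. real n \<le> M * b \<and> (\<forall>i<n. norm (x i) \<le> \<delta> * b) \<and> norm (W x n) > \<kappa>' * b}"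
      let ?E3 = "\<lambda>k. {x \<in> space seq.S. - (2 * \<rho> * b) < r b (x k) - real k \<and> r b (x k) - real k \<le> \<rho> * b}"
      let ?E4 = "\<lambda>k. {x \<in> space seq.S. norm (x k) > \<delta> * b \<and>
          (\<exists>n. real n \<le> M * b \<and> norm (W (\<lambda>i. x (Suc k + i)) n) > (\<rho> / L) * b)}"
      have [measurable]: "(\<lambda>x. W (\<lambda>i. x (Suc k + i)) n) \<in> borel_measurable seq.S" for k n
        unfolding W_def by measurable
      have m3: "?E3 k \<in> sets seq.S" for k by measurable
      have m4: "?E4 k \<in> sets seq.S" for k by measurable
      have m1: "?E1 \<in> sets seq.S" by measurable
      have m2: "?E2 \<in> sets seq.S" by measurable
      have p1: "measure seq.S ?E1 \<le> e4 * g b"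
      proof -
        have "K1 * g (M * b) \<le> K1 * (e4 / K1 * g b)"
          using elim K1(1) by (intro mult_left_mono) auto
        then show ?thesis using elim(1) K1(1) by simp
      qed
      have p3: "measure seq.S (\<Union>k\<in>{..N}. ?E3 k) \<le> e4 * g b"
      proof -
        have "measure seq.S (\<Union>k\<in>{..N}. ?E3 k) \<le> (\<Sum>k\<le>N. measure seq.S (?E3 k))"
          using m3 by (intro measure_UNION_le) auto
        also have "\<dots> = (\<Sum>k\<le>N. \<P>(x in D. - (2 * \<rho> * b) < r b x - real k \<and> r b x - real k \<le> \<rho> * b))"
          by (intro sum.cong refl prob_component) measurable
        also have "\<dots> \<le> (2 * \<rho> * b + \<rho> * b + 1) * \<P>(x in D. r b x > - (2 * \<rho> * b))"
          using \<rho> b by (intro sum_prob_strip_le) auto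
        also have "\<dots> \<le> (4 * \<rho> * b) * tail (amin / (2 * L) * b)"
        proof (intro mult_mono)
          have "\<P>(x in D. r b x > - (2 * \<rho> * b)) \<le> tail ((amin * b - 2 * \<rho> * b) / L)"
            using b by (intro prob_r_le) simp
          also have "\<dots> \<le> tail (amin / (2 * L) * b)"
          proof (rule H_mono)
            have "4 * \<rho> * b \<le> amin * b" using \<rho> b by simp
            then have "amin * b / 2 \<le> amin * b - 2 * \<rho> * b" by linarith
            then have "(amin * b / 2) / L \<le> (amin * b - 2 * \<rho> * b) / L"
              using L_pos by (intro divide_right_mono) auto
            then show "amin / (2 * L) * b \<le> (amin * b - 2 * \<rho> * b) / L" by simp
          qed
          finally show "\<P>(x in D. r b x > - (2 * \<rho> * b)) \<le> tail (amin / (2 * L) * b)" .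
        qed (use b \<rho> in auto)
        also have "\<dots> \<le> (4 * \<rho> * b) * (K3 * tail b)"
          using elim b \<rho> by (intro mult_left_mono) auto
        also have "\<dots> = (4 * \<rho> * K3) * g b" by (simp add: g_def)
        also have "\<dots> \<le> e4 * g b"
          using \<rho> g_pos[OF b(1)] by (intro mult_right_mono) auto
        finally show ?thesis .
      qed
      have p4: "measure seq.S (\<Union>k\<in>{..N}. ?E4 k) \<le> e4 * g b"
      proof -
        \<comment> \<open>The deviation after the jump uses only increments from index
          \<open>Suc k\<close> on, so it is independent of the jump. Its probability tends to 0 and
          multiplies the tail, which makes two deviations cheaper than any fixed multiple of
          \<open>g b\<close>.\<close>
        have single: "measure seq.S (?E4 k) \<le> tail (\<delta> * b) * (e4 / (2 * M * K4))" for k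
        proof -
          have "measure seq.S (?E4 k) = \<P>(x in seq.S. norm (x k) > \<delta> * b) *
             \<P>(x in seq.S. \<exists>n. real n \<le> M * b \<and> norm (W x n) > (\<rho> / L) * b)"
          proof (rule prob_indep_prefix[where n = "Suc k" and A = "\<lambda>x. norm (x k) > \<delta> * b"
                and B = "\<lambda>x. \<exists>n. real n \<le> M * b \<and> norm (W x n) > (\<rho> / L) * b"])
            fix x y :: "nat \<Rightarrow> real^'d" assume "\<And>i. i < Suc k \<Longrightarrow> x i = y i"
            from this[of k] show "(norm (x k) > \<delta> * b) = (norm (y k) > \<delta> * b)" by simp
          qed measurable
          also have "\<P>(x in seq.S. norm (x k) > \<delta> * b) = tail (\<delta> * b)"
            unfolding tail_def by (rule prob_component) measurable
          also have "tail (\<delta> * b) * \<P>(x in seq.S. \<exists>n. real n \<le> M * b \<and> norm (W x n) > (\<rho> / L) * b)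
            \<le> tail (\<delta> * b) * (e4 / (2 * M * K4))"
            using elim H_nonneg by (intro mult_left_mono) auto
          finally show ?thesis .
        qed
        have "measure seq.S (\<Union>k\<in>{..N}. ?E4 k) \<le> (\<Sum>k\<le>N. measure seq.S (?E4 k))"
          using m4 by (intro measure_UNION_le) auto
        also have "\<dots> \<le> (\<Sum>k\<le>N. tail (\<delta> * b) * (e4 / (2 * M * K4)))"
          by (intro sum_mono single)
        also have "\<dots> = (real N + 1) * (tail (\<delta> * b) * (e4 / (2 * M * K4)))"
          by (simp add: algebra_simps)
        also have "\<dots> \<le> (2 * M * b) * (K4 * tail b * (e4 / (2 * M * K4)))"
          using NM b elim e4' H_nonneg[of "\<delta> * b"] M by (intro mult_mono mult_right_mono mult_nonneg_nonneg) auto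
        also have "\<dots> = e4 * g b" using M K4 by (simp add: g_def)
        finally show ?thesis .
      qed
      have "measure seq.S (hit b - (\<Union>n\<in>{n. real n \<le> M * b}. good \<kappa> b n))
         \<le> measure seq.S (?E1 \<union> ?E2 \<union> (\<Union>k\<in>{..N}. ?E3 k) \<union> (\<Union>k\<in>{..N}. ?E4 k))"
        using m1 m2 m3 m4 b M \<kappa>' \<rho> unfolding N_def
        by (intro seq.P.finite_measure_mono hit_diff_good_subset sets.Un sets.finite_UN) auto
      also have "\<dots> \<le> measure seq.S (?E1 \<union> ?E2 \<union> (\<Union>k\<in>{..N}. ?E3 k)) + measure seq.S (\<Union>k\<in>{..N}. ?E4 k)"
        using m1 m2 m3 m4 by (intro measure_Un_le sets.Un sets.finite_UN) auto
      also have "measure seq.S (?E1 \<union> ?E2 \<union> (\<Union>k\<in>{..N}. ?E3 k)) \<le> measure seq.S (?E1 \<union> ?E2) + measure seq.S (\<Union>k\<in>{..N}. ?E3 k)"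
        using m1 m2 m3 by (intro measure_Un_le sets.Un sets.finite_UN) auto
      also have "measure seq.S (?E1 \<union> ?E2) \<le> measure seq.S ?E1 + measure seq.S ?E2"
        using m1 m2 by (intro measure_Un_le) auto
      finally show ?case
        using p1 p3 p4 elim(2) by (simp add: e4_def)
    qed
  qed
  then show ?thesis using M0(1) by blast
qed

text \<open>Disjoint one-jump scenarios: stay in the tube up to time \<open>n\<close>, then take an
  increment that reaches the target whatever the position in the tube. Independence turns each
  probability into nearly \<open>P(r > n + u)\<close>, which dominates a difference of integrated
  tails.\<close>

lemma prob_hit_ge:
  assumes e: "e > 0"
  shows "eventually (\<lambda>b. Iex v a b 0 - e * g b \<le> measure seq.S (hit b)) at_top"
proof -
  obtain K1 where K1: "K1 > 0" "eventually (\<lambda>b. Iex v a b 0 \<le> K1 * g b) at_top"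
    using Iex_le_g by blast
  obtain M0 where M0: "M0 > 0" "\<And>M. M \<ge> M0 \<Longrightarrow> eventually (\<lambda>b. Iex v a b (M * b) \<le> (e / 3) * g b) at_top"
    using Iex_small[of "e / 3"] e by auto
  have "amin / L > 0" using amin_pos L_pos by simp
  then obtain K3 where K3: "K3 > 0" "eventually (\<lambda>b. tail (amin / L * b) \<le> K3 * tail b) at_top"
    using H_scale_le by blast
  \<comment> \<open>The first bound keeps the tube off the target. The second makes the loss from
    replacing the level 0 by \<open>u = L * \<kappa> * b\<close> at most
    \<open>e / 3 * g b\<close>.\<close>
  define \<kappa> where "\<kappa> = min (amin / (2 * L)) (e / (3 * L * K3))"
  have \<kappa>: "\<kappa> > 0" "L * \<kappa> < amin" "L * \<kappa> * K3 \<le> e / 3"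
  proof -
    show "\<kappa> > 0" using amin_pos L_pos e K3 by (simp add: \<kappa>_def)
    have "\<kappa> \<le> amin / (2 * L)" "\<kappa> \<le> e / (3 * L * K3)" by (auto simp: \<kappa>_def)
    then have "L * \<kappa> \<le> amin / 2" "L * \<kappa> * K3 \<le> e / 3" using L_pos K3 by (auto simp: field_simps)
    then show "L * \<kappa> < amin" "L * \<kappa> * K3 \<le> e / 3" using amin_pos by auto
  qed
  \<comment> \<open>The allowed probability of leaving the tube: it multiplies an integrated tail of
    size at most \<open>K1 * g b\<close>.\<close>
  define e' where "e' = min 1 (e / (3 * K1))"
  have e': "e' > 0" "e' \<le> 1" "e' * K1 \<le> e / 3"
  proof -
    show "e' > 0" "e' \<le> 1" using e K1 by (auto simp: e'_def)
    have "e' \<le> e / (3 * K1)" by (simp add: e'_def)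
    then show "e' * K1 \<le> e / 3" using K1 by (simp add: field_simps)
  qed
  show ?thesis
    using K1(2) M0(2)[OF order_refl] K3(2) prob_deviation_small[OF \<kappa>(1) M0(1) e'(1)] eventually_gt_at_top[of 0]
  proof eventually_elim
    case (elim b)
    have b: "b > 0" by fact
    define N where "N = nat \<lfloor>M0 * b\<rfloor>"
    have N: "real n \<le> M0 * b \<longleftrightarrow> n \<le> N" for n
      using b M0 unfolding N_def by (intro real_le_iff_le_nat_floor) auto
    \<comment> \<open>The largest amount by which a position in the tube can lower the value reached
      by the jump.\<close>
    define u where "u = L * \<kappa> * b"
    have u: "u \<ge> 0" using L_pos \<kappa> b by (simp add: u_def)
    define tube where "tube n x \<longleftrightarrow> (\<forall>k\<le>n. norm (W x k) \<le> \<kappa> * b)" for n x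
    have [measurable]: "Measurable.pred seq.S (tube n)" for n
      unfolding tube_def by measurable
    have p_tube: "\<P>(x in seq.S. tube n x) \<ge> 1 - e'" if "n \<le> N" for n
    proof -
      have "\<P>(x in seq.S. \<not> tube n x) \<le> \<P>(x in seq.S. \<exists>n. real n \<le> M0 * b \<and> norm (W x n) > \<kappa> * b)"
      proof (rule seq.P.finite_measure_mono)
        show "{x \<in> space seq.S. \<not> tube n x} \<subseteq> {x \<in> space seq.S. \<exists>n. real n \<le> M0 * b \<and> norm (W x n) > \<kappa> * b}"
          using that by (auto simp: tube_def N not_le intro: le_trans)
      qed measurable
      moreover have "\<P>(x in seq.S. \<not> tube n x) = 1 - \<P>(x in seq.S. tube n x)"
        by (rule seq.P.prob_neg) measurable
      ultimately show ?thesis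
        using elim by linarith
    qed
    define G where "G n = {x \<in> space seq.S. tube n x \<and> r b (x n) > real n + u}" for n
    have Gm: "G n \<in> sets seq.S" for n
      unfolding G_def by measurable
    have G_good: "G n \<subseteq> good \<kappa> b n" for n
    proof
      fix x assume x: "x \<in> G n"
      have "L * norm (W x n) \<le> L * (\<kappa> * b)"
        using x L_pos by (intro mult_left_mono) (auto simp: G_def tube_def)
      moreover have "r b (walk x (Suc n)) = r b (x n + W x n) - real n"
        unfolding walk_Suc by (rule rfun_shift[OF eta_v])
      ultimately have "r b (walk x (Suc n)) > 0"
        using x rfun_add_ge[of b v a "x n" "W x n"] by (simp add: G_def u_def)
      then show "x \<in> good \<kappa> b n" using x by (simp add: good_def G_def tube_def)
    qed
    have disj: "disjoint_family_on G {..N}"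
      using disjoint_good[OF b \<kappa>(2)] G_good unfolding disjoint_family_on_def by blast
    have pG: "measure seq.S (G n) \<ge> (1 - e') * (Iex v a b (u + real n) - Iex v a b (u + real (Suc n)))"
      if "n \<le> N" for n
    proof -
      have "measure seq.S (G n) = \<P>(x in seq.S. tube n x \<and> (\<lambda>y. r b (y 0) > real n + u) (\<lambda>i. x (n + i)))"
        by (simp add: G_def)
      also have "\<dots> = \<P>(x in seq.S. tube n x) * \<P>(x in seq.S. r b (x 0) > real n + u)"
      proof (rule prob_indep_prefix[where A = "tube n" and B = "\<lambda>y. r b (y 0) > real n + u"])
        fix x y :: "nat \<Rightarrow> real^'d" assume "\<And>i. i < n \<Longrightarrow> x i = y i"
        then have "W x k = W y k" if "k \<le> n" for k
          unfolding W_def using that by (intro sum.cong) auto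
        then show "tube n x = tube n y" by (simp add: tube_def)
      qed measurable
      also have "\<P>(x in seq.S. r b (x 0) > real n + u) = \<P>(x in D. r b x > real n + u)"
        by (rule prob_component) measurable
      finally have *: "measure seq.S (G n) = \<P>(x in seq.S. tube n x) * \<P>(x in D. r b x > real n + u)" .
      have "Iex v a b (u + real n) - Iex v a b (u + real (Suc n)) \<le> \<P>(x in D. r b x > real n + u)"
        using Iex_diff_le[of "u + real n" "u + real (Suc n)" v a b] by (simp add: add.commute)
      then show ?thesis
        unfolding * using p_tube[OF that] e' by (intro mult_mono) (auto intro: Iex_antimono)
    qed
    \<comment> \<open>The lower bounds telescope in \<open>n\<close>. Since \<open>Suc N\<close>
      exceeds \<open>M0 * b\<close>, the remaining far end is negligible.\<close>
    have "(1 - e') * (Iex v a b u - Iex v a b (u + real (Suc N)))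
      = (1 - e') * (\<Sum>n\<le>N. Iex v a b (u + real n) - Iex v a b (u + real (Suc n)))"
      using sum_telescope[of "\<lambda>n. Iex v a b (u + real n)" N] by simp
    also have "\<dots> \<le> (\<Sum>n\<le>N. measure seq.S (G n))"
      unfolding sum_distrib_left by (intro sum_mono pG) auto
    also have "\<dots> = measure seq.S (\<Union>n\<in>{..N}. G n)"
      using disj Gm by (intro seq.P.finite_measure_finite_Union[symmetric]) auto
    also have "\<dots> \<le> measure seq.S (hit b)"
      using G_good good_subset_hit by (intro seq.P.finite_measure_mono sets_hit) blast
    finally have main: "(1 - e') * (Iex v a b u - Iex v a b (u + real (Suc N))) \<le> measure seq.S (hit b)" .
    have i1: "Iex v a b (u + real (Suc N)) \<le> e / 3 * g b"
    proof -
      have "M0 * b \<le> u + real (Suc N)" using N[of "Suc N"] u by (simp add: not_le)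
      from Iex_antimono[OF this, of v a b] elim show ?thesis by simp
    qed
    have i2: "Iex v a b 0 - Iex v a b u \<le> e / 3 * g b"
    proof -
      have "Iex v a b 0 - Iex v a b u \<le> u * \<P>(x in D. r b x > 0)"
        using Iex_diff_le[of 0 u v a b] u by simp
      also have "\<dots> \<le> u * tail (amin / L * b)"
        using prob_r_le[of b 0] b u by (intro mult_left_mono) auto
      also have "\<dots> \<le> u * (K3 * tail b)"
        using elim u by (intro mult_left_mono) auto
      also have "\<dots> = (L * \<kappa> * K3) * g b" by (simp add: u_def g_def)
      also have "\<dots> \<le> e / 3 * g b" using \<kappa> g_pos[OF b] by (intro mult_right_mono) auto
      finally show ?thesis .
    qed
    have i3: "e' * Iex v a b u \<le> e / 3 * g b"
    proof -
      have "e' * Iex v a b u \<le> e' * (K1 * g b)"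
        using elim e' Iex_antimono[OF u, of v a b] by (intro mult_left_mono) auto
      also have "\<dots> = (e' * K1) * g b" by simp
      also have "\<dots> \<le> e / 3 * g b" using e' g_pos[OF b] by (intro mult_right_mono) auto
      finally show ?thesis .
    qed
    have "(1 - e') * Iex v a b (u + real (Suc N)) \<le> 1 * Iex v a b (u + real (Suc N))"
      using e' by (intro mult_right_mono Iex_nonneg) auto
    then show ?case
      using main i1 i2 i3 by (simp add: algebra_simps)
  qed
qed

end

section \<open>The approximating kernel\<close>

definition kernel_density ::
    "(real^'d) measure \<Rightarrow> real \<Rightarrow> real \<Rightarrow> real \<Rightarrow> real \<Rightarrow>
     ('j::finite \<Rightarrow> real^'d) \<Rightarrow> ('j \<Rightarrow> real) \<Rightarrow> real^'d \<Rightarrow> real^'d \<Rightarrow> real" where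
  "kernel_density D b \<theta> c \<delta>2 v a s0 s1 =
     pfun D b \<theta> c \<delta>2 v a s0 * indicator (jump_set b c v a s0) s1
         / measure (walk_kernel D s0) (jump_set b c v a s0)
       + (1 - pfun D b \<theta> c \<delta>2 v a s0)"

lemma jump_set_iff: "s1 \<in> jump_set b c v a s \<longleftrightarrow> (\<exists>j. (s1 - s) \<bullet> v j > c * (a j * b - s \<bullet> v j))"
  unfolding jump_set_def by (subst mem_Collect_eq, subst Max_gr_iff) auto

context rv_increments
begin

lemma measurable_jump_set [measurable]:
  "Measurable.pred (borel \<Otimes>\<^sub>M borel) (\<lambda>z. snd z \<in> jump_set b c v a (fst z :: real^'d))"
  unfolding jump_set_iff by measurable

lemma sets_jump_set [measurable]: "jump_set b c v a (s::real^'d) \<in> sets borel"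
proof -
  have "jump_set b c v a s = {s1 \<in> space borel. \<exists>j. (s1 - s) \<bullet> v j > c * (a j * b - s \<bullet> v j)}"
    by (auto simp: jump_set_iff)
  also have "\<dots> \<in> sets borel" by measurable
  finally show ?thesis .
qed

lemma sets_walk_kernel [simp, measurable_cong]: "sets (walk_kernel D s) = sets borel"
  by (simp add: walk_kernel_def)

lemma space_walk_kernel [simp]: "space (walk_kernel D s) = UNIV"
  by (simp add: walk_kernel_def)

lemma prob_space_walk_kernel: "prob_space (walk_kernel D s)"
  unfolding walk_kernel_def by (intro prob_space_distr) measurable

lemma measure_jump_set:
  "measure (walk_kernel D s) (jump_set b c v a s) = \<P>(x in D. \<exists>j. x \<bullet> v j > c * (a j * b - s \<bullet> v j))"
  unfolding walk_kernel_def by (subst measure_distr) (auto simp: vimage_def jump_set_iff)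

lemma measurable_jump_prob [measurable]:
  "(\<lambda>s. measure (walk_kernel D s) (jump_set b c v a s)) \<in> borel_measurable borel"
  unfolding measure_jump_set by measurable

lemma measurable_vfun [measurable]:
  fixes v :: "'j::finite \<Rightarrow> real^'d"
  assumes "b > 0"
  shows "vfun D b v a \<in> borel_measurable borel"
proof -
  have "vfun D b v a = (\<lambda>s. \<integral>t. indicator {0..} t *\<^sub>R \<P>(x in D. rfun b v a (x + t *\<^sub>R eta + s) > 0) \<partial>lborel)"
    using assms by (simp add: vfun_def set_lebesgue_integral_def mem_dilate_iff fun_eq_iff)
  also have "\<dots> \<in> borel_measurable borel"
    by measurable
  finally show ?thesis .
qed

lemma vfun_nonneg: "0 \<le> vfun D b v a s"
  unfolding vfun_def set_lebesgue_integral_def by (intro integral_nonneg_AE) auto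

lemma measurable_pfun:
  fixes v :: "'j::finite \<Rightarrow> real^'d"
  assumes "b > 0"
  shows "pfun D b \<theta> c \<delta>2 v a \<in> borel_measurable borel"
proof -
  note [measurable] = measurable_vfun[OF assms]
  show ?thesis unfolding pfun_def[abs_def] by measurable
qed

lemma pfun_bounds:
  assumes "\<theta> \<ge> 0"
  shows "0 \<le> pfun D b \<theta> c \<delta>2 v a s" "pfun D b \<theta> c \<delta>2 v a s \<le> 1"
  using assms vfun_nonneg[of b v a s] by (auto simp: pfun_def)

lemma measurable_kernel_density:
  fixes v :: "'j::finite \<Rightarrow> real^'d"
  assumes "b > 0"
  shows "(\<lambda>z. kernel_density D b \<theta> c \<delta>2 v a (fst z) (snd z)) \<in> borel_measurable (borel \<Otimes>\<^sub>M borel)"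
proof -
  note [measurable] = measurable_pfun[OF assms]
  have "(\<lambda>z. kernel_density D b \<theta> c \<delta>2 v a (fst z) (snd z)) = (\<lambda>z.
     pfun D b \<theta> c \<delta>2 v a (fst z) * (if snd z \<in> jump_set b c v a (fst z) then 1 else 0)
         / measure (walk_kernel D (fst z)) (jump_set b c v a (fst z))
       + (1 - pfun D b \<theta> c \<delta>2 v a (fst z)))"
    by (auto simp: kernel_density_def fun_eq_iff)
  also have "\<dots> \<in> borel_measurable (borel \<Otimes>\<^sub>M borel)"
    by measurable
  finally show ?thesis .
qed

lemma mixed_kernel_eq:
  "mixed_kernel D b \<theta> c \<delta>2 v a s = density (walk_kernel D s) (\<lambda>s1. ennreal (kernel_density D b \<theta> c \<delta>2 v a s s1))"
  by (simp add: mixed_kernel_def kernel_density_def)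

lemma kernel_density_ge:
  assumes "\<theta> \<ge> 0"
  shows "1 - pfun D b \<theta> c \<delta>2 v a s \<le> kernel_density D b \<theta> c \<delta>2 v a s s1"
  using pfun_bounds[OF assms, of b c \<delta>2 v a s] by (auto simp: kernel_density_def indicator_def)

lemma kernel_density_nonneg: "\<theta> \<ge> 0 \<Longrightarrow> 0 \<le> kernel_density D b \<theta> c \<delta>2 v a s s1"
  using kernel_density_ge[of \<theta> b c \<delta>2 v a s s1] pfun_bounds[of \<theta> b c \<delta>2 v a s] by linarith

lemma measurable_kernel_density2:
  fixes v :: "'j::finite \<Rightarrow> real^'d"
  assumes "b > 0"
  shows "kernel_density D b \<theta> c \<delta>2 v a s \<in> borel_measurable borel"
  using measurable_compose[OF measurable_Pair1' measurable_kernel_density[OF assms], of s] by simp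

lemma prob_space_mixed_kernel:
  fixes v :: "'j::finite \<Rightarrow> real^'d"
  assumes "b > 0" "\<theta> \<ge> 0"
  shows "prob_space (mixed_kernel D b \<theta> c \<delta>2 v a s)"
proof (rule prob_spaceI)
  note [measurable] = measurable_kernel_density2[OF assms(1)]
  interpret K: prob_space "walk_kernel D s" by (rule prob_space_walk_kernel)
  let ?p = "pfun D b \<theta> c \<delta>2 v a s" and ?J = "jump_set b c v a s"
  let ?P = "measure (walk_kernel D s) ?J"
  have p: "0 \<le> ?p" "?p \<le> 1" by (rule pfun_bounds[OF assms(2)])+
  have "emeasure (mixed_kernel D b \<theta> c \<delta>2 v a s) (space (mixed_kernel D b \<theta> c \<delta>2 v a s))
    = (\<integral>\<^sup>+s1. ennreal (kernel_density D b \<theta> c \<delta>2 v a s s1) \<partial>walk_kernel D s)"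
    unfolding mixed_kernel_eq by (subst emeasure_density) (auto intro!: nn_integral_cong)
  also have "\<dots> = (\<integral>\<^sup>+s1. ennreal (?p / ?P) * indicator ?J s1 + ennreal (1 - ?p) \<partial>walk_kernel D s)"
    using p by (intro nn_integral_cong) (auto simp: kernel_density_def indicator_def ennreal_plus[symmetric] simp del: ennreal_plus)
  also have "\<dots> = ennreal (?p / ?P) * emeasure (walk_kernel D s) ?J + ennreal (1 - ?p)"
    using K.emeasure_space_1 by (subst nn_integral_add) (auto simp: nn_integral_cmult_indicator)
  also have "\<dots> = ennreal (?p / ?P * ?P + (1 - ?p))"
    using p by (simp add: K.emeasure_eq_measure ennreal_mult[symmetric] ennreal_plus[symmetric] del: ennreal_plus)
  \<comment> \<open>If the jump set is a null set, its measure as a factor in the numerator makes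
    \<open>pfun\<close> vanish, so the quotient with denominator 0 does no harm.\<close>
  also have "?p / ?P * ?P + (1 - ?p) = 1"
    by (cases "?P = 0") (auto simp: pfun_def)
  finally show "emeasure (mixed_kernel D b \<theta> c \<delta>2 v a s) (space (mixed_kernel D b \<theta> c \<delta>2 v a s)) = 1"
    by simp
qed

lemma nn_integral_walk_kernel:
  assumes [measurable]: "f \<in> borel_measurable borel"
  shows "(\<integral>\<^sup>+s1. f s1 \<partial>walk_kernel D s) = (\<integral>\<^sup>+x. f (x + s) \<partial>D)"
  unfolding walk_kernel_def by (subst nn_integral_distr) auto

text \<open>Both the reference measure and the density depend on \<open>s\<close>. Translating back
  to the increment leaves the fixed measure \<open>D\<close>, and joint measurability of the
  integrand in \<open>s\<close> and the increment is then enough.\<close>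

lemma measurable_mixed_kernel:
  fixes v :: "'j::finite \<Rightarrow> real^'d"
  assumes "b > 0" "\<theta> \<ge> 0"
  shows "mixed_kernel D b \<theta> c \<delta>2 v a \<in> borel \<rightarrow>\<^sub>M subprob_algebra borel"
proof (rule measurable_subprob_algebra)
  fix s :: "real^'d"
  show "subprob_space (mixed_kernel D b \<theta> c \<delta>2 v a s)"
    using prob_space_mixed_kernel[OF assms] by (rule prob_space_imp_subprob_space)
  show "sets (mixed_kernel D b \<theta> c \<delta>2 v a s) = sets borel"
    by (simp add: mixed_kernel_def)
next
  fix A :: "(real^'d) set" assume A [measurable]: "A \<in> sets borel"
  note [measurable] = measurable_kernel_density[OF assms(1)] measurable_kernel_density2[OF assms(1)]
  have "emeasure (mixed_kernel D b \<theta> c \<delta>2 v a s) A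
    = (\<integral>\<^sup>+x. ennreal (kernel_density D b \<theta> c \<delta>2 v a s (x + s)) * indicator A (x + s) \<partial>D)" for s
    unfolding mixed_kernel_eq by (subst emeasure_density) (auto simp: nn_integral_walk_kernel)
  moreover have "(\<lambda>s. \<integral>\<^sup>+x. ennreal (kernel_density D b \<theta> c \<delta>2 v a s (x + s)) * indicator A (x + s) \<partial>D) \<in> borel_measurable borel"
  proof -
    have "(\<lambda>z. (snd z, fst z + snd z)) \<in> D \<Otimes>\<^sub>M borel \<rightarrow>\<^sub>M borel \<Otimes>\<^sub>M borel"
      by measurable
    from measurable_compose[OF this measurable_kernel_density[OF assms(1)], of \<theta> c \<delta>2 v a]
    have [measurable]: "(\<lambda>z. kernel_density D b \<theta> c \<delta>2 v a (snd z) (fst z + snd z)) \<in> borel_measurable (D \<Otimes>\<^sub>M borel)"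
      by simp
    have "(\<lambda>z. (snd z, fst z)) \<in> borel \<Otimes>\<^sub>M D \<rightarrow>\<^sub>M D \<Otimes>\<^sub>M (borel :: (real^'d) measure)"
      by measurable
    from measurable_compose[OF this \<open>(\<lambda>z. kernel_density D b \<theta> c \<delta>2 v a (snd z) (fst z + snd z)) \<in> borel_measurable (D \<Otimes>\<^sub>M borel)\<close>]
    have [measurable]: "(\<lambda>(s, x). kernel_density D b \<theta> c \<delta>2 v a s (x + s)) \<in> borel_measurable (borel \<Otimes>\<^sub>M D)"
      by (simp add: split_beta')
    show ?thesis
      by (intro borel_measurable_nn_integral) measurable
  qed
  ultimately show "(\<lambda>s. emeasure (mixed_kernel D b \<theta> c \<delta>2 v a s) A) \<in> borel_measurable borel"
    by simp
qed

lemma measurable_walk_kernel: "walk_kernel D \<in> borel \<rightarrow>\<^sub>M subprob_algebra borel"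
proof (rule measurable_subprob_algebra)
  fix A :: "(real^'d) set" assume A [measurable]: "A \<in> sets borel"
  have "emeasure (walk_kernel D s) A = (\<integral>\<^sup>+x. indicator A (x + s) \<partial>D)" for s
    using nn_integral_walk_kernel[of "indicator A" s] by simp
  moreover have "(\<lambda>s. \<integral>\<^sup>+x. indicator A (x + s) \<partial>D) \<in> borel_measurable borel"
    by (intro borel_measurable_nn_integral) measurable
  ultimately show "(\<lambda>s. emeasure (walk_kernel D s) A) \<in> borel_measurable borel"
    by simp
qed (simp_all add: prob_space_walk_kernel prob_space_imp_subprob_space)

end

section \<open>The kernel along the tube around the drift line\<close>

context rv_target
begin

lemma r_shift: "r b (z + t *\<^sub>R eta) = r b z - t"
  by (rule rfun_shift) (rule eta_v)

text \<open>After \<open>t\<close> units of drift the event is \<open>t < r b (x + s)\<close>, so by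
  Tonelli the time integral of its probability is the mean length of the interval from 0 to
  \<open>r b (x + s)\<close>.\<close>

lemma vfun_eq:
  assumes "b > 0"
  shows "vfun D b v a s = (\<integral>x. max 0 (r b (x + s)) \<partial>D)"
proof -
  have mem: "x + t *\<^sub>R eta + s \<in> dilate b (halfspaces v a) \<longleftrightarrow> t < r b (x + s)" for x t
  proof -
    have "x + t *\<^sub>R eta + s = (x + s) + t *\<^sub>R eta" by simp
    show ?thesis
      unfolding mem_dilate_iff[OF assms] \<open>x + t *\<^sub>R eta + s = (x + s) + t *\<^sub>R eta\<close> r_shift
      by simp
  qed
  have "vfun D b v a s = (\<integral>t. indicator {0..} t * \<P>(x in D. t < r b (x + s)) \<partial>lborel)"
    by (simp add: vfun_def set_lebesgue_integral_def mem)
  also have "\<dots> = enn2real (\<integral>\<^sup>+t. ennreal (indicator {0..} t * \<P>(x in D. t < r b (x + s))) \<partial>lborel)"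
    by (rule integral_eq_nn_integral) auto
  also have "(\<integral>\<^sup>+t. ennreal (indicator {0..} t * \<P>(x in D. t < r b (x + s))) \<partial>lborel)
     = (\<integral>\<^sup>+t. \<integral>\<^sup>+x. indicator {0..<max 0 (r b (x + s))} t \<partial>D \<partial>lborel)"
  proof (intro nn_integral_cong)
    fix t :: real
    have "(\<integral>\<^sup>+x. indicator {0..<max 0 (r b (x + s))} t \<partial>D) = (\<integral>\<^sup>+x. indicator {0..} t * indicator {x. t < r b (x + s)} x \<partial>D)"
      by (intro nn_integral_cong) (auto simp: indicator_def)
    also have "\<dots> = indicator {0..} t * emeasure D {x. t < r b (x + s)}"
      by (subst nn_integral_cmult) auto
    finally show "ennreal (indicator {0..} t * \<P>(x in D. t < r b (x + s))) = (\<integral>\<^sup>+x. indicator {0..<max 0 (r b (x + s))} t \<partial>D)"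
      by (simp add: emeasure_eq_measure indicator_def)
  qed
  also have "\<dots> = (\<integral>\<^sup>+x. \<integral>\<^sup>+t. indicator {0..<max 0 (r b (x + s))} t \<partial>lborel \<partial>D)"
  proof -
    interpret pair_sigma_finite lborel D ..
    have "(\<lambda>z. indicator {0..<max 0 (r b (snd z + s))} (fst z)) = (\<lambda>z. if 0 \<le> fst z \<and> fst z < max 0 (r b (snd z + s)) then 1 else (0::ennreal))"
      by (auto simp: indicator_def)
    also have "\<dots> \<in> borel_measurable (lborel \<Otimes>\<^sub>M D)"
      by measurable
    finally have "(\<lambda>(t, x). indicator {0..<max 0 (r b (x + s))} t :: ennreal) \<in> borel_measurable (lborel \<Otimes>\<^sub>M D)"
      by (simp add: split_beta')
    then show ?thesis by (rule Fubini'[symmetric])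
  qed
  also have "\<dots> = (\<integral>\<^sup>+x. ennreal (max 0 (r b (x + s))) \<partial>D)"
    by (intro nn_integral_cong) simp
  also have "enn2real \<dots> = (\<integral>x. max 0 (r b (x + s)) \<partial>D)"
    by (rule integral_eq_nn_integral[symmetric]) auto
  finally show ?thesis .
qed

definition amax :: real where "amax = (MAX j. a j)"

lemma le_amax: "a j \<le> amax"
  unfolding amax_def by (intro Max_ge) auto

text \<open>Write \<open>s\<close> as \<open>k\<close> times the drift plus a remainder: the first
  part shifts \<open>r\<close> by exactly \<open>k\<close>, the second by at most
  \<open>L * \<kappa> * b\<close>. Quantities at a point of the tube are thereby compared with
  functions of time alone.\<close>

lemma r_tube:
  assumes "norm (s - real k *\<^sub>R eta) \<le> \<kappa> * b"
  shows "r b x - real k - L * \<kappa> * b \<le> r b (x + s)" "r b (x + s) \<le> r b x - real k + L * \<kappa> * b"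
proof -
  define w where "w = s - real k *\<^sub>R eta"
  have "L * norm w \<le> L * (\<kappa> * b)"
    using assms L_pos by (intro mult_left_mono) (auto simp: w_def)
  moreover have "x + s = (x + w) + real k *\<^sub>R eta"
    by (simp add: w_def)
  then have "r b (x + s) = r b (x + w) - real k"
    by (simp only: r_shift)
  ultimately show "r b x - real k - L * \<kappa> * b \<le> r b (x + s)" "r b (x + s) \<le> r b x - real k + L * \<kappa> * b"
    using rfun_add_le[of b v a x w] rfun_add_ge[of b v a x w] by auto
qed

lemma vfun_tube:
  assumes "b > 0" "norm (s - real k *\<^sub>R eta) \<le> \<kappa> * b"
  shows "Iex v a b (real k + L * \<kappa> * b) \<le> vfun D b v a s" "vfun D b v a s \<le> Iex v a b (real k - L * \<kappa> * b)"
proof -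
  have i: "integrable D (\<lambda>x. max 0 (r b (x + s)))"
    by (intro integrable_max integrable_rfun) auto
  show "Iex v a b (real k + L * \<kappa> * b) \<le> vfun D b v a s"
    unfolding vfun_eq[OF assms(1)] Iex_def
  proof (intro integral_mono integrable_Iex i max.mono order_refl)
    show "r b x - (real k + L * \<kappa> * b) \<le> r b (x + s)" for x
      using r_tube(1)[OF assms(2), of x] by linarith
  qed
  show "vfun D b v a s \<le> Iex v a b (real k - L * \<kappa> * b)"
    unfolding vfun_eq[OF assms(1)] Iex_def
  proof (intro integral_mono integrable_Iex i max.mono order_refl)
    show "r b (x + s) \<le> r b x - (real k - L * \<kappa> * b)" for x
      using r_tube(2)[OF assms(2), of x] by linarith
  qed
qed

text \<open>The jump set asks only for the fraction \<open>c\<close> of the missing height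
  \<open>a j * b - s \<bullet> v j\<close>. Up to time \<open>M * b\<close> that height is at most
  \<open>(amax + M + L * \<kappa>) * b\<close>, so relaxing it costs a shift by \<open>1 - c\<close>
  times this bound, in addition to the shift from the tube.\<close>

lemma jump_prob_tube_le:
  assumes "b > 0" "0 < c" "c < 1" "real k \<le> M * b" "norm (s - real k *\<^sub>R eta) \<le> \<kappa> * b"
    and \<kappa>'': "L * \<kappa> + (1 - c) * (amax + M + L * \<kappa>) \<le> \<kappa>''"
  shows "measure (walk_kernel D s) (jump_set b c v a s) \<le> \<P>(x in D. r b x > real k - \<kappa>'' * b)"
  unfolding measure_jump_set
proof (rule finite_measure_mono)
  define w where "w = s - real k *\<^sub>R eta"
  have Lw: "L * norm w \<le> L * \<kappa> * b"
    using mult_left_mono[OF assms(5), of L] L_pos by (simp add: w_def)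
  show "{x \<in> space D. \<exists>j. x \<bullet> v j > c * (a j * b - s \<bullet> v j)} \<subseteq> {x \<in> space D. r b x > real k - \<kappa>'' * b}"
  proof safe
    fix x j assume j: "x \<bullet> v j > c * (a j * b - s \<bullet> v j)"
    define A where "A = a j * b - s \<bullet> v j"
    have sv: "s \<bullet> v j = w \<bullet> v j - real k"
      by (simp add: w_def inner_diff_left eta_v)
    have w1: "w \<bullet> v j \<le> L * norm w" "- (w \<bullet> v j) \<le> L * norm w"
      using inner_le_vmax[of w v j] inner_le_vmax[of "- w" v j] by auto
    have "A \<le> (amax + M + L * \<kappa>) * b"
    proof -
      have "a j * b \<le> amax * b" using le_amax assms(1) by (intro mult_right_mono) auto
      then show ?thesis
        unfolding A_def distrib_right using sv w1 Lw assms(4) by linarith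
    qed
    then have "(1 - c) * A \<le> (1 - c) * ((amax + M + L * \<kappa>) * b)"
      using assms by (intro mult_left_mono) auto
    moreover have "A \<ge> a j * b + real k - L * \<kappa> * b"
      using sv w1 Lw by (simp add: A_def)
    moreover have "c * A = A - (1 - c) * A" by (simp add: algebra_simps)
    moreover have "(L * \<kappa> + (1 - c) * (amax + M + L * \<kappa>)) * b \<le> \<kappa>'' * b"
      using \<kappa>'' assms(1) by (intro mult_right_mono) auto
    then have "L * \<kappa> * b + (1 - c) * ((amax + M + L * \<kappa>) * b) \<le> \<kappa>'' * b"
      by (simp add: algebra_simps)
    ultimately have "x \<bullet> v j - a j * b > real k - \<kappa>'' * b"
      using j unfolding A_def[symmetric] by linarith
    then show "r b x > real k - \<kappa>'' * b"
      using rfun_gt_iff by blast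
  qed
qed measurable

text \<open>The missing heights are nonnegative in the tube, so an increment that enters the target
  also clears the fraction \<open>c < 1\<close> of one of them.\<close>

lemma jump_prob_tube_ge:
  assumes "b > 0" "0 < c" "c < 1" "L * \<kappa> \<le> amin" "norm (s - real k *\<^sub>R eta) \<le> \<kappa> * b"
  shows "\<P>(x in D. r b x > real k + L * \<kappa> * b) \<le> measure (walk_kernel D s) (jump_set b c v a s)"
  unfolding measure_jump_set
proof (rule finite_measure_mono)
  define w where "w = s - real k *\<^sub>R eta"
  have Lw: "L * norm w \<le> L * \<kappa> * b"
    using mult_left_mono[OF assms(5), of L] L_pos by (simp add: w_def)
  show "{x \<in> space D. r b x > real k + L * \<kappa> * b} \<subseteq> {x \<in> space D. \<exists>j. x \<bullet> v j > c * (a j * b - s \<bullet> v j)}"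
  proof safe
    fix x assume "r b x > real k + L * \<kappa> * b"
    then obtain j where j: "x \<bullet> v j - a j * b > real k + L * \<kappa> * b"
      using rfun_gt_iff by blast
    define A where "A = a j * b - s \<bullet> v j"
    have sv: "s \<bullet> v j = w \<bullet> v j - real k"
      by (simp add: w_def inner_diff_left eta_v)
    have w1: "w \<bullet> v j \<le> L * norm w" "- (w \<bullet> v j) \<le> L * norm w"
      using inner_le_vmax[of w v j] inner_le_vmax[of "- w" v j] by auto
    have "L * \<kappa> * b \<le> amin * b" using assms by (intro mult_right_mono) auto
    also have "\<dots> \<le> a j * b" using amin_le assms by (intro mult_right_mono) auto
    finally have "A \<ge> 0" using sv w1 Lw by (simp add: A_def)
    then have "c * A \<le> 1 * A" using assms by (intro mult_right_mono) auto
    moreover have "A \<le> a j * b + real k + L * \<kappa> * b"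
      using sv w1 Lw by (simp add: A_def)
    ultimately have "x \<bullet> v j > c * A" using j by linarith
    then show "\<exists>j. x \<bullet> v j > c * (a j * b - s \<bullet> v j)"
      unfolding A_def by blast
  qed
qed measurable

text \<open>The bounds on the density factors telescope over the steps before the jump, because
  \<open>P(r X > u) \<le> I(u - 1) - I(u)\<close> for the integrated tail \<open>I\<close>.\<close>

context
  fixes b \<theta> c \<delta>2 \<kappa> \<kappa>'' M :: real
  assumes b: "b > 0" and \<theta>: "0 < \<theta>" "\<theta> < 1" and c: "0 < c" "c < 1"
    and \<kappa>: "0 \<le> \<kappa>" "\<delta>2 + L * \<kappa> \<le> amin" "0 < \<delta>2"
    and M: "M \<ge> 0"
    and \<kappa>'': "L * \<kappa> + (1 - c) * (amax + M + L * \<kappa>) \<le> \<kappa>''"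
    and pos: "\<P>(x in D. r b x > M * b + L * \<kappa> * b) > 0"
    and comparable: "\<And>k::nat. real k \<le> M * b \<Longrightarrow> \<theta> * Iex v a b (real k - 1 - \<kappa>'' * b) \<le> Iex v a b (real k + L * \<kappa> * b)"
    and Ipos: "Iex v a b (M * b + L * \<kappa> * b) > 0"
begin

lemma tube_shift: "0 \<le> L * \<kappa> * b" "L * \<kappa> * b \<le> \<kappa>'' * b"
proof -
  have "amin \<le> amax" using amin_le le_amax order_trans by blast
  then have "0 \<le> (1 - c) * (amax + M + L * \<kappa>)"
    using c M \<kappa>(1) L_pos amin_pos by (intro mult_nonneg_nonneg add_nonneg_nonneg) auto
  then have "L * \<kappa> \<le> \<kappa>''" using \<kappa>'' by linarith
  then show "L * \<kappa> * b \<le> \<kappa>'' * b" using b by (intro mult_right_mono) auto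
  show "0 \<le> L * \<kappa> * b" using b \<kappa>(1) L_pos by simp
qed

lemma Iex_tube_pos:
  assumes "real k \<le> M * b" "u \<le> real k + L * \<kappa> * b"
  shows "0 < Iex v a b u"
proof -
  have "Iex v a b (M * b + L * \<kappa> * b) \<le> Iex v a b u"
    using assms by (intro Iex_antimono) linarith
  with Ipos show ?thesis by linarith
qed

text \<open>The factor \<theta> cancels: \<open>comparable\<close> bounds the denominator below by
  \<open>\<theta>\<close> times the integrated tail at the shifted level, so nothing is lost per
  step. The extra shift by 1 lets the tail probability be bounded by a difference of two consecutive
  integrated tails.\<close>

lemma pfun_ratio_le:
  assumes k: "real k \<le> M * b" and s: "norm (s - real k *\<^sub>R eta) \<le> \<kappa> * b"
  shows "\<theta> * measure (walk_kernel D s) (jump_set b c v a s) / vfun D b v a s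
    \<le> 1 - Iex v a b (real k - \<kappa>'' * b) / Iex v a b (real k - 1 - \<kappa>'' * b)"
proof -
  define F where "F = \<P>(x in D. r b x > real k - \<kappa>'' * b)"
  define I1 where "I1 = Iex v a b (real k - 1 - \<kappa>'' * b)"
  have F: "measure (walk_kernel D s) (jump_set b c v a s) \<le> F"
    unfolding F_def by (rule jump_prob_tube_le[OF b c k s \<kappa>''])
  have I: "Iex v a b (real k + L * \<kappa> * b) \<le> vfun D b v a s"
    by (rule vfun_tube(1)[OF b s])
  have Ik: "0 < Iex v a b (real k + L * \<kappa> * b)"
    by (rule Iex_tube_pos[OF k]) simp
  have I1: "I1 > 0"
    unfolding I1_def using tube_shift by (intro Iex_tube_pos[OF k]) linarith
  have "\<theta> * measure (walk_kernel D s) (jump_set b c v a s) / vfun D b v a s \<le> \<theta> * F / (\<theta> * I1)"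
    using F I Ik comparable[OF k] \<theta> I1 by (intro frac_le mult_left_mono) (auto simp: F_def I1_def)
  also have "\<dots> = F / I1" using \<theta> by simp
  also have "F \<le> I1 - Iex v a b (real k - \<kappa>'' * b)"
    using Iex_diff_ge[of "real k - 1 - \<kappa>'' * b" "real k - \<kappa>'' * b" b v a] by (simp add: F_def I1_def)
  then have "F / I1 \<le> (I1 - Iex v a b (real k - \<kappa>'' * b)) / I1"
    using I1 by (intro divide_right_mono) auto
  also have "\<dots> = 1 - Iex v a b (real k - \<kappa>'' * b) / I1"
    using I1 by (simp add: diff_divide_distrib)
  finally show ?thesis unfolding I1_def .
qed

lemma Iex_ratio_le_1: "Iex v a b (u + 1) / Iex v a b u \<le> 1"
  using Iex_antimono[of u "u + 1" v a b] Iex_nonneg[of v a b u]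
  by (cases "Iex v a b u = 0") (auto simp: divide_le_eq_1 less_le)

text \<open>Dropping the nonnegative jump part leaves \<open>1 - p\<close>. That the ratio is at
  most 1 covers the case where the indicator in \<open>pfun\<close> switches the jump probability
  off.\<close>

lemma kernel_density_before_jump:
  assumes k: "real k \<le> M * b" and s: "norm (s - real k *\<^sub>R eta) \<le> \<kappa> * b"
  shows "Iex v a b (real k - \<kappa>'' * b) / Iex v a b (real k - 1 - \<kappa>'' * b) \<le> kernel_density D b \<theta> c \<delta>2 v a s s1"
proof -
  have "0 \<le> Iex v a b (real k - \<kappa>'' * b) / Iex v a b (real k - 1 - \<kappa>'' * b)"
    by (intro divide_nonneg_nonneg Iex_nonneg)
  moreover have "pfun D b \<theta> c \<delta>2 v a s \<le> 1 - Iex v a b (real k - \<kappa>'' * b) / Iex v a b (real k - 1 - \<kappa>'' * b)"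
    using pfun_ratio_le[OF k s] Iex_ratio_le_1[of "real k - 1 - \<kappa>'' * b"]
    by (auto simp: pfun_def min_def diff_diff_add add.commute)
  ultimately show ?thesis
    using kernel_density_ge[of \<theta> b c \<delta>2 v a s s1] \<theta> by linarith
qed

text \<open>The probability of the jump set cancels between \<open>pfun\<close> and the density,
  leaving \<open>\<theta>\<close> over \<open>vfun\<close>. For this it has to be positive, the
  minimum with 1 and the indicator in \<open>pfun\<close> must be inactive, and the new position
  must lie in the jump set.\<close>

lemma kernel_density_at_jump:
  assumes k: "real k \<le> M * b" and s: "norm (s - real k *\<^sub>R eta) \<le> \<kappa> * b" and s1: "r b s1 > 0"
  shows "\<theta> / Iex v a b (real k - \<kappa>'' * b) \<le> kernel_density D b \<theta> c \<delta>2 v a s s1"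
proof -
  let ?P = "measure (walk_kernel D s) (jump_set b c v a s)"
  have L\<kappa>: "L * \<kappa> \<ge> 0" using L_pos \<kappa> by simp
  have "L * \<kappa> \<le> amin" using \<kappa> L\<kappa> by linarith
  have "0 < \<P>(x in D. r b x > M * b + L * \<kappa> * b)" by (rule pos)
  also have "\<dots> \<le> \<P>(x in D. r b x > real k + L * \<kappa> * b)"
    using k by (intro finite_measure_mono) (auto, measurable)
  also have "\<dots> \<le> ?P"
    by (rule jump_prob_tube_ge[OF b c \<open>L * \<kappa> \<le> amin\<close> s])
  finally have P: "?P > 0" .
  \<comment> \<open>The tube lies at depth at least \<open>(amin - L * \<kappa>) * b\<close>, which
    is no less than \<open>\<delta>2 * b\<close>, so the indicator in \<open>pfun\<close> equals
    1.\<close>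
  have r0: "r b s \<le> - \<delta>2 * b"
  proof -
    have "r b (0 + s) \<le> r b 0 - real k + L * \<kappa> * b" by (rule r_tube(2)[OF s])
    moreover have "r b 0 \<le> - amin * b" using r_le[of b 0] b by simp
    moreover have "(\<delta>2 + L * \<kappa>) * b \<le> amin * b" using \<kappa> b by (intro mult_right_mono) auto
    ultimately show ?thesis by (simp add: algebra_simps)
  qed
  have r0': "r b s \<le> 0" using r0 \<kappa> b by (smt (verit) mult_pos_pos mult_minus_left)
  \<comment> \<open>Starting below the boundary, an entrance into the target covers the whole
    missing height in some direction, hence more than its fraction \<open>c\<close>.\<close>
  have jump: "s1 \<in> jump_set b c v a s"
  proof -
    obtain j where j: "s1 \<bullet> v j - a j * b > 0" using s1 rfun_gt_iff by blast
    have "s \<bullet> v j - a j * b \<le> 0" using r0' rfun_le_iff by blast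
    then have "c * (a j * b - s \<bullet> v j) \<le> 1 * (a j * b - s \<bullet> v j)"
      using c by (intro mult_right_mono) auto
    then have "(s1 - s) \<bullet> v j > c * (a j * b - s \<bullet> v j)" using j by (simp add: inner_diff_left)
    then show ?thesis unfolding jump_set_iff by blast
  qed
  have I0: "0 \<le> Iex v a b (real k - \<kappa>'' * b) / Iex v a b (real k - 1 - \<kappa>'' * b)"
    by (intro divide_nonneg_nonneg Iex_nonneg)
  have "\<theta> * ?P / vfun D b v a s \<le> 1"
    using pfun_ratio_le[OF k s] I0 by linarith
  then have p: "pfun D b \<theta> c \<delta>2 v a s = \<theta> * ?P / vfun D b v a s"
    using r0 by (simp add: pfun_def)
  have "0 < Iex v a b (real k + L * \<kappa> * b)" by (rule Iex_tube_pos[OF k]) simp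
  also have "\<dots> \<le> vfun D b v a s" by (rule vfun_tube(1)[OF b s])
  finally have v: "vfun D b v a s > 0" .
  have "vfun D b v a s \<le> Iex v a b (real k - L * \<kappa> * b)" by (rule vfun_tube(2)[OF b s])
  also have "\<dots> \<le> Iex v a b (real k - \<kappa>'' * b)"
    using tube_shift by (intro Iex_antimono) linarith
  finally have "\<theta> / Iex v a b (real k - \<kappa>'' * b) \<le> \<theta> / vfun D b v a s"
    using v \<theta> by (intro divide_left_mono mult_pos_pos) auto
  also have "\<dots> = pfun D b \<theta> c \<delta>2 v a s * indicator (jump_set b c v a s) s1 / ?P"
    using p P jump by simp
  also have "\<dots> \<le> kernel_density D b \<theta> c \<delta>2 v a s s1"
    using pfun_bounds[of \<theta> b c \<delta>2 v a s] \<theta> by (simp add: kernel_density_def)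
  finally show ?thesis .
qed

text \<open>With \<open>J k\<close> the integrated tail at \<open>k - 1 - \<kappa>'' * b\<close>,
  the step from time \<open>k\<close> contributes \<open>J (Suc k) / J k\<close> and the jump
  \<open>\<theta> / J (Suc n)\<close>. The ratios before the jump stop at \<open>J n\<close>, and
  the mismatch is harmless because \<open>J\<close> is antitone.\<close>

lemma density_product_ge:
  assumes n: "real n \<le> M * b" and S: "\<And>k. k \<le> n \<Longrightarrow> norm (S k - real k *\<^sub>R eta) \<le> \<kappa> * b" "r b (S (Suc n)) > 0"
  shows "\<theta> / Iex v a b (- 1 - \<kappa>'' * b) \<le> (\<Prod>k\<le>n. kernel_density D b \<theta> c \<delta>2 v a (S k) (S (Suc k)))"
proof -
  define J where "J k = Iex v a b (real k - 1 - \<kappa>'' * b)" for k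
  have J_pos: "J k > 0" if "real k \<le> M * b" for k
    unfolding J_def using tube_shift by (intro Iex_tube_pos[OF that]) linarith
  have tel: "(\<Prod>k<m. J (Suc k) / J k) = J m / J 0" if "m \<le> n" for m
    using that
  proof (induction m)
    case 0
    then show ?case using J_pos[of 0] M b by simp
  next
    case (Suc m)
    have "J m > 0" using Suc.prems n by (intro J_pos) simp
    then show ?case using Suc by simp
  qed
  have Jn: "J n > 0" "J 0 > 0" using n M b by (auto intro!: J_pos)
  have J_Suc: "J (Suc k) = Iex v a b (real k - \<kappa>'' * b)" for k by (simp add: J_def)
  have Jn1: "J (Suc n) \<le> J n" unfolding J_def by (intro Iex_antimono) simp
  have JSn: "J (Suc n) > 0"
    unfolding J_Suc using tube_shift by (intro Iex_tube_pos[OF n]) linarith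
  then have "\<theta> / J 0 \<le> (J n / J 0) * (\<theta> / J (Suc n))"
    using Jn Jn1 \<theta> by (simp add: field_simps)
  also have "\<dots> = (\<Prod>k<n. J (Suc k) / J k) * (\<theta> / J (Suc n))"
    using tel[of n] by simp
  also have "\<dots> \<le> (\<Prod>k<n. kernel_density D b \<theta> c \<delta>2 v a (S k) (S (Suc k))) * kernel_density D b \<theta> c \<delta>2 v a (S n) (S (Suc n))"
  proof (intro mult_mono prod_mono conjI)
    fix k assume k: "k \<in> {..<n}"
    show "0 \<le> J (Suc k) / J k" by (simp add: J_def Iex_nonneg)
    have "real k \<le> M * b" using k n by simp
    from kernel_density_before_jump[OF this S(1)] k
    show "J (Suc k) / J k \<le> kernel_density D b \<theta> c \<delta>2 v a (S k) (S (Suc k))"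
      by (simp add: J_def)
  next
    show "\<theta> / J (Suc n) \<le> kernel_density D b \<theta> c \<delta>2 v a (S n) (S (Suc n))"
      unfolding J_Suc by (rule kernel_density_at_jump[OF n S(1)[OF order_refl] S(2)])
    show "0 \<le> (\<Prod>k<n. kernel_density D b \<theta> c \<delta>2 v a (S k) (S (Suc k)))"
      using \<theta> by (intro prod_nonneg ballI kernel_density_nonneg) simp
    show "0 \<le> \<theta> / J (Suc n)" using \<theta> JSn by simp
  qed
  also have "\<dots> = (\<Prod>k\<le>n. kernel_density D b \<theta> c \<delta>2 v a (S k) (S (Suc k)))"
    by (simp add: lessThan_Suc_atMost[symmetric])
  finally show ?thesis by (simp add: J_def)
qed

end

end

section \<open>The approximating law on confined paths\<close>

lemma enat_less_hit_time_iff: "enat n < hit_time C S \<longleftrightarrow> (\<forall>k\<le>n. S k \<notin> C)"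
proof -
  have "enat n < hit_time C S \<longleftrightarrow> enat (Suc n) \<le> hit_time C S"
    by (simp add: Suc_ile_eq)
  also have "\<dots> \<longleftrightarrow> (\<forall>k\<le>n. S k \<notin> C)"
    unfolding hit_time_def le_INF_iff by (auto simp: not_less_eq_eq[symmetric])
  finally show ?thesis .
qed

text \<open>A product of indicators instead of a set: it enters integrands as a factor and splits
  off its last factor in inductions on the time.\<close>

definition confined :: "(nat \<Rightarrow> 'a set) \<Rightarrow> nat \<Rightarrow> (nat \<Rightarrow> 'a) \<Rightarrow> ennreal" where
  "confined V n S = (\<Prod>k\<le>n. indicator (V k) (S k))"

lemma confined_Suc: "confined V (Suc n) S = confined V n S * indicator (V (Suc n)) (S (Suc n))"
  by (simp add: confined_def)

lemma confined_cong: "(\<And>k. k \<le> n \<Longrightarrow> S k = S' k) \<Longrightarrow> confined V n S = confined V n S'"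
  unfolding confined_def by (intro prod.cong) auto

lemma confined_eq_0: "\<not> (\<forall>k\<le>n. S k \<in> V k) \<Longrightarrow> confined V n S = 0"
  unfolding confined_def by (intro prod_zero) (auto simp: indicator_def)

text \<open>The likelihood ratio of the path up to time \<open>n\<close>; it has one factor for each
  of the \<open>n\<close> steps, whereas \<open>confined\<close> has one for each of
  \<open>n + 1\<close> positions.\<close>

definition step_weight :: "(nat \<Rightarrow> 'a \<Rightarrow> 'a \<Rightarrow> ennreal) \<Rightarrow> nat \<Rightarrow> (nat \<Rightarrow> 'a) \<Rightarrow> ennreal" where
  "step_weight f n S = (\<Prod>k<n. f k (S k) (S (Suc k)))"

lemma step_weight_Suc: "step_weight f (Suc n) S = step_weight f n S * f n (S n) (S (Suc n))"
  by (simp add: step_weight_def)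

lemma step_weight_cong: "(\<And>k. k \<le> n \<Longrightarrow> S k = S' k) \<Longrightarrow> step_weight f n S = step_weight f n S'"
  unfolding step_weight_def by (intro prod.cong) auto

context rv_increments
begin

text \<open>The functional looks only at the first \<open>n\<close> entries, so the entry with index
  \<open>n\<close> can be replaced by an independent copy. It takes a whole sequence as argument to
  spare restrictions to initial segments.\<close>

lemma nn_integral_indep_prefix:
  assumes \<Phi>: "(\<lambda>(x, z). \<Phi> x z) \<in> borel_measurable (seq.S \<Otimes>\<^sub>M D)"
    and prefix: "\<And>x y z. (\<And>i. i < n \<Longrightarrow> x i = y i) \<Longrightarrow> \<Phi> x z = \<Phi> y z"
  shows "(\<integral>\<^sup>+x. \<Phi> x (x n) \<partial>seq.S) = (\<integral>\<^sup>+x. \<integral>\<^sup>+z. \<Phi> x z \<partial>D \<partial>seq.S)"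
proof -
  have pair: "(\<lambda>x. (x, x n)) \<in> seq.S \<rightarrow>\<^sub>M seq.S \<Otimes>\<^sub>M D"
    by measurable
  have m1: "(\<lambda>x. \<Phi> x (x n)) \<in> borel_measurable seq.S"
    using measurable_compose[OF pair \<Phi>] by simp
  have pair': "(\<lambda>z. (fst z, snd z 0)) \<in> seq.S \<Otimes>\<^sub>M seq.S \<rightarrow>\<^sub>M seq.S \<Otimes>\<^sub>M D"
    by measurable
  have m2: "(\<lambda>(x, y). \<Phi> x (y 0)) \<in> borel_measurable (seq.S \<Otimes>\<^sub>M seq.S)"
    using measurable_compose[OF pair' \<Phi>] by (simp add: split_beta')
  have "(\<integral>\<^sup>+x. \<Phi> x (x n) \<partial>seq.S)
    = (\<integral>\<^sup>+x. \<Phi> x (x n) \<partial>distr (seq.S \<Otimes>\<^sub>M seq.S) seq.S (\<lambda>(\<omega>, \<omega>'). comb_seq n \<omega> \<omega>'))"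
    by (simp only: seq.PiM_comb_seq)
  also have "\<dots> = (\<integral>\<^sup>+z. (\<lambda>x. \<Phi> x (x n)) ((\<lambda>(\<omega>, \<omega>'). comb_seq n \<omega> \<omega>') z) \<partial>(seq.S \<Otimes>\<^sub>M seq.S))"
    by (rule nn_integral_distr[OF measurable_comb_seq]) (simp add: m1)
  also have "\<dots> = (\<integral>\<^sup>+z. (\<lambda>(x, y). \<Phi> x (y 0)) z \<partial>(seq.S \<Otimes>\<^sub>M seq.S))"
  proof (intro nn_integral_cong)
    fix z :: "(nat \<Rightarrow> real^'d) \<times> (nat \<Rightarrow> real^'d)"
    obtain x y where z: "z = (x, y)" by (cases z)
    have "comb_seq n x y n = y 0" using comb_seq_add[of n x y 0] by simp
    moreover have "\<Phi> (comb_seq n x y) (y 0) = \<Phi> x (y 0)"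
      by (rule prefix) (simp add: comb_seq_less)
    ultimately show "(\<lambda>x. \<Phi> x (x n)) ((\<lambda>(\<omega>, \<omega>'). comb_seq n \<omega> \<omega>') z) = (\<lambda>(x, y). \<Phi> x (y 0)) z"
      by (simp add: z)
  qed
  also have "\<dots> = (\<integral>\<^sup>+x. \<integral>\<^sup>+y. \<Phi> x (y 0) \<partial>seq.S \<partial>seq.S)"
    using seq.P.nn_integral_fst[OF m2] by simp
  also have "\<dots> = (\<integral>\<^sup>+x. \<integral>\<^sup>+z. \<Phi> x z \<partial>D \<partial>seq.S)"
  proof (intro nn_integral_cong)
    fix x :: "nat \<Rightarrow> real^'d"
    have mx: "\<Phi> x \<in> borel_measurable D"
    proof -
      have "Pair x \<in> D \<rightarrow>\<^sub>M seq.S \<Otimes>\<^sub>M D"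
        by (rule measurable_Pair1') simp
      from measurable_compose[OF this \<Phi>] show ?thesis
        by (simp only: prod.case)
    qed
    have "(\<integral>\<^sup>+z. \<Phi> x z \<partial>D) = (\<integral>\<^sup>+z. \<Phi> x z \<partial>distr seq.S D (\<lambda>y. y 0))"
      by (simp only: seq.PiM_component[OF UNIV_I])
    also have "\<dots> = (\<integral>\<^sup>+y. \<Phi> x (y 0) \<partial>seq.S)"
      by (rule nn_integral_distr[OF measurable_component_singleton[OF UNIV_I]]) (simp add: mx)
    finally show "(\<integral>\<^sup>+y. \<Phi> x (y 0) \<partial>seq.S) = (\<integral>\<^sup>+z. \<Phi> x z \<partial>D)" ..
  qed
  finally show ?thesis .
qed

lemma measurable_walk_path [measurable]: "walk \<in> seq.S \<rightarrow>\<^sub>M path_space"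
  unfolding path_space_def by (rule measurable_PiM_single') auto

lemma walk_cong: "(\<And>i. i < n \<Longrightarrow> x i = y i) \<Longrightarrow> k \<le> n \<Longrightarrow> walk x k = walk y k"
  unfolding walk_def by (intro sum.cong) auto

section \<open>The approximating law as a projective limit\<close>

context
  fixes b \<theta> c \<delta>2 :: real and v :: "'j::finite \<Rightarrow> real^'d" and a :: "'j \<Rightarrow> real" and G :: "(real^'d) set"
  assumes b: "b > 0" and \<theta>: "\<theta> \<ge> 0" and G [measurable]: "dilate b G \<in> sets borel"
begin

abbreviation P where "P \<equiv> step_kernel D b \<theta> c \<delta>2 v a G 0"

lemma step_kernel_Suc:
  "P (Suc n) S = (if \<forall>k\<in>{..n}. S k \<notin> dilate b (halfspaces v a) \<and> S k \<notin> dilate b G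
     then mixed_kernel D b \<theta> c \<delta>2 v a (S n) else walk_kernel D (S n))"
  by (auto simp: step_kernel_def enat_less_hit_time_iff)

text \<open>Whether a target has been hit by time \<open>n\<close> is a condition on finitely many
  coordinates, all available to the kernel of step \<open>Suc n\<close>; so the case distinction
  between the two kernels is measurable.\<close>

lemma Ionescu_Tulcea_step_kernel: "Ionescu_Tulcea P (\<lambda>_. borel)"
proof (rule Ionescu_Tulcea.intro)
  fix i
  show "P i \<in> PiM {0..<i} (\<lambda>_. borel) \<rightarrow>\<^sub>M subprob_algebra borel"
  proof (cases i)
    case 0
    have "return borel (0::real^'d) \<in> space (subprob_algebra borel)"
      by (simp add: space_subprob_algebra prob_space_imp_subprob_space prob_space_return)
    then show ?thesis unfolding 0 step_kernel_def by simp
  next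
    case (Suc n)
    have comp: "(\<lambda>S. S k) \<in> PiM {0..<Suc n} (\<lambda>_. borel) \<rightarrow>\<^sub>M (borel :: (real^'d) measure)" if "k \<le> n" for k
      using that by (intro measurable_component_singleton) auto
    have A: "dilate b (halfspaces v a) \<in> sets borel"
    proof -
      have "dilate b (halfspaces v a) = {z \<in> space borel. rfun b v a z > 0}"
        using b by (auto simp: mem_dilate_iff)
      also have "\<dots> \<in> sets borel" by measurable
      finally show ?thesis .
    qed
    have "Measurable.pred (borel :: (real^'d) measure) (\<lambda>z. z \<notin> dilate b (halfspaces v a) \<and> z \<notin> dilate b G)"
      using A G by measurable
    then have "Measurable.pred (PiM {0..<Suc n} (\<lambda>_. borel))
       (\<lambda>S. \<forall>k\<in>{..n}. S k \<notin> dilate b (halfspaces v a) \<and> S k \<notin> dilate b G)"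
      by (intro pred_intros_finite) (auto intro!: measurable_compose[OF comp])
    then show ?thesis
      unfolding Suc step_kernel_Suc[abs_def]
      by (intro measurable_If_restrict_space_iff[THEN iffD2] measurable_If measurable_compose[OF comp]
          measurable_mixed_kernel[OF b \<theta>] measurable_walk_kernel) auto
  qed
next
  fix i :: nat and S :: "nat \<Rightarrow> real^'d"
  assume "S \<in> space (PiM {0..<i} (\<lambda>_. borel))"
  show "prob_space (P i S)"
    using prob_space_mixed_kernel[OF b \<theta>] prob_space_walk_kernel
    by (cases i) (auto simp: step_kernel_Suc, simp add: step_kernel_def prob_space_return)
qed

interpretation IT: Ionescu_Tulcea P "\<lambda>_. borel"
  by (rule Ionescu_Tulcea_step_kernel)

lemma approx_law_eq: "approx_law D b \<theta> c \<delta>2 v a G 0 = IT.PF.lim"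
  by (simp add: approx_law_def)

lemma sets_approx_law: "sets (approx_law D b \<theta> c \<delta>2 v a G 0) = sets (path_space :: (nat \<Rightarrow> real^'d) measure)"
  unfolding approx_law_eq by (simp add: path_space_def)

text \<open>The total mass is read off from the marginal on the empty set of coordinates.\<close>

lemma prob_space_approx_law: "prob_space (approx_law D b \<theta> c \<delta>2 v a G 0)"
  unfolding approx_law_eq
proof (rule prob_space_distrD)
  show "(\<lambda>x. restrict x {}) \<in> IT.PF.lim \<rightarrow>\<^sub>M PiM {} (\<lambda>_. borel)"
    by (simp add: measurable_cong_sets[OF IT.PF.sets_lim refl])
  show "prob_space (distr IT.PF.lim (PiM {} (\<lambda>_. borel)) (\<lambda>x. restrict x {}))"
    by (subst IT.distr_lim) (auto intro: IT.PF.prob_space_P)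
qed

text \<open>For an initial segment of indices the cylinder over an event is the event itself, so the
  projective family consists there of the iterated kernels.\<close>

lemma CI_atLeastLessThan: "IT.CI {0..<n} = IT.C 0 n (\<lambda>_. undefined)"
proof (rule measure_eqI)
  show "sets (IT.CI {0..<n}) = sets (IT.C 0 n (\<lambda>_. undefined))"
    by (simp add: IT.PF.sets_P IT.sets_C)
  fix X assume "X \<in> sets (IT.CI {0..<n})"
  then have X: "X \<in> sets (PiM {0..<n} (\<lambda>_. borel))"
    by (simp add: IT.PF.sets_P)
  have "emeasure (IT.CI {0..<n}) X = emeasure (IT.C 0 n (\<lambda>_. undefined)) (prod_emb {0..<n} (\<lambda>_. borel) {0..<n} X)"
    by (rule IT.emeasure_CI[OF order_refl X])
  also have "prod_emb {0..<n} (\<lambda>_. borel) {0..<n} X = X"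
    using sets.sets_into_space[OF X] by (intro prod_emb_id) (simp add: space_PiM)
  finally show "emeasure (IT.CI {0..<n}) X = emeasure (IT.C 0 n (\<lambda>_. undefined)) X" .
qed

lemma nn_integral_approx_law:
  assumes h: "h \<in> borel_measurable (PiM {0..<n} (\<lambda>_. borel))"
  shows "(\<integral>\<^sup>+S. h (restrict S {0..<n}) \<partial>approx_law D b \<theta> c \<delta>2 v a G 0) = (\<integral>\<^sup>+\<omega>. h \<omega> \<partial>IT.C 0 n (\<lambda>_. undefined))"
proof -
  have "(\<integral>\<^sup>+\<omega>. h \<omega> \<partial>IT.C 0 n (\<lambda>_. undefined))
    = (\<integral>\<^sup>+\<omega>. h \<omega> \<partial>distr IT.PF.lim (PiM {0..<n} (\<lambda>_. borel)) (\<lambda>x. restrict x {0..<n}))"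
    by (subst IT.distr_lim) (auto simp: CI_atLeastLessThan)
  also have "\<dots> = (\<integral>\<^sup>+S. h (restrict S {0..<n}) \<partial>IT.PF.lim)"
  proof (intro nn_integral_distr)
    show "(\<lambda>x. restrict x {0..<n}) \<in> IT.PF.lim \<rightarrow>\<^sub>M PiM {0..<n} (\<lambda>_. borel)"
      unfolding measurable_cong_sets[OF IT.PF.sets_lim refl] by (rule measurable_restrict_subset) simp
  qed (use h in simp)
  finally show ?thesis by (simp add: approx_law_eq)
qed

text \<open>\<open>V k\<close> confines the position at time \<open>k\<close>; on the confined paths, the step from time \<open>k\<close> has
  density \<open>f k\<close> with respect to the step of the random walk.\<close>

context
  fixes V :: "nat \<Rightarrow> (real^'d) set" and f :: "nat \<Rightarrow> real^'d \<Rightarrow> real^'d \<Rightarrow> ennreal"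
  assumes V [measurable]: "\<And>k. V k \<in> sets borel"
    and f: "\<And>k. (\<lambda>(s, s1). f k s s1) \<in> borel_measurable (borel \<Otimes>\<^sub>M borel)"
    and step: "\<And>n S. (\<And>k. k \<le> n \<Longrightarrow> S k \<in> V k) \<Longrightarrow> P (Suc n) S = density (walk_kernel D (S n)) (f n (S n))"
begin

lemma measurable_f2 [measurable]: "f k s \<in> borel_measurable borel"
  using measurable_compose[OF measurable_Pair1' f, of s] by simp

lemma measurable_f:
  assumes "X \<in> M \<rightarrow>\<^sub>M borel" "Y \<in> M \<rightarrow>\<^sub>M borel"
  shows "(\<lambda>x. f k (X x) (Y x)) \<in> borel_measurable M"
proof -
  have "(\<lambda>x. (X x, Y x)) \<in> M \<rightarrow>\<^sub>M borel \<Otimes>\<^sub>M borel"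
    using assms by measurable
  from measurable_compose[OF this f] show ?thesis by simp
qed

lemma measurable_confined:
  assumes "n < m"
  shows "confined V n \<in> borel_measurable (PiM {0..<m} (\<lambda>_. borel))"
proof -
  have "(\<lambda>S. indicator (V k) (S k) :: ennreal) \<in> borel_measurable (PiM {0..<m} (\<lambda>_. borel))" if "k \<le> n" for k
  proof (rule measurable_compose[where g = "indicator (V k)"])
    show "(\<lambda>S. S k) \<in> PiM {0..<m} (\<lambda>_. borel) \<rightarrow>\<^sub>M (borel :: (real^'d) measure)"
      using that assms by (intro measurable_component_singleton) auto
  qed measurable
  then show ?thesis unfolding confined_def[abs_def] by (intro borel_measurable_prod_ennreal) auto
qed

lemma measurable_confined_walk [measurable]: "(\<lambda>x. confined V n (walk x)) \<in> borel_measurable seq.S"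
proof -
  have "(\<lambda>x. indicator (V k) (walk x k) :: ennreal) \<in> borel_measurable seq.S" for k
    by measurable
  then show ?thesis unfolding confined_def by (intro borel_measurable_prod_ennreal) auto
qed

lemma measurable_weight_walk [measurable]: "(\<lambda>x. step_weight f n (walk x)) \<in> borel_measurable seq.S"
  unfolding step_weight_def by (intro borel_measurable_prod_ennreal measurable_f measurable_walk)

text \<open>A change of measure by induction on the time. The last step is integrated out into a
  function of one coordinate less, for which the claim is assumed; hence \<open>h\<close> is
  arbitrary. The factor \<open>confined\<close> ensures that the kernel is rewritten only on
  histories where it is known to have the density \<open>f\<close>.\<close>

lemma nn_integral_C_eq:
  assumes h: "h \<in> borel_measurable (PiM {0..<Suc n} (\<lambda>_. borel))"
  shows "(\<integral>\<^sup>+\<omega>. h \<omega> * confined V n \<omega> \<partial>IT.C 0 (Suc n) (\<lambda>_. undefined))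
    = (\<integral>\<^sup>+x. h (restrict (walk x) {0..<Suc n}) * step_weight f n (walk x) * confined V n (walk x) \<partial>seq.S)"
  using h
proof (induction n arbitrary: h)
  case 0
  have u: "(\<lambda>_. undefined) \<in> space (PiM {0..<0} (\<lambda>_. borel :: (real^'d) measure))"
    by (simp add: space_PiM PiE_def extensional_def)
  have h0: "(\<lambda>\<omega>. h \<omega> * confined V 0 \<omega>) \<in> borel_measurable (PiM {0..<Suc 0} (\<lambda>_. borel))"
    using 0 measurable_confined[of 0 "Suc 0"] by measurable
  have upd: "(\<lambda>y. fun_upd (\<lambda>_. undefined) 0 y) \<in> borel \<rightarrow>\<^sub>M PiM {0..<Suc 0} (\<lambda>_. borel :: (real^'d) measure)"
    by (rule measurable_fun_upd[where J = "{}"]) (auto simp: space_PiM)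
  \<comment> \<open>The kernel with index 0 only places the path at the origin, as
    \<open>walk x 0\<close> does; it is not a step and carries no weight.\<close>
  have "IT.C 0 (Suc 0) (\<lambda>_. undefined) = IT.eP 0 (\<lambda>_. undefined)"
    using bind_return[OF IT.measurable_eP[of 0], OF u] by simp
  then have "(\<integral>\<^sup>+\<omega>. h \<omega> * confined V 0 \<omega> \<partial>IT.C 0 (Suc 0) (\<lambda>_. undefined))
    = (\<integral>\<^sup>+y. h (fun_upd (\<lambda>_. undefined) 0 y) * confined V 0 (fun_upd (\<lambda>_. undefined) 0 y) \<partial>P 0 (\<lambda>_. undefined))"
    using IT.nn_integral_eP[OF u h0] by simp
  also have "\<dots> = h (fun_upd (\<lambda>_. undefined) 0 0) * confined V 0 (fun_upd (\<lambda>_. undefined) 0 0)"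
    unfolding step_kernel_def using measurable_compose[OF upd h0]
    by (simp add: nn_integral_return)
  also have "\<dots> = (\<integral>\<^sup>+x. h (fun_upd (\<lambda>_. undefined) 0 0) * confined V 0 (fun_upd (\<lambda>_. undefined) 0 0) \<partial>seq.S)"
    using seq.P.emeasure_space_1 by simp
  also have "\<dots> = (\<integral>\<^sup>+x. h (restrict (walk x) {0..<Suc 0}) * step_weight f 0 (walk x) * confined V 0 (walk x) \<partial>seq.S)"
  proof (intro nn_integral_cong)
    fix x :: "nat \<Rightarrow> real^'d"
    have "restrict (walk x) {0..<Suc 0} = fun_upd (\<lambda>_. undefined) 0 0"
      by (auto simp: fun_eq_iff walk_def)
    moreover have "confined V 0 (walk x) = confined V 0 (fun_upd (\<lambda>_. undefined) 0 0)"
      by (rule confined_cong) (simp add: walk_def)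
    ultimately show "h (fun_upd (\<lambda>_. undefined) 0 0) * confined V 0 (fun_upd (\<lambda>_. undefined) 0 0)
       = h (restrict (walk x) {0..<Suc 0}) * step_weight f 0 (walk x) * confined V 0 (walk x)"
      by (simp add: step_weight_def)
  qed
  finally show ?case .
next
  case (Suc n)
  note h = Suc.prems
  have u: "(\<lambda>_. undefined) \<in> space (PiM {0..<0} (\<lambda>_. borel :: (real^'d) measure))"
    by (simp add: space_PiM PiE_def extensional_def)
  have hV: "(\<lambda>\<omega>. h \<omega> * confined V (Suc n) \<omega>) \<in> borel_measurable (PiM {0..<Suc (Suc n)} (\<lambda>_. borel))"
    using h measurable_confined[of "Suc n" "Suc (Suc n)"] by measurable
  \<comment> \<open>The last position is integrated out together with its indicator and the density
    of the step leading to it, expressed through the increment.\<close>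
  define h' where "h' \<omega> = (\<integral>\<^sup>+z. h (fun_upd \<omega> (Suc n) (z + \<omega> n)) * indicator (V (Suc n)) (z + \<omega> n) * f n (\<omega> n) (z + \<omega> n) \<partial>D)" for \<omega>
  have upd: "(\<lambda>p. fun_upd (X (fst p)) (Suc n) (snd p + X (fst p) n)) \<in> M \<Otimes>\<^sub>M D \<rightarrow>\<^sub>M PiM {0..<Suc (Suc n)} (\<lambda>_. borel)"
    if X: "X \<in> M \<rightarrow>\<^sub>M PiM {0..<Suc n} (\<lambda>_. borel)" for X :: "'x \<Rightarrow> nat \<Rightarrow> real^'d" and M
  proof (rule measurable_fun_upd[where J = "{0..<Suc n}"])
    show "{0..<Suc (Suc n)} = {0..<Suc n} \<union> {Suc n}" by auto
    show "(\<lambda>p. X (fst p)) \<in> M \<Otimes>\<^sub>M D \<rightarrow>\<^sub>M PiM {0..<Suc n} (\<lambda>_. borel)"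
      using X by measurable
    have "(\<lambda>x. X x n) \<in> M \<rightarrow>\<^sub>M borel"
      by (rule measurable_compose[OF X measurable_component_singleton]) simp
    then show "(\<lambda>p. snd p + X (fst p) n) \<in> M \<Otimes>\<^sub>M D \<rightarrow>\<^sub>M borel" by measurable
  qed
  have integrand: "(\<lambda>p. h (fun_upd (X (fst p)) (Suc n) (snd p + X (fst p) n)) * indicator (V (Suc n)) (snd p + X (fst p) n) * f n (X (fst p) n) (snd p + X (fst p) n))
      \<in> borel_measurable (M \<Otimes>\<^sub>M D)"
    if X: "X \<in> M \<rightarrow>\<^sub>M PiM {0..<Suc n} (\<lambda>_. borel)" for X :: "'x \<Rightarrow> nat \<Rightarrow> real^'d" and M
  proof -
    have "(\<lambda>x. X x n) \<in> M \<rightarrow>\<^sub>M borel"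
      by (rule measurable_compose[OF X measurable_component_singleton]) simp
    then have X1: "(\<lambda>p. X (fst p) n) \<in> M \<Otimes>\<^sub>M D \<rightarrow>\<^sub>M borel" "(\<lambda>p. snd p + X (fst p) n) \<in> M \<Otimes>\<^sub>M D \<rightarrow>\<^sub>M borel"
      by measurable
    have [measurable]: "(\<lambda>p. indicator (V (Suc n)) (snd p + X (fst p) n) :: ennreal) \<in> borel_measurable (M \<Otimes>\<^sub>M D)"
      by (rule measurable_compose[OF X1(2), where g = "indicator (V (Suc n))"]) measurable
    note [measurable] = measurable_compose[OF upd[OF X] h] measurable_f[OF X1]
    show ?thesis by measurable
  qed
  have h': "h' \<in> borel_measurable (PiM {0..<Suc n} (\<lambda>_. borel))"
    unfolding h'_def using integrand[OF measurable_ident_sets[OF refl]]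
    by (intro borel_measurable_nn_integral) (simp add: split_beta')
  have inner: "(\<integral>\<^sup>+\<omega>'. h \<omega>' * confined V (Suc n) \<omega>' \<partial>IT.eP (Suc n) \<omega>) = h' \<omega> * confined V n \<omega>"
    if \<omega>: "\<omega> \<in> space (PiM {0..<Suc n} (\<lambda>_. borel))" for \<omega>
  proof -
    have "(\<integral>\<^sup>+\<omega>'. h \<omega>' * confined V (Suc n) \<omega>' \<partial>IT.eP (Suc n) \<omega>)
      = (\<integral>\<^sup>+y. h (fun_upd \<omega> (Suc n) y) * confined V (Suc n) (fun_upd \<omega> (Suc n) y) \<partial>P (Suc n) \<omega>)"
      by (rule IT.nn_integral_eP[OF \<omega> hV])
    also have "\<dots> = (\<integral>\<^sup>+y. h (fun_upd \<omega> (Suc n) y) * (confined V n \<omega> * indicator (V (Suc n)) y) \<partial>P (Suc n) \<omega>)"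
    proof (intro nn_integral_cong)
      fix y
      have "confined V n (fun_upd \<omega> (Suc n) y) = confined V n \<omega>" by (rule confined_cong) auto
      then show "h (fun_upd \<omega> (Suc n) y) * confined V (Suc n) (fun_upd \<omega> (Suc n) y) = h (fun_upd \<omega> (Suc n) y) * (confined V n \<omega> * indicator (V (Suc n)) y)"
        by (simp add: confined_Suc)
    qed
    also have "\<dots> = h' \<omega> * confined V n \<omega>"
    \<comment> \<open>Off the confined histories both sides are 0, whatever the kernel is there; on
      them the hypothesis \<open>step\<close> supplies the density.\<close>
    proof (cases "\<forall>k\<le>n. \<omega> k \<in> V k")
      case False
      then show ?thesis by (simp add: confined_eq_0)
    next
      case True
      then have P: "P (Suc n) \<omega> = density (walk_kernel D (\<omega> n)) (f n (\<omega> n))"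
        by (intro step) auto
      have "(\<lambda>y. fun_upd \<omega> (Suc n) y) \<in> borel \<rightarrow>\<^sub>M PiM {0..<Suc (Suc n)} (\<lambda>_. borel)"
        using \<omega> by (intro measurable_fun_upd[where J = "{0..<Suc n}"]) auto
      from measurable_compose[OF this h]
      have [measurable]: "(\<lambda>y. h (fun_upd \<omega> (Suc n) y)) \<in> borel_measurable borel" .
      have "(\<integral>\<^sup>+y. h (fun_upd \<omega> (Suc n) y) * (confined V n \<omega> * indicator (V (Suc n)) y) \<partial>P (Suc n) \<omega>)
        = (\<integral>\<^sup>+y. f n (\<omega> n) y * (h (fun_upd \<omega> (Suc n) y) * (confined V n \<omega> * indicator (V (Suc n)) y)) \<partial>walk_kernel D (\<omega> n))"
        unfolding P
      proof (intro nn_integral_density)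
        have "(\<lambda>y. h (fun_upd \<omega> (Suc n) y) * (confined V n \<omega> * indicator (V (Suc n)) y)) \<in> borel_measurable borel"
          by measurable
        then show "(\<lambda>y. h (fun_upd \<omega> (Suc n) y) * (confined V n \<omega> * indicator (V (Suc n)) y)) \<in> borel_measurable (walk_kernel D (\<omega> n))"
          by (simp add: measurable_cong_sets[OF sets_walk_kernel refl])
        show "f n (\<omega> n) \<in> borel_measurable (walk_kernel D (\<omega> n))"
          using measurable_f2 by (simp add: measurable_cong_sets[OF sets_walk_kernel refl])
      qed
      also have "\<dots> = (\<integral>\<^sup>+z. f n (\<omega> n) (z + \<omega> n) * (h (fun_upd \<omega> (Suc n) (z + \<omega> n)) * (confined V n \<omega> * indicator (V (Suc n)) (z + \<omega> n))) \<partial>D)"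
        by (rule nn_integral_walk_kernel) measurable
      also have "\<dots> = (\<integral>\<^sup>+z. h (fun_upd \<omega> (Suc n) (z + \<omega> n)) * indicator (V (Suc n)) (z + \<omega> n) * f n (\<omega> n) (z + \<omega> n) * confined V n \<omega> \<partial>D)"
        by (simp only: mult_ac)
      also have "\<dots> = h' \<omega> * confined V n \<omega>"
        unfolding h'_def by (intro nn_integral_multc) measurable
      finally show ?thesis .
    qed
    finally show ?thesis .
  qed
  have C: "IT.C 0 (Suc n) (\<lambda>_. undefined) \<in> space (subprob_algebra (PiM {0..<Suc n} (\<lambda>_. borel)))"
    using measurable_space[OF IT.measurable_C[of 0 "Suc n"] u] by simp
  have spC: "space (IT.C 0 (Suc n) (\<lambda>_. undefined)) = space (PiM {0..<Suc n} (\<lambda>_. borel))"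
    using IT.space_C[OF u, of "Suc n"] by simp
  have "(\<integral>\<^sup>+\<omega>. h \<omega> * confined V (Suc n) \<omega> \<partial>IT.C 0 (Suc (Suc n)) (\<lambda>_. undefined))
    = (\<integral>\<^sup>+\<omega>. h \<omega> * confined V (Suc n) \<omega> \<partial>(IT.C 0 (Suc n) (\<lambda>_. undefined) \<bind> IT.eP (Suc n)))"
    by (simp only: IT.C.simps(2)[of 0 "Suc n"] add_0)
  also have "\<dots> = (\<integral>\<^sup>+\<omega>. \<integral>\<^sup>+\<omega>'. h \<omega>' * confined V (Suc n) \<omega>' \<partial>IT.eP (Suc n) \<omega> \<partial>IT.C 0 (Suc n) (\<lambda>_. undefined))"
  proof (rule nn_integral_bind[OF hV])
    have sC: "sets (IT.C 0 (Suc n) (\<lambda>_. undefined)) = sets (PiM {0..<Suc n} (\<lambda>_. borel))"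
      using IT.sets_C[OF u, of "Suc n"] by (simp only: add_0)
    show "IT.eP (Suc n) \<in> IT.C 0 (Suc n) (\<lambda>_. undefined) \<rightarrow>\<^sub>M subprob_algebra (PiM {0..<Suc (Suc n)} (\<lambda>_. borel))"
      using IT.measurable_eP[of "Suc n"] by (simp only: measurable_cong_sets[OF sC refl])
  qed
  also have "\<dots> = (\<integral>\<^sup>+\<omega>. h' \<omega> * confined V n \<omega> \<partial>IT.C 0 (Suc n) (\<lambda>_. undefined))"
    by (intro nn_integral_cong inner) (simp only: spC)
  also have "\<dots> = (\<integral>\<^sup>+x. h' (restrict (walk x) {0..<Suc n}) * step_weight f n (walk x) * confined V n (walk x) \<partial>seq.S)"
    by (rule Suc.IH[OF h'])
  also have "\<dots> = (\<integral>\<^sup>+x. \<integral>\<^sup>+z. h (fun_upd (restrict (walk x) {0..<Suc n}) (Suc n) (z + walk x n)) * indicator (V (Suc n)) (z + walk x n)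
       * f n (walk x n) (z + walk x n) * (step_weight f n (walk x) * confined V n (walk x)) \<partial>D \<partial>seq.S)" (is "_ = (\<integral>\<^sup>+x. \<integral>\<^sup>+z. ?\<Phi> x z \<partial>D \<partial>seq.S)")
  proof (intro nn_integral_cong)
    fix x :: "nat \<Rightarrow> real^'d"
    \<comment> \<open>A constant map from a one-point space specialises the joint measurability of
      the integrand to a fixed history.\<close>
    have "(\<lambda>_. restrict (walk x) {0..<Suc n}) \<in> count_space {()} \<rightarrow>\<^sub>M PiM {0..<Suc n} (\<lambda>_. borel)"
      by (simp add: space_PiM)
    note i1 = measurable_compose[OF measurable_Pair1' integrand[OF this], of "()"]
    have "h' (restrict (walk x) {0..<Suc n}) * (step_weight f n (walk x) * confined V n (walk x)) = (\<integral>\<^sup>+z. ?\<Phi> x z \<partial>D)"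
      unfolding h'_def using i1 by (subst nn_integral_multc[symmetric]) simp_all
    then show "h' (restrict (walk x) {0..<Suc n}) * step_weight f n (walk x) * confined V n (walk x) = (\<integral>\<^sup>+z. ?\<Phi> x z \<partial>D)"
      by (simp only: mult.assoc)
  qed
  \<comment> \<open>The increment integrated out separately becomes the entry \<open>x n\<close> of
    the sequence, since everything else in the integrand depends on earlier entries only.\<close>
  also have "\<dots> = (\<integral>\<^sup>+x. ?\<Phi> x (x n) \<partial>seq.S)"
  proof (rule nn_integral_indep_prefix[symmetric])
    have X: "(\<lambda>x. restrict (walk x) {0..<Suc n}) \<in> seq.S \<rightarrow>\<^sub>M PiM {0..<Suc n} (\<lambda>_. borel)"
      by (intro measurable_restrict measurable_walk)
    have "(\<lambda>p. step_weight f n (walk (fst p)) * confined V n (walk (fst p))) \<in> borel_measurable (seq.S \<Otimes>\<^sub>M D)"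
      by measurable
    from borel_measurable_times_ennreal[OF integrand[OF X] this]
    show "(\<lambda>(x, z). ?\<Phi> x z) \<in> borel_measurable (seq.S \<Otimes>\<^sub>M D)"
      by (simp add: split_beta')
  next
    fix x y z assume xy: "\<And>i. i < n \<Longrightarrow> x i = (y i :: real^'d)"
    have w: "walk x k = walk y k" if "k \<le> n" for k
      by (rule walk_cong[of n]) (use xy that in auto)
    have "restrict (walk x) {0..<Suc n} = restrict (walk y) {0..<Suc n}"
      using w by (auto simp: fun_eq_iff)
    moreover have "step_weight f n (walk x) = step_weight f n (walk y)" "confined V n (walk x) = confined V n (walk y)"
      by (intro step_weight_cong confined_cong w; simp)+
    ultimately show "?\<Phi> x z = ?\<Phi> y z" using w[of n] by simp
  qed
  also have "\<dots> = (\<integral>\<^sup>+x. h (restrict (walk x) {0..<Suc (Suc n)}) * step_weight f (Suc n) (walk x) * confined V (Suc n) (walk x) \<partial>seq.S)"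
  proof (intro nn_integral_cong)
    fix x :: "nat \<Rightarrow> real^'d"
    have w: "x n + walk x n = walk x (Suc n)" by (simp add: walk_def add.commute)
    have "fun_upd (restrict (walk x) {0..<Suc n}) (Suc n) (walk x (Suc n)) = restrict (walk x) {0..<Suc (Suc n)}"
      by (auto simp: fun_eq_iff)
    then show "?\<Phi> x (x n) = h (restrict (walk x) {0..<Suc (Suc n)}) * step_weight f (Suc n) (walk x) * confined V (Suc n) (walk x)"
      unfolding w by (simp only: step_weight_Suc confined_Suc mult_ac)
  qed
  finally show ?case .
qed

text \<open>Both sides are finite measures in \<open>B\<close>, so it suffices that they agree on
  cylinders. A cylinder may look beyond the time \<open>N\<close>; as no confinement and only
  trivial weights follow, the finite-time identity applies at a later time without change.\<close>

lemma approx_law_confined: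
  assumes B: "B \<in> sets path_space"
    and tail: "\<And>k. k > N \<Longrightarrow> V k = UNIV" "\<And>k s s1. k \<ge> N \<Longrightarrow> f k s s1 = 1"
  shows "(\<integral>\<^sup>+S. confined V N S * indicator B S \<partial>approx_law D b \<theta> c \<delta>2 v a G 0)
    = (\<integral>\<^sup>+x. step_weight f N (walk x) * confined V N (walk x) * indicator B (walk x) \<partial>seq.S)"
proof -
  let ?Q = "approx_law D b \<theta> c \<delta>2 v a G 0"
  have Qs [measurable_cong]: "sets ?Q = sets (PiM UNIV (\<lambda>_. borel))"
    using sets_approx_law by (simp add: path_space_def)
  have confined_m: "confined V m \<in> borel_measurable (PiM UNIV (\<lambda>_. borel))" for m
  proof -
    have "(\<lambda>S. indicator (V k) (S k) :: ennreal) \<in> borel_measurable (PiM UNIV (\<lambda>_. borel))" for k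
      by measurable
    then show ?thesis unfolding confined_def[abs_def] by (intro borel_measurable_prod_ennreal) auto
  qed
  then have confined_Q: "confined V m \<in> borel_measurable ?Q" for m
    by (simp add: measurable_cong_sets[OF Qs refl])
  define M1 where "M1 = density ?Q (confined V N)"
  define M2 where "M2 = distr (density seq.S (\<lambda>x. step_weight f N (walk x) * confined V N (walk x))) (PiM UNIV (\<lambda>_. borel)) walk"
  have walkm: "walk \<in> seq.S \<rightarrow>\<^sub>M PiM UNIV (\<lambda>_. borel)"
    using measurable_walk_path by (simp add: path_space_def)
  have e1: "emeasure M1 X = (\<integral>\<^sup>+S. confined V N S * indicator X S \<partial>?Q)" if "X \<in> sets (PiM UNIV (\<lambda>_. borel))" for X
    unfolding M1_def using that confined_Q by (subst emeasure_density) (auto simp: Qs)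
  have e2: "emeasure M2 X = (\<integral>\<^sup>+x. step_weight f N (walk x) * confined V N (walk x) * indicator X (walk x) \<partial>seq.S)"
    if X: "X \<in> sets (PiM UNIV (\<lambda>_. borel))" for X
  proof -
    have "emeasure M2 X = emeasure (density seq.S (\<lambda>x. step_weight f N (walk x) * confined V N (walk x)))
       (walk -` X \<inter> space (density seq.S (\<lambda>x. step_weight f N (walk x) * confined V N (walk x))))"
      unfolding M2_def using walkm X by (intro emeasure_distr) simp_all
    also have "\<dots> = emeasure (density seq.S (\<lambda>x. step_weight f N (walk x) * confined V N (walk x))) (walk -` X \<inter> space seq.S)"
      by (simp only: space_density)
    also have "\<dots> = (\<integral>\<^sup>+x. step_weight f N (walk x) * confined V N (walk x) * indicator (walk -` X \<inter> space seq.S) x \<partial>seq.S)"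
      by (rule emeasure_density[OF _ measurable_sets[OF walkm X]]) measurable
    also have "\<dots> = (\<integral>\<^sup>+x. step_weight f N (walk x) * confined V N (walk x) * indicator X (walk x) \<partial>seq.S)"
      by (intro nn_integral_cong) (simp add: indicator_def)
    finally show ?thesis .
  qed
  have "M1 = M2"
  proof (rule measure_eqI_PiM_infinite)
    show "sets M1 = PiM UNIV (\<lambda>_. borel)" by (simp add: M1_def Qs)
    show "sets M2 = PiM UNIV (\<lambda>_. borel)" by (simp add: M2_def)
    interpret Q: prob_space ?Q by (rule prob_space_approx_law)
    have "confined V N S \<le> 1" for S
      unfolding confined_def by (intro prod_le_1) (auto simp: indicator_def)
    then have "(\<integral>\<^sup>+S. confined V N S * indicator (space ?Q) S \<partial>?Q) \<le> (\<integral>\<^sup>+S. 1 \<partial>?Q)"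
      by (intro nn_integral_mono) (auto simp: indicator_def)
    also have "\<dots> < \<infinity>" using Q.emeasure_space_1 by simp
    finally show "finite_measure M1"
      unfolding M1_def using confined_Q by (intro finite_measureI) (simp add: emeasure_density)
    fix A :: "nat \<Rightarrow> (real^'d) set" and J :: "nat set"
    assume J: "finite J" and A: "\<And>i. i \<in> J \<Longrightarrow> A i \<in> sets borel"
    let ?X = "prod_emb UNIV (\<lambda>_. borel) J (Pi\<^sub>E J A)"
    have X: "?X \<in> sets (PiM UNIV (\<lambda>_. borel))"
      using J A by (intro sets_PiM_I) auto
    \<comment> \<open>A time that covers \<open>N\<close> and all coordinates of the cylinder;
      inserting 0 keeps the maximum defined for empty \<open>J\<close>.\<close>
    define m where "m = max N (Max (insert 0 J))"
    have "i \<le> m" if "i \<in> J" for i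
    proof -
      have "i \<le> Max (insert 0 J)" using J that by (intro Max_ge) auto
      then show ?thesis by (simp add: m_def)
    qed
    then have m: "N \<le> m" "J \<subseteq> {0..<Suc m}"
      by (auto simp: m_def less_Suc_eq_le)
    have memX: "S \<in> ?X \<longleftrightarrow> (\<forall>i\<in>J. S i \<in> A i)" for S
      by (auto simp: prod_emb_def PiE_iff space_PiM)
    define h where "h \<omega> = (indicator (prod_emb {0..<Suc m} (\<lambda>_. borel) J (Pi\<^sub>E J A)) \<omega> :: ennreal)" for \<omega> :: "nat \<Rightarrow> real^'d"
    have h: "h \<in> borel_measurable (PiM {0..<Suc m} (\<lambda>_. borel))"
      unfolding h_def using J A m by (intro borel_measurable_indicator sets_PiM_I) auto
    have hX: "h (restrict S {0..<Suc m}) = indicator ?X S" for S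
    proof -
      have "restrict S {0..<Suc m} \<in> prod_emb {0..<Suc m} (\<lambda>_. borel) J (Pi\<^sub>E J A) \<longleftrightarrow> (\<forall>i\<in>J. S i \<in> A i)"
        using m(2) by (auto simp: prod_emb_def PiE_iff space_PiM subset_iff)
      then show ?thesis by (simp add: h_def indicator_def memX)
    qed
    have confined_tail: "confined V m S = confined V N S" for S
      using m(1)
    proof (induction rule: dec_induct)
      case (step k)
      then show ?case by (simp add: confined_Suc tail(1))
    qed simp
    have weight_tail: "step_weight f m S = step_weight f N S" for S
      using m(1)
    proof (induction rule: dec_induct)
      case (step k)
      then show ?case by (simp add: step_weight_Suc tail(2))
    qed simp
    have hV: "(\<lambda>\<omega>. h \<omega> * confined V m \<omega>) \<in> borel_measurable (PiM {0..<Suc m} (\<lambda>_. borel))"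
      using h measurable_confined[of m "Suc m"] by measurable
    have "emeasure M1 ?X = (\<integral>\<^sup>+S. h (restrict S {0..<Suc m}) * confined V m (restrict S {0..<Suc m}) \<partial>?Q)"
      unfolding e1[OF X]
    proof (intro nn_integral_cong)
      fix S :: "nat \<Rightarrow> real^'d"
      have "confined V m (restrict S {0..<Suc m}) = confined V m S"
        by (rule confined_cong) auto
      then show "confined V N S * indicator ?X S = h (restrict S {0..<Suc m}) * confined V m (restrict S {0..<Suc m})"
        by (simp add: hX confined_tail mult.commute)
    qed
    also have "\<dots> = (\<integral>\<^sup>+\<omega>. h \<omega> * confined V m \<omega> \<partial>IT.C 0 (Suc m) (\<lambda>_. undefined))"
      by (rule nn_integral_approx_law[OF hV])
    also have "\<dots> = (\<integral>\<^sup>+x. h (restrict (walk x) {0..<Suc m}) * step_weight f m (walk x) * confined V m (walk x) \<partial>seq.S)"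
      by (rule nn_integral_C_eq[OF h])
    also have "\<dots> = emeasure M2 ?X"
      unfolding e2[OF X] by (intro nn_integral_cong) (simp add: hX confined_tail weight_tail mult_ac)
    finally show "emeasure M1 ?X = emeasure M2 ?X" .
  qed
  with e1[of B] e2[of B] B show ?thesis by (simp add: path_space_def)
qed

end

end

end

section \<open>The limit measure and the enlarged target\<close>

lemma regvar_tail_of_mv_regularly_varying:
  fixes D :: "(real^'d) measure"
  assumes "prob_space D" "sets D = sets borel" "\<alpha> > 1" "mv_regularly_varying D \<alpha> \<mu>"
  shows "regvar_tail (\<lambda>b. \<P>(x in D. norm x > b)) \<alpha>"
proof
  interpret prob_space D by fact
  note [measurable_cong] = assms(2)
  have sp: "space D = UNIV" using sets_eq_imp_space_eq[OF assms(2)] by simp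
  show "antimono (\<lambda>b. \<P>(x in D. norm x > b))"
  proof (rule antimonoI)
    fix b c :: real assume "b \<le> c"
    show "\<P>(x in D. norm x > c) \<le> \<P>(x in D. norm x > b)"
    proof (rule finite_measure_mono)
      show "{x \<in> space D. norm x > c} \<subseteq> {x \<in> space D. norm x > b}" using \<open>b \<le> c\<close> by auto
    qed measurable
  qed
  obtain Lf where Lf: "slowly_varying Lf" "\<And>b. b > 0 \<Longrightarrow> \<P>(x in D. norm x > b) = b powr (- \<alpha>) * Lf b"
    using assms(4) unfolding mv_regularly_varying_def by blast
  fix c :: real assume c: "c > 0"
  have "((\<lambda>b. c powr (- \<alpha>) * (Lf (c * b) / Lf b)) \<longlongrightarrow> c powr (- \<alpha>) * 1) at_top"
    using Lf(1) c unfolding slowly_varying_def by (intro tendsto_mult tendsto_const) auto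
  then have lim: "((\<lambda>b. c powr (- \<alpha>) * (Lf (c * b) / Lf b)) \<longlongrightarrow> c powr (- \<alpha>)) at_top" by simp
  have "eventually (\<lambda>b. c powr (- \<alpha>) * (Lf (c * b) / Lf b) = \<P>(x in D. norm x > c * b) / \<P>(x in D. norm x > b)) at_top"
    using eventually_gt_at_top[of 0]
  proof eventually_elim
    case (elim b)
    have "(c * b) powr (- \<alpha>) = c powr (- \<alpha>) * b powr (- \<alpha>)" using elim c by (simp add: powr_mult)
    moreover have "b powr (- \<alpha>) \<noteq> 0" using elim by simp
    moreover have "c * b > 0" using elim c by simp
    ultimately show ?case using Lf(2)[OF elim] Lf(2)[of "c * b"] by simp
  qed
  with lim show "((\<lambda>b. \<P>(x in D. norm x > c * b) / \<P>(x in D. norm x > b)) \<longlongrightarrow> c powr (- \<alpha>)) at_top"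
    by (rule Lim_transform_eventually)
qed (use assms in auto)

text \<open>The projection of the compactification to a cube, used to extend functions with compact
  support in the cube from \<open>real^'d\<close>.\<close>

definition clamp_ereal :: "real \<Rightarrow> ereal^'d \<Rightarrow> real^'d" where
  "clamp_ereal R y = (\<chi> i. real_of_ereal (max (- ereal R) (min (ereal R) (y $ i))))"

lemma continuous_clamp_ereal: "continuous_on UNIV (clamp_ereal R :: ereal^'d \<Rightarrow> real^'d)"
  unfolding clamp_ereal_def
proof (intro continuous_on_vec_lambda)
  fix i :: 'd
  have *: "continuous_on UNIV (\<lambda>y::ereal^'d. max (- ereal R) (min (ereal R) (y $ i)))"
    by (intro continuous_on_max continuous_on_min continuous_on_const)
       (simp add: continuous_on_def tendsto_vec_nth)
  have mem: "max (- ereal R) (min (ereal R) z) \<in> UNIV - {\<infinity>, - \<infinity>}" for z :: ereal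
    by (cases z) (auto simp: max_def min_def)
  show "continuous_on UNIV (\<lambda>y::ereal^'d. real_of_ereal (max (- ereal R) (min (ereal R) (y $ i))))"
    by (rule continuous_on_compose2[OF continuous_on_real *], rule image_subsetI, rule mem)
qed

lemma clamp_ereal_emb:
  assumes "norm x \<le> R"
  shows "clamp_ereal R (emb x) = x"
proof -
  have "\<bar>x $ i\<bar> \<le> R" for i
    using component_le_norm_cart[of x i] assms by linarith
  then have "- R \<le> x $ i" "x $ i \<le> R" for i
    by (auto simp: abs_le_iff minus_le_iff)
  then show ?thesis
    by (simp add: clamp_ereal_def emb_def vec_eq_iff min_absorb2 max_absorb2)
qed

text \<open>The strict inequality matters: a coordinate that was cut off, in particular an infinite
  one, would have modulus \<open>R\<close>.\<close>

lemma emb_clamp_ereal: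
  assumes "norm (clamp_ereal R y) < R"
  shows "y = emb (clamp_ereal R y)"
  unfolding vec_eq_iff
proof
  fix i
  have "\<bar>clamp_ereal R y $ i\<bar> < R"
    using component_le_norm_cart[of "clamp_ereal R y" i] assms by linarith
  then show "y $ i = emb (clamp_ereal R y) $ i"
    by (cases "y $ i") (auto simp: clamp_ereal_def emb_def max_def min_def abs_if split: if_splits)
qed

lemma continuous_emb: "continuous_on A emb"
  unfolding emb_def by (intro continuous_on_vec_lambda continuous_on_ereal continuous_intros)

lemma emb_eq_0_iff [simp]: "0 = emb x \<longleftrightarrow> x = 0"
  by (auto simp: emb_def vec_eq_iff zero_ereal_def)

lemma inj_emb: "inj emb"
  by (auto simp: inj_def emb_def vec_eq_iff)

lemma continuous_rfun: "continuous_on A (rfun b v a)"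
proof -
  have "dist (rfun b v a z) (rfun b v a w) \<le> vmax v * dist z w" for z w
    using rfun_add_le[of b v a w "z - w"] rfun_add_ge[of b v a w "z - w"]
    by (auto simp: dist_norm abs_le_iff)
  then have "lipschitz_on (vmax v) A (rfun b v a)"
    by (intro lipschitz_onI vmax_nonneg)
  then show ?thesis by (rule lipschitz_on_continuous_on)
qed

lemma rfun_scale:
  assumes "b > 0"
  shows "rfun 1 v a (x /\<^sub>R b) > u \<longleftrightarrow> rfun b v a x > u * b"
  unfolding rfun_gt_iff using assms by (simp add: field_simps)

section \<open>Positive limit mass of the target\<close>

context rv_target
begin

text \<open>Vague convergence tests only continuous functions with compact support, while the target
  is open and unbounded. A compact piece of positive mass is selected, and a bump function that is 1
  on it and vanishes where \<open>r 1\<close> is at most \<open>u\<close> transfers the mass to the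
  increments.\<close>

lemma target_prob_ge:
  assumes rv: "mv_regularly_varying D \<alpha> \<mu>" and pos: "emeasure \<mu> (emb ` halfspaces v a) > 0"
  shows "\<exists>u>0. \<exists>c>0. eventually (\<lambda>b. \<P>(x in D. r b x > u * b) \<ge> c * tail b) at_top"
proof -
  have sets_\<mu>: "sets \<mu> = sets (restrict_space borel (- {0}))"
    and compact_\<mu>: "\<And>C. compact C \<Longrightarrow> 0 \<notin> C \<Longrightarrow> emeasure \<mu> C < \<infinity>"
    using rv unfolding mv_regularly_varying_def punctured_radon_def by auto
  have vague: "((\<lambda>b. (\<integral>x. f (emb (x /\<^sub>R b)) \<partial>D) / tail b) \<longlongrightarrow> (\<integral>y. f y \<partial>\<mu>)) at_top" if "punctured_test f" for f
    using rv that unfolding mv_regularly_varying_def tail_def by blast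
  have r0: "r 1 0 < 0"
    using r_le[of 1 0] amin_pos by simp
  \<comment> \<open>These pieces exhaust the target: the norm bound keeps them away from infinity,
    the positive level makes them closed and bounded away from the origin.\<close>
  define A where "A n = {x. norm x \<le> real n \<and> r 1 x \<ge> 1 / (real n + 1)}" for n :: nat
  have compactA: "compact {x. norm x \<le> R \<and> r 1 x \<ge> w}" for R w
  proof -
    have "closed {x. w \<le> r 1 x}"
      by (intro closed_Collect_le continuous_on_const continuous_rfun)
    then have "compact (cball 0 R \<inter> {x. w \<le> r 1 x})"
      by (intro compact_Int_closed) auto
    also have "cball 0 R \<inter> {x. w \<le> r 1 x} = {x. norm x \<le> R \<and> r 1 x \<ge> w}" by auto
    finally show ?thesis .
  qed
  have compact_emb: "compact (emb ` {x. norm x \<le> R \<and> r 1 x \<ge> w})" for R w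
    by (intro compact_continuous_image continuous_emb compactA)
  have zero_emb: "0 \<notin> emb ` {x. norm x \<le> R \<and> r 1 x \<ge> w}" if "w \<ge> 0" for R w
    using r0 that by (auto simp: image_iff)
  have sets_emb: "emb ` {x. norm x \<le> R \<and> r 1 x \<ge> w} \<in> sets \<mu>" if "w \<ge> 0" for R w
  proof -
    \<comment> \<open>The clamp acts at radius \<open>R + 1\<close>, so a point whose clamped image
      has norm at most \<open>R\<close> was not altered. The embedded set is therefore the preimage
      of a closed set under a continuous map.\<close>
    have cont: "continuous_on UNIV (clamp_ereal (R + 1) :: ereal^'d \<Rightarrow> real^'d)"
      by (rule continuous_clamp_ereal)
    have "emb ` {x. norm x \<le> R \<and> r 1 x \<ge> w}
      = {y. norm (clamp_ereal (R + 1) y) \<le> R} \<inter> {y. w \<le> r 1 (clamp_ereal (R + 1) y)}"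
    proof (intro equalityI subsetI)
      fix y assume "y \<in> emb ` {x. norm x \<le> R \<and> r 1 x \<ge> w}"
      then show "y \<in> {y. norm (clamp_ereal (R + 1) y) \<le> R} \<inter> {y. w \<le> r 1 (clamp_ereal (R + 1) y)}"
        by (auto simp: clamp_ereal_emb)
    next
      fix y :: "ereal^'d"
      assume y: "y \<in> {y. norm (clamp_ereal (R + 1) y) \<le> R} \<inter> {y. w \<le> r 1 (clamp_ereal (R + 1) y)}"
      then have "y = emb (clamp_ereal (R + 1) y)"
        by (intro emb_clamp_ereal) auto
      with y show "y \<in> emb ` {x. norm x \<le> R \<and> r 1 x \<ge> w}"
        by (intro image_eqI[of _ _ "clamp_ereal (R + 1) y"]) auto
    qed
    also have "closed \<dots>"
      by (intro closed_Int closed_Collect_le continuous_on_const continuous_on_norm cont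
          continuous_on_compose2[OF continuous_rfun cont]) auto
    finally have "emb ` {x. norm x \<le> R \<and> r 1 x \<ge> w} \<in> sets borel"
      by (rule borel_closed)
    then show ?thesis
      unfolding sets_\<mu> sets_restrict_space
    proof (rule rev_image_eqI)
      have aux: "A = - {0} \<inter> A" if "0 \<notin> A" for A :: "(ereal^'d) set"
        using that by blast
      show "emb ` {x. norm x \<le> R \<and> r 1 x \<ge> w} = - {0} \<inter> emb ` {x. norm x \<le> R \<and> r 1 x \<ge> w}"
        by (rule aux[OF zero_emb[OF that]])
    qed
  qed
  have "\<exists>n. emeasure \<mu> (emb ` A n) \<noteq> 0"
  proof (rule ccontr)
    assume "\<not> (\<exists>n. emeasure \<mu> (emb ` A n) \<noteq> 0)"
    then have "emeasure \<mu> (\<Union>n. emb ` A n) = 0"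
      using sets_emb unfolding A_def by (intro emeasure_UN_eq_0) auto
    also have "(\<Union>n. emb ` A n) = emb ` halfspaces v a"
    proof -
      have "(\<Union>n. A n) = halfspaces v a"
      proof (intro equalityI subsetI)
        fix x assume "x \<in> (\<Union>n. A n)"
        then obtain n where "r 1 x \<ge> 1 / (real n + 1)" by (auto simp: A_def)
        moreover have "1 / (real n + 1) > 0" by simp
        ultimately have "r 1 x > 0" by linarith
        then show "x \<in> halfspaces v a" by (auto simp: rfun_gt_iff halfspaces_def)
      next
        fix x assume "x \<in> halfspaces v a"
        then have x: "r 1 x > 0" by (auto simp: rfun_gt_iff halfspaces_def)
        obtain n :: nat where n: "real n > max (norm x) (1 / r 1 x)"
          using reals_Archimedean2 by blast
        then have "1 / r 1 x < real n + 1" by simp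
        then have "1 / (real n + 1) \<le> r 1 x"
          using x by (simp add: field_simps)
        then have "x \<in> A n" using n by (simp add: A_def)
        then show "x \<in> (\<Union>n. A n)" by blast
      qed
      then show ?thesis by (metis image_UN)
    qed
    finally show False using pos by simp
  qed
  then obtain n where n: "emeasure \<mu> (emb ` A n) \<noteq> 0" by blast
  define w where "w = 1 / (real n + 1)"
  define u where "u = w / 2"
  have "w > 0" by (simp add: w_def)
  then have w: "w > 0" "u > 0" "u < w" by (auto simp: u_def)
  \<comment> \<open>Larger than the radius \<open>n + 1\<close> outside which \<psi> vanishes, so
    \<open>f\<close> can be nonzero only at points left unaltered by the clamp, and never at
    infinite ones.\<close>
  define R where "R = real n + 2"
  \<comment> \<open>Two ramps: one falls from 1 to 0 between the norms \<open>n\<close> and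
    \<open>n + 1\<close>, the other rises from 0 to 1 as \<open>r 1\<close> goes from
    \<open>u\<close> to \<open>w\<close>.\<close>
  define \<psi> where "\<psi> x = max 0 (min 1 (real n + 1 - norm x)) * max 0 (min 1 ((r 1 x - u) / (w - u)))" for x
  define f where "f y = \<psi> (clamp_ereal R y)" for y
  have \<psi>_bounds: "0 \<le> \<psi> x" "\<psi> x \<le> 1" for x
    by (auto simp: \<psi>_def intro!: mult_le_one)
  have \<psi>_0: "\<psi> x = 0" if "\<not> (norm x < real n + 1 \<and> r 1 x > u)" for x
  proof (cases "norm x < real n + 1")
    case True
    then have "(r 1 x - u) / (w - u) \<le> 0" using that w by (intro divide_nonpos_pos) auto
    then show ?thesis by (simp add: \<psi>_def)
  qed (simp add: \<psi>_def)
  have \<psi>_1: "\<psi> x = 1" if "x \<in> A n" for x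
  proof -
    have "(r 1 x - u) / (w - u) \<ge> 1" using that w by (simp add: A_def w_def[symmetric] le_divide_eq)
    then show ?thesis using that by (simp add: \<psi>_def A_def)
  qed
  have cont\<psi>: "continuous_on UNIV \<psi>"
    unfolding \<psi>_def using w by (intro continuous_intros continuous_rfun) auto
  have contf: "continuous_on UNIV f"
    unfolding f_def by (rule continuous_on_compose2[OF cont\<psi> continuous_clamp_ereal]) simp
  define C where "C = emb ` {x. norm x \<le> real n + 1 \<and> r 1 x \<ge> u}"
  have C: "compact C" "0 \<notin> C" "C \<in> sets \<mu>"
    unfolding C_def using w by (intro compact_emb sets_emb zero_emb; simp)+
  have supp: "f y = 0" if "y \<notin> C" for y
  proof (rule ccontr)
    assume "f y \<noteq> 0"
    then have *: "norm (clamp_ereal R y) < real n + 1" "r 1 (clamp_ereal R y) > u"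
      using \<psi>_0[of "clamp_ereal R y"] by (auto simp: f_def)
    then have "y = emb (clamp_ereal R y)"
      by (intro emb_clamp_ereal) (simp add: R_def)
    then have "y \<in> C"
      using * unfolding C_def by (intro image_eqI[of _ _ "clamp_ereal R y"]) auto
    then show False using that by simp
  qed
  have test: "punctured_test f"
    unfolding punctured_test_def using contf C supp by blast
  have f_bounds: "0 \<le> f y" "f y \<le> 1" for y by (simp_all add: f_def \<psi>_bounds)
  have fm: "f \<in> borel_measurable \<mu>"
  proof -
    have "f \<in> borel_measurable (restrict_space borel (- {0}))"
      by (intro measurable_restrict_space1 borel_measurable_continuous_onI contf)
    then show ?thesis by (simp add: measurable_cong_sets[OF sets_\<mu> refl])
  qed
  have fin_C: "emeasure \<mu> C < \<infinity>" by (intro compact_\<mu> C)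
  have int_C: "integrable \<mu> (indicator C :: _ \<Rightarrow> real)"
    using C fin_C by simp
  have int_f: "integrable \<mu> f"
  proof (rule Bochner_Integration.integrable_bound[OF int_C fm])
    show "AE y in \<mu>. norm (f y) \<le> norm (indicator C y :: real)"
      using f_bounds supp by (intro AE_I2) (auto simp: indicator_def)
  qed
  have An: "emb ` A n \<in> sets \<mu>" "emeasure \<mu> (emb ` A n) < \<infinity>"
    unfolding A_def by (intro sets_emb compact_\<mu> compact_emb zero_emb; simp)+
  have "0 < measure \<mu> (emb ` A n)"
    using n An by (simp add: measure_def enn2real_positive_iff zero_less_iff_neq_zero)
  also have "\<dots> = (\<integral>y. indicator (emb ` A n) y \<partial>\<mu>)"
    using An sets.sets_into_space[OF An(1)] by (simp add: Int_absorb2)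
  also have "\<dots> \<le> (\<integral>y. f y \<partial>\<mu>)"
  proof (intro integral_mono int_f)
    show "integrable \<mu> (indicator (emb ` A n) :: _ \<Rightarrow> real)" using An by simp
    fix y
    show "indicator (emb ` A n) y \<le> f y"
    proof (cases "y \<in> emb ` A n")
      case True
      then obtain x where x: "y = emb x" "x \<in> A n" by blast
      then have "clamp_ereal R y = x"
        by (simp add: clamp_ereal_emb A_def R_def)
      then show ?thesis using x True \<psi>_1 by (simp add: f_def)
    qed (simp add: f_bounds)
  qed
  finally have int_pos: "0 < (\<integral>y. f y \<partial>\<mu>)" .
  define c where "c = (\<integral>y. f y \<partial>\<mu>) / 2"
  have c: "c > 0" "c < (\<integral>y. f y \<partial>\<mu>)" using int_pos by (auto simp: c_def)
  have "eventually (\<lambda>b. c < (\<integral>x. f (emb (x /\<^sub>R b)) \<partial>D) / tail b) at_top"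
    by (rule order_tendstoD(1)[OF vague[OF test] c(2)])
  then have "eventually (\<lambda>b. \<P>(x in D. r b x > u * b) \<ge> c * tail b) at_top"
    using eventually_gt_at_top[of 0]
  proof eventually_elim
    case (elim b)
    have "(\<integral>x. f (emb (x /\<^sub>R b)) \<partial>D) \<le> (\<integral>x. indicator {x. r b x > u * b} x \<partial>D)"
    proof (rule integral_mono')
      show "integrable D (indicator {x. r b x > u * b} :: _ \<Rightarrow> real)"
        by (intro integrable_real_indicator) (auto simp: emeasure_eq_measure)
      fix x
      show "0 \<le> (indicator {x. r b x > u * b} x :: real)" by simp
      show "f (emb (x /\<^sub>R b)) \<le> indicator {x. r b x > u * b} x"
      proof (cases "r b x > u * b")
        case False
        have "f (emb (x /\<^sub>R b)) = 0"
        proof (rule ccontr)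
          assume "f (emb (x /\<^sub>R b)) \<noteq> 0"
          then have *: "norm (clamp_ereal R (emb (x /\<^sub>R b))) < real n + 1" "r 1 (clamp_ereal R (emb (x /\<^sub>R b))) > u"
            using \<psi>_0[of "clamp_ereal R (emb (x /\<^sub>R b))"] by (auto simp: f_def)
          then have "emb (x /\<^sub>R b) = emb (clamp_ereal R (emb (x /\<^sub>R b)))"
            by (intro emb_clamp_ereal) (simp add: R_def)
          then have "clamp_ereal R (emb (x /\<^sub>R b)) = x /\<^sub>R b"
            using inj_emb by (metis injD)
          with *(2) have "r 1 (x /\<^sub>R b) > u" by simp
          then show False using False rfun_scale[OF elim(2)] by blast
        qed
        then show ?thesis by simp
      qed (simp add: f_bounds)
    qed
    also have "\<dots> = \<P>(x in D. r b x > u * b)" by simp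
    finally have "(\<integral>x. f (emb (x /\<^sub>R b)) \<partial>D) \<le> \<P>(x in D. r b x > u * b)" .
    moreover have "c * tail b < (\<integral>x. f (emb (x /\<^sub>R b)) \<partial>D)"
      using elim H_pos[of b] by (simp add: field_simps)
    ultimately show ?case by linarith
  qed
  with w c show ?thesis by blast
qed

end

section \<open>Lower bounds on the tail and the integrated tail\<close>

locale rv_target_pos = rv_target D \<alpha> v a
  for D :: "(real^'d) measure" and \<alpha> and v :: "'m::finite \<Rightarrow> real^'d" and a +
  assumes target_prob: "\<exists>u>0. \<exists>c>0. eventually (\<lambda>b. \<P>(x in D. r b x > u * b) \<ge> c * tail b) at_top"
begin

text \<open>The target at a larger scale \<open>K * b\<close> lies deep inside the target at scale
  \<open>b\<close>. With \<open>amin * K = amax + M\<close> it lies where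
  \<open>r b > M * b\<close>, and regular variation compares the tails at the two scales.\<close>

lemma prob_r_ge:
  assumes "M \<ge> 0"
  shows "\<exists>c>0. eventually (\<lambda>b. \<P>(x in D. r b x > M * b) \<ge> c * tail b) at_top"
proof -
  obtain u c where uc: "u > 0" "c > 0" "eventually (\<lambda>b. \<P>(x in D. r b x > u * b) \<ge> c * tail b) at_top"
    using target_prob by blast
  define K where "K = (amax + M) / amin"
  have "amin \<le> amax" using amin_le le_amax order_trans by blast
  then have K: "K > 0" "amin * K = amax + M"
    using amin_pos assms by (auto simp: K_def)
  obtain K' where K': "K' > 0" "eventually (\<lambda>b. tail (K * b) \<ge> K' * tail b) at_top"
    using H_scale_ge[OF K(1)] by blast
  have "eventually (\<lambda>b. \<P>(x in D. r (K * b) x > u * (K * b)) \<ge> c * tail (K * b)) at_top"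
  proof (rule eventually_compose_filterlim[OF uc(3)])
    show "filterlim (\<lambda>b. K * b) at_top at_top" using K(1) by real_asymp
  qed
  then have "eventually (\<lambda>b. \<P>(x in D. r b x > M * b) \<ge> (c * K') * tail b) at_top"
    using K'(2) eventually_gt_at_top[of 0]
  proof eventually_elim
    case (elim b)
    have "(c * K') * tail b \<le> c * tail (K * b)" using elim uc by simp
    also have "\<dots> \<le> \<P>(x in D. r (K * b) x > u * (K * b))" by fact
    also have "\<dots> \<le> \<P>(x in D. r b x > M * b)"
    proof (rule finite_measure_mono)
      show "{x \<in> space D. r (K * b) x > u * (K * b)} \<subseteq> {x \<in> space D. r b x > M * b}"
      proof safe
        fix x assume "u * (K * b) < r (K * b) x"
        then obtain j where j: "x \<bullet> v j - a j * (K * b) > u * (K * b)"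
          using rfun_gt_iff by blast
        have "u * (K * b) > 0" using uc K elim by simp
        moreover have "amin * (K * b) \<le> a j * (K * b)"
          using amin_le K elim by (intro mult_right_mono) auto
        moreover have "amin * (K * b) = amax * b + M * b"
          using K(2) by (simp add: mult.assoc[symmetric] distrib_right)
        moreover have "a j * b \<le> amax * b" using le_amax elim by (intro mult_right_mono) auto
        ultimately have "x \<bullet> v j - a j * b > M * b" using j by linarith
        then show "r b x > M * b" using rfun_gt_iff by blast
      qed
    qed measurable
    finally show ?case .
  qed
  then show ?thesis using uc K' by (intro exI[of _ "c * K'"]) simp
qed

lemma Iex_ge:
  assumes "M \<ge> 0"
  shows "\<exists>c>0. eventually (\<lambda>b. Iex v a b (M * b) \<ge> c * g b) at_top"
proof -
  obtain c where c: "c > 0" "eventually (\<lambda>b. \<P>(x in D. r b x > (M + 1) * b) \<ge> c * tail b) at_top"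
    using prob_r_ge[of "M + 1"] assms by auto
  have "eventually (\<lambda>b. Iex v a b (M * b) \<ge> c * g b) at_top"
    using c(2) eventually_gt_at_top[of 0]
  proof eventually_elim
    case (elim b)
    have "c * g b = b * (c * tail b)" by (simp add: g_def)
    also have "\<dots> \<le> b * \<P>(x in D. r b x > (M + 1) * b)"
      using elim by (intro mult_left_mono) auto
    also have "\<dots> \<le> Iex v a b (M * b) - Iex v a b ((M + 1) * b)"
      using Iex_diff_ge[of "M * b" "(M + 1) * b" b v a] elim by (simp add: algebra_simps)
    also have "\<dots> \<le> Iex v a b (M * b)" using Iex_nonneg by simp
    finally show ?case .
  qed
  with c show ?thesis by blast
qed

end

section \<open>The cost of enlarging the target\<close>

lemma norm_eta_ge_1: "1 \<le> norm (eta :: real^'d)"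
proof -
  have "\<bar>(eta :: real^'d) $ undefined\<bar> \<le> norm (eta :: real^'d)" by (rule component_le_norm_cart)
  then show ?thesis by (simp add: eta_def)
qed

context rv_target
begin

lemma enlarged_simps:
  "enlarged_normals \<delta> v (Inl j) = v j"
  "enlarged_normals \<delta> v (Inr (Inl j)) = (v j + (\<delta> / (norm (eta :: real^'d))\<^sup>2) *\<^sub>R eta) /\<^sub>R (1 - \<delta>)"
  "enlarged_normals \<delta> v (Inr (Inr i)) = axis i 1"
  "enlarged_levels \<beta> a (Inl j :: 'm + 'm + 'd) = a j"
  "enlarged_levels \<beta> a (Inr (Inl j) :: 'm + 'm + 'd) = a j"
  "enlarged_levels \<beta> a (Inr (Inr i) :: 'm + 'm + 'd) = \<beta>"
  by (simp_all add: enlarged_normals_def enlarged_levels_def)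

text \<open>Tilting changes the inner product with the drift to \<open>- 1 + \<delta>\<close>, and
  dividing by \<open>1 - \<delta>\<close> restores \<open>- 1\<close>; the coordinate vectors have
  this inner product by the choice of the drift.\<close>

lemma rv_target_enlarged:
  assumes "0 < \<delta>" "\<delta> < 1" "\<beta> > 0"
  shows "rv_target D \<alpha> (enlarged_normals \<delta> v) (enlarged_levels \<beta> a)"
proof
  fix k :: "'m + 'm + 'd"
  have "eta \<bullet> (eta :: real^'d) = (norm (eta :: real^'d))\<^sup>2" by (simp add: power2_norm_eq_inner)
  moreover have "norm (eta :: real^'d) \<noteq> 0" using norm_eta_ge_1[where 'd = 'd] by linarith
  moreover have "eta \<bullet> axis i (1::real) = - 1" for i :: 'd
    by (simp add: inner_axis eta_def)
  moreover have "eta \<bullet> ((v j + (\<delta> / (norm (eta :: real^'d))\<^sup>2) *\<^sub>R eta) /\<^sub>R (1 - \<delta>)) = - 1" for j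
  proof -
    have "eta \<bullet> (v j + (\<delta> / (norm (eta :: real^'d))\<^sup>2) *\<^sub>R eta) = - 1 + \<delta>"
      using calculation(1,2) by (simp add: inner_add_right eta_v)
    then show ?thesis using assms by (simp add: divide_simps)
  qed
  ultimately show "eta \<bullet> enlarged_normals \<delta> v k = -1"
    by (auto simp: enlarged_normals_def eta_v split: sum.splits)
  show "0 < enlarged_levels \<beta> a k"
    using assms a_pos by (auto simp: enlarged_levels_def split: sum.splits)
qed

lemma rfun_enlarged_ge: "r b x \<le> rfun b (enlarged_normals \<delta> v) (enlarged_levels \<beta> a) x"
  unfolding rfun_le_iff
proof
  fix j
  show "x \<bullet> v j - a j * b \<le> rfun b (enlarged_normals \<delta> v) (enlarged_levels \<beta> a) x"
    using rfun_ge[of x "enlarged_normals \<delta> v" "Inl j" "enlarged_levels \<beta> a" b] by (simp add: enlarged_simps)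
qed

text \<open>A tilted functional exceeds the original one by at most
  \<open>2 * \<delta> * (L + 1) * norm x\<close>, as \<open>\<delta> \<le> 1 / 2\<close>. If
  \<open>(2 * L + 1) * norm x\<close> is at most \<open>amin * b\<close>, the tilted functional is
  still nonpositive, so the excess counts only for large increments. A coordinate functional is
  positive only beyond norm \<open>\<beta> * b\<close>.\<close>

lemma rfun_enlarged_le:
  assumes b: "b > 0" and \<delta>: "0 < \<delta>" "\<delta> \<le> 1 / 2" and \<beta>: "\<beta> > 0"
  shows "max 0 (rfun b (enlarged_normals \<delta> v) (enlarged_levels \<beta> a) x)
    \<le> max 0 (r b x) + 2 * \<delta> * (L + 1) * (norm x * indicator {x. norm x > amin / (2 * L + 1) * b} x)
      + norm x * indicator {x. norm x > \<beta> * b} x" (is "_ \<le> ?rhs")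
proof -
  have nonneg: "0 \<le> 2 * \<delta> * (L + 1) * (norm x * indicator {x. norm x > amin / (2 * L + 1) * b} x)"
    "0 \<le> norm x * indicator {x. norm x > \<beta> * b} x"
    using \<delta> L_pos by auto
  have "x \<bullet> enlarged_normals \<delta> v k - enlarged_levels \<beta> a k * b \<le> ?rhs" for k
  proof (cases k)
    case (Inl j)
    have "x \<bullet> v j - a j * b \<le> r b x" by (rule rfun_ge)
    then show ?thesis unfolding Inl enlarged_simps using nonneg by linarith
  next
    case (Inr k')
    show ?thesis
    proof (cases k')
      case (Inl j)
      define y where "y = x \<bullet> v j + (x \<bullet> eta) / (norm (eta :: real^'d))\<^sup>2"
      have eq: "x \<bullet> enlarged_normals \<delta> v (Inr (Inl j)) - a j * b = (x \<bullet> v j - a j * b) + (\<delta> / (1 - \<delta>)) * y"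
        using \<delta> by (simp add: enlarged_simps y_def inner_add_right divide_simps) (simp add: algebra_simps)
      have "(x \<bullet> eta) / (norm (eta :: real^'d))\<^sup>2 \<le> norm x"
      proof -
        have "(x \<bullet> eta) / (norm (eta :: real^'d))\<^sup>2 \<le> (norm x * norm (eta :: real^'d)) / (norm (eta :: real^'d))\<^sup>2"
          by (intro divide_right_mono norm_cauchy_schwarz) simp
        also have "\<dots> = norm x / norm (eta :: real^'d)" by (simp add: power2_eq_square)
        also have "\<dots> \<le> norm x / 1" using norm_eta_ge_1[where 'd = 'd] by (intro divide_left_mono) auto
        finally show ?thesis by simp
      qed
      then have "y \<le> (L + 1) * norm x" using inner_le_vmax[of x v j] by (simp add: y_def algebra_simps)
      then have "(\<delta> / (1 - \<delta>)) * y \<le> (\<delta> / (1 - \<delta>)) * ((L + 1) * norm x)"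
        using \<delta> by (intro mult_left_mono) auto
      also have "\<dots> \<le> (2 * \<delta>) * ((L + 1) * norm x)"
        using \<delta> L_pos by (intro mult_right_mono) (auto simp: field_simps)
      finally have y: "(\<delta> / (1 - \<delta>)) * y \<le> 2 * \<delta> * (L + 1) * norm x" by (simp add: mult.assoc)
      show ?thesis
      proof (cases "norm x > amin / (2 * L + 1) * b")
        case True
        have "x \<bullet> v j - a j * b \<le> r b x" by (rule rfun_ge)
        moreover have "2 * \<delta> * (L + 1) * (norm x * indicator {x. norm x > amin / (2 * L + 1) * b} x) = 2 * \<delta> * (L + 1) * norm x"
          using True by simp
        moreover have "r b x \<le> max 0 (r b x)" by simp
        ultimately show ?thesis unfolding Inr Inl enlarged_simps(5) eq using y nonneg(2) by linarith
      next
        case False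
        then have "(2 * L + 1) * norm x \<le> amin * b"
          using L_pos by (simp add: field_simps not_less)
        moreover have "2 * \<delta> * (L + 1) * norm x \<le> 1 * (L + 1) * norm x"
          using \<delta> L_pos by (intro mult_right_mono) auto
        moreover have "amin * b \<le> a j * b" using amin_le b by (intro mult_right_mono) auto
        moreover have "x \<bullet> v j \<le> L * norm x" by (rule inner_le_vmax)
        ultimately have "(x \<bullet> v j - a j * b) + (\<delta> / (1 - \<delta>)) * y \<le> 0"
          using y by (simp add: algebra_simps)
        then show ?thesis unfolding Inr Inl enlarged_simps(5) eq using nonneg by linarith
      qed
    next
      case (Inr i)
      have xi: "x \<bullet> axis i 1 \<le> norm x"
        using component_le_norm_cart[of x i] by (simp add: inner_axis)
      have "\<beta> * b > 0" using \<beta> b by simp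
      show ?thesis
      proof (cases "norm x > \<beta> * b")
        case True
        then have "norm x * indicator {x. norm x > \<beta> * b} x = norm x" by simp
        moreover have "0 \<le> max 0 (r b x)" by simp
        ultimately show ?thesis unfolding \<open>k = Inr k'\<close> Inr enlarged_simps
          using xi nonneg(1) \<open>\<beta> * b > 0\<close> by linarith
      next
        case False
        moreover have "0 \<le> max 0 (r b x)" by simp
        ultimately show ?thesis unfolding \<open>k = Inr k'\<close> Inr enlarged_simps
          using xi nonneg by linarith
      qed
    qed
  qed
  then have "rfun b (enlarged_normals \<delta> v) (enlarged_levels \<beta> a) x \<le> ?rhs"
    unfolding rfun_le_iff by blast
  moreover have "0 \<le> ?rhs" using nonneg by linarith
  ultimately show ?thesis by simp
qed

text \<open>The tilted half-spaces cost \<delta> times a truncated mean of order \<open>g b\<close>;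
  the coordinate half-spaces cost the truncated mean beyond \<open>\<beta> * b\<close>, which is a
  small multiple of \<open>g b\<close> for large \<beta>.\<close>

lemma Iex_enlarged_le:
  assumes "e > 0"
  shows "\<exists>\<delta>0>0. \<exists>\<beta>0>0. \<forall>\<delta> \<beta>. 0 < \<delta> \<and> \<delta> \<le> \<delta>0 \<and> \<beta>0 \<le> \<beta> \<longrightarrow>
    eventually (\<lambda>b. Iex (enlarged_normals \<delta> v) (enlarged_levels \<beta> a) b 0 \<le> Iex v a b 0 + e * g b) at_top"
proof -
  have "amin / (2 * L + 1) > 0" using amin_pos L_pos by simp
  then obtain K where K: "K > 0" "eventually (\<lambda>b. trunc_mean (amin / (2 * L + 1) * b) \<le> K * g b) at_top"
    using trunc_mean_scale_le by blast
  obtain \<beta>0 where \<beta>0: "\<beta>0 > 0" "\<And>\<beta>. \<beta> \<ge> \<beta>0 \<Longrightarrow> eventually (\<lambda>b. trunc_mean (\<beta> * b) \<le> (e / 2) * g b) at_top"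
    using trunc_mean_scale_small[of "e / 2"] assms by auto
  define \<delta>0 where "\<delta>0 = min (1 / 2) (e / (4 * (L + 1) * K))"
  have \<delta>0: "\<delta>0 > 0" "\<delta>0 \<le> 1 / 2" "2 * \<delta>0 * (L + 1) * K \<le> e / 2"
  proof -
    show "\<delta>0 > 0" using assms K L_pos by (simp add: \<delta>0_def)
    show "\<delta>0 \<le> 1 / 2" by (simp only: \<delta>0_def min.cobounded1)
    have "\<delta>0 \<le> e / (4 * (L + 1) * K)" by (simp add: \<delta>0_def)
    then have "\<delta>0 * (4 * (L + 1) * K) \<le> e" using K L_pos by (simp add: pos_le_divide_eq)
    then show "2 * \<delta>0 * (L + 1) * K \<le> e / 2" by (simp add: mult_ac)
  qed
  have "eventually (\<lambda>b. Iex (enlarged_normals \<delta> v) (enlarged_levels \<beta> a) b 0 \<le> Iex v a b 0 + e * g b) at_top"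
    if d: "0 < \<delta>" "\<delta> \<le> \<delta>0" "\<beta>0 \<le> \<beta>" for \<delta> \<beta>
    using K(2) \<beta>0(2)[OF d(3)] eventually_gt_at_top[of 0]
  proof eventually_elim
    case (elim b)
    have d': "\<delta> \<le> 1 / 2" "\<beta> > 0" using d \<delta>0 \<beta>0 by auto
    let ?c = "amin / (2 * L + 1)"
    have i: "integrable D (\<lambda>x. 2 * \<delta> * (L + 1) * (norm x * indicator {x. norm x > ?c * b} x))"
      by (intro integrable_mult_right integrable_trunc_mean)
    have "Iex (enlarged_normals \<delta> v) (enlarged_levels \<beta> a) b 0
      \<le> (\<integral>x. max 0 (r b x - 0) + 2 * \<delta> * (L + 1) * (norm x * indicator {x. norm x > ?c * b} x)
          + norm x * indicator {x. norm x > \<beta> * b} x \<partial>D)"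
      unfolding Iex_def
    proof (rule integral_mono)
      show "integrable D (\<lambda>x. max 0 (r b x - 0) + 2 * \<delta> * (L + 1) * (norm x * indicator {x. norm x > ?c * b} x)
          + norm x * indicator {x. norm x > \<beta> * b} x)"
        by (intro Bochner_Integration.integrable_add integrable_Iex i integrable_trunc_mean)
    next
      show "integrable D (\<lambda>x. max 0 (rfun b (enlarged_normals \<delta> v) (enlarged_levels \<beta> a) x - 0))"
        by (rule integrable_Iex)
    qed (use rfun_enlarged_le[OF elim(3) d(1) d'] in simp)
    also have "\<dots> = Iex v a b 0 + 2 * \<delta> * (L + 1) * trunc_mean (?c * b) + trunc_mean (\<beta> * b)"
    proof -
      have "(\<integral>x. max 0 (r b x - 0) + 2 * \<delta> * (L + 1) * (norm x * indicator {x. norm x > ?c * b} x)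
          + norm x * indicator {x. norm x > \<beta> * b} x \<partial>D)
        = (\<integral>x. max 0 (r b x - 0) + 2 * \<delta> * (L + 1) * (norm x * indicator {x. norm x > ?c * b} x) \<partial>D) + trunc_mean (\<beta> * b)"
        unfolding trunc_mean_def
        by (intro Bochner_Integration.integral_add Bochner_Integration.integrable_add integrable_Iex i integrable_trunc_mean)
      also have "(\<integral>x. max 0 (r b x - 0) + 2 * \<delta> * (L + 1) * (norm x * indicator {x. norm x > ?c * b} x) \<partial>D)
        = (\<integral>x. max 0 (r b x - 0) \<partial>D) + (\<integral>x. 2 * \<delta> * (L + 1) * (norm x * indicator {x. norm x > ?c * b} x) \<partial>D)"
        by (intro Bochner_Integration.integral_add integrable_Iex i)
      also have "(\<integral>x. 2 * \<delta> * (L + 1) * (norm x * indicator {x. norm x > ?c * b} x) \<partial>D) = 2 * \<delta> * (L + 1) * trunc_mean (?c * b)"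
        unfolding trunc_mean_def by (rule integral_mult_right_zero)
      finally show ?thesis by (simp only: Iex_def)
    qed
    also have "2 * \<delta> * (L + 1) * trunc_mean (?c * b) \<le> (2 * \<delta>0 * (L + 1)) * (K * g b)"
      using d elim L_pos trunc_mean_nonneg \<delta>0 by (intro mult_mono mult_nonneg_nonneg) auto
    also have "(2 * \<delta>0 * (L + 1)) * (K * g b) = (2 * \<delta>0 * (L + 1) * K) * g b" by simp
    also have "\<dots> \<le> e / 2 * g b"
      using \<delta>0 g_pos[OF elim(3)] by (intro mult_right_mono) auto
    also have "trunc_mean (\<beta> * b) \<le> e / 2 * g b" using elim by simp
    finally show ?case by (simp add: algebra_simps)
  qed
  then show ?thesis using \<delta>0(1) \<beta>0(1) by blast
qed

end

section \<open>Total variation\<close>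

lemma hit_time_less_infinity_iff: "hit_time C S < \<infinity> \<longleftrightarrow> (\<exists>n. S n \<in> C)"
  unfolding hit_time_def INF_less_iff by auto

lemma dilate_upper_halfspace:
  assumes "b > 0"
  shows "dilate b {y :: real^'d. y \<bullet> e \<ge> t} = {y. y \<bullet> e \<ge> t * b}"
proof (intro equalityI subsetI)
  fix y assume "y \<in> dilate b {y. y \<bullet> e \<ge> t}"
  then show "y \<in> {y. y \<bullet> e \<ge> t * b}"
    using assms by (auto simp: dilate_def mult.commute)
next
  fix y assume "y \<in> {y. y \<bullet> e \<ge> t * b}"
  then have "(1 / b) *\<^sub>R y \<in> {y. y \<bullet> e \<ge> t}" "y = b *\<^sub>R ((1 / b) *\<^sub>R y)"
    using assms by (auto simp: field_simps)
  then show "y \<in> dilate b {y. y \<bullet> e \<ge> t}" unfolding dilate_def by blast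
qed

context rv_increments
begin

lemma walk_law_eq: "walk_law D 0 = distr seq.S path_space walk"
  by (simp add: walk_law_def walk_def[abs_def])

end

section \<open>The conditional law in terms of increments\<close>

context rv_target
begin

lemma measure_cond_walk_law:
  assumes b: "b > 0" and p: "measure seq.S (hit b) > 0" and B: "B \<in> sets path_space"
  shows "measure (cond_walk_law D (dilate b (halfspaces v a)) 0) B = measure seq.S {x \<in> hit b. walk x \<in> B} / measure seq.S (hit b)"
    "prob_space (cond_walk_law D (dilate b (halfspaces v a)) 0)"
    "sets (cond_walk_law D (dilate b (halfspaces v a)) 0) = sets (path_space :: (nat \<Rightarrow> real^'d) measure)"
proof -
  define H where "H = {S \<in> space (walk_law D 0). hit_time (dilate b (halfspaces v a)) S < \<infinity>}"
  interpret WL: prob_space "walk_law D 0"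
    unfolding walk_law_eq by (rule seq.P.prob_space_distr) measurable
  have sp: "space (walk_law D 0) = UNIV" "sets (walk_law D 0) = sets (path_space :: (nat \<Rightarrow> real^'d) measure)"
    by (simp_all add: walk_law_eq path_space_def space_PiM PiE_UNIV_domain)
  have H_eq: "H = {S \<in> space path_space. \<exists>n. r b (S n) > 0}"
    unfolding H_def hit_time_less_infinity_iff mem_dilate_iff[OF b]
    by (simp add: sp path_space_def space_PiM PiE_UNIV_domain)
  have H: "H \<in> sets path_space"
    unfolding H_eq path_space_def by measurable
  have pre: "measure (walk_law D 0) X = measure seq.S {x. walk x \<in> X}" if "X \<in> sets path_space" for X
    unfolding walk_law_eq using that by (subst measure_distr) (auto simp: vimage_def)
  have hitH: "{x. walk x \<in> H \<inter> X} = {x \<in> hit b. walk x \<in> X}" for X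
    by (auto simp: H_eq hit_def path_space_def space_PiM PiE_UNIV_domain)
  have mH: "measure (walk_law D 0) H = measure seq.S (hit b)"
    using pre[OF H] hitH[of UNIV] by simp
  have nz: "emeasure (walk_law D 0) H \<noteq> 0" "emeasure (walk_law D 0) H \<noteq> \<infinity>"
    using p mH by (auto simp: WL.emeasure_eq_measure)
  have cond: "cond_walk_law D (dilate b (halfspaces v a)) 0 = uniform_measure (walk_law D 0) H"
    by (simp add: cond_walk_law_def H_def)
  show "measure (cond_walk_law D (dilate b (halfspaces v a)) 0) B = measure seq.S {x \<in> hit b. walk x \<in> B} / measure seq.S (hit b)"
    unfolding cond using nz H B sp pre[of "H \<inter> B"] hitH[of B] mH
    by (subst measure_uniform_measure) auto
  show "prob_space (cond_walk_law D (dilate b (halfspaces v a)) 0)"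
    unfolding cond by (rule prob_space_uniform_measure[OF nz])
  show "sets (cond_walk_law D (dilate b (halfspaces v a)) 0) = sets (path_space :: (nat \<Rightarrow> real^'d) measure)"
    unfolding cond by (simp add: sp)
qed

end

text \<open>The enlarged family enters as a second target with a larger \<open>r\<close>; how much
  larger its integrated tail is becomes a hypothesis of the final lower bound.\<close>

locale rv_enlarged = rv_target D \<alpha> v a + E: rv_target D \<alpha> v' a'
  for D :: "(real^'d) measure" and \<alpha> and v :: "'m::finite \<Rightarrow> real^'d" and a
    and v' :: "'j::finite \<Rightarrow> real^'d" and a' +
  assumes r_le_r': "rfun b v a x \<le> rfun b v' a' x"
begin

text \<open>The event \<open>good\<close> seen from path space, where the approximating law lives;
  \<open>good\<close> itself is an event of increment sequences.\<close>

definition path_good :: "real \<Rightarrow> real \<Rightarrow> nat \<Rightarrow> (nat \<Rightarrow> real^'d) set" where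
  "path_good \<kappa> b n = {S. (\<forall>k\<le>n. norm (S k - real k *\<^sub>R eta) \<le> \<kappa> * b) \<and> r b (S (Suc n)) > 0}"

lemma walk_in_path_good_iff: "walk x \<in> path_good \<kappa> b n \<longleftrightarrow> x \<in> good \<kappa> b n"
  by (simp add: path_good_def good_def walk_eq)

lemma sets_path_good: "path_good \<kappa> b n \<in> sets path_space"
proof -
  have "path_good \<kappa> b n = {S \<in> space (PiM UNIV (\<lambda>_. borel)). (\<forall>k\<le>n. norm (S k - real k *\<^sub>R eta) \<le> \<kappa> * b) \<and> r b (S (Suc n)) > 0}"
    by (auto simp: path_good_def space_PiM PiE_UNIV_domain)
  also have "\<dots> \<in> sets (PiM UNIV (\<lambda>_. borel))" by measurable
  finally show ?thesis by (simp add: path_space_def)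
qed

lemma disjoint_path_good:
  assumes "b > 0" "L * \<kappa> < amin"
  shows "disjoint_family (path_good \<kappa> b)"
proof -
  have False if S: "S \<in> path_good \<kappa> b n" "S \<in> path_good \<kappa> b m" "n < m" for S n m
  proof -
    have "norm (S (Suc n) - real (Suc n) *\<^sub>R eta) \<le> \<kappa> * b"
      using S(2,3) unfolding path_good_def by (auto simp del: of_nat_Suc)
    from r_tube(2)[OF this, of 0]
    have "r b (S (Suc n)) \<le> r b 0 - real (Suc n) + L * \<kappa> * b" by simp
    moreover have "r b 0 \<le> - amin * b" using r_le[of b 0] assms(1) by simp
    moreover have "L * \<kappa> * b \<le> amin * b" using assms by (intro mult_right_mono) auto
    ultimately have "r b (S (Suc n)) \<le> 0" by simp
    then show False using S(1) by (simp add: path_good_def)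
  qed
  then show ?thesis
    unfolding disjoint_family_on_def by (metis disjoint_iff linorder_neqE_nat)
qed

text \<open>On such paths the switch to the random walk kernel happens exactly at time
  \<open>Suc n\<close>. The likelihood ratio is therefore the product of the kernel densities at
  times 0 to \<open>n\<close>, for which \<open>density_product_ge\<close> gives one bound valid for
  all good paths.\<close>

lemma approx_law_path_good_ge:
  assumes b: "b > 0" and \<theta>: "0 < \<theta>" "\<theta> < 1" and c: "0 < c" "c < 1"
    and \<kappa>: "0 \<le> \<kappa>" "\<delta>2 + vmax v' * \<kappa> \<le> E.amin" "0 < \<delta>2"
    and M: "M \<ge> 0"
    and \<kappa>'': "vmax v' * \<kappa> + (1 - c) * (E.amax + M + vmax v' * \<kappa>) \<le> \<kappa>''"
    and pos: "\<P>(x in D. rfun b v' a' x > M * b + vmax v' * \<kappa> * b) > 0"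
    and comparable: "\<And>k::nat. real k \<le> M * b \<Longrightarrow> \<theta> * Iex v' a' b (real k - 1 - \<kappa>'' * b) \<le> Iex v' a' b (real k + vmax v' * \<kappa> * b)"
    and Ipos: "Iex v' a' b (M * b + vmax v' * \<kappa> * b) > 0"
    and \<gamma>: "M * (norm (eta :: real^'d))\<^sup>2 + \<kappa> * norm (eta :: real^'d) < \<gamma>"
    and n: "real n \<le> M * b" and B: "B \<in> sets path_space"
  defines "Q \<equiv> approx_law D b \<theta> c \<delta>2 v' a' {y. y \<bullet> eta \<ge> \<gamma>} 0"
  shows "\<theta> / Iex v' a' b (- 1 - \<kappa>'' * b) * measure seq.S {x \<in> good \<kappa> b n. walk x \<in> B} \<le> measure Q (path_good \<kappa> b n \<inter> B)"
proof -
  let ?G = "{y :: real^'d. y \<bullet> eta \<ge> \<gamma>}"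
  define lb where "lb = \<theta> / Iex v' a' b (- 1 - \<kappa>'' * b)"
  have lb: "lb \<ge> 0" unfolding lb_def using \<theta> by (intro divide_nonneg_nonneg Iex_nonneg) simp
  have \<theta>0: "\<theta> \<ge> 0" using \<theta> by simp
  have Gm: "dilate b ?G \<in> sets borel"
    unfolding dilate_upper_halfspace[OF b] by measurable
  define V where "V k = (if k \<le> n then {s. norm (s - real k *\<^sub>R eta) \<le> \<kappa> * b} else if k = Suc n then {s. r b s > 0} else UNIV)" for k
  define f where "f k s s1 = (if k \<le> n then ennreal (kernel_density D b \<theta> c \<delta>2 v' a' s s1) else 1)" for k s s1
  have Vm: "V k \<in> sets borel" for k
  proof -
    have "{s \<in> space borel. norm (s - real k *\<^sub>R eta) \<le> \<kappa> * b} \<in> sets borel" by measurable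
    moreover have "{s \<in> space borel. r b s > 0} \<in> sets borel" by measurable
    ultimately show ?thesis by (simp add: V_def)
  qed
  have fm: "(\<lambda>(s, s1). f k s s1) \<in> borel_measurable (borel \<Otimes>\<^sub>M borel)" for k
  proof (cases "k \<le> n")
    case True
    have "(\<lambda>z. ennreal (kernel_density D b \<theta> c \<delta>2 v' a' (fst z) (snd z))) \<in> borel_measurable (borel \<Otimes>\<^sub>M borel)"
      using measurable_kernel_density[OF b] by measurable
    then show ?thesis using True by (simp add: f_def split_beta')
  qed (simp add: f_def split_beta')
  have step: "step_kernel D b \<theta> c \<delta>2 v' a' ?G 0 (Suc m) S = density (walk_kernel D (S m)) (f m (S m))"
    if S: "\<And>k. k \<le> m \<Longrightarrow> S k \<in> V k" for m S
  proof (cases "m \<le> n")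
    case True
    \<comment> \<open>In the tube up to time \<open>M * b\<close> the path is below the enlarged
      target, and its component along the drift is less than \<open>\<gamma> * b\<close>.\<close>
    have "S k \<notin> dilate b (halfspaces v' a') \<and> S k \<notin> dilate b ?G" if k: "k \<le> m" for k
    proof
      have kn: "k \<le> n" using k True by simp
      have tube: "norm (S k - real k *\<^sub>R eta) \<le> \<kappa> * b"
        using S[OF k] kn by (simp add: V_def)
      have "rfun b v' a' (0 + S k) \<le> rfun b v' a' 0 - real k + vmax v' * \<kappa> * b"
        by (rule E.r_tube(2)[OF tube])
      moreover have "rfun b v' a' 0 \<le> - E.amin * b" using E.r_le[of b 0] b by simp
      moreover have "vmax v' * \<kappa> * b \<le> E.amin * b" using \<kappa> b by (intro mult_right_mono) auto
      ultimately have "rfun b v' a' (S k) \<le> 0" by simp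
      then show "S k \<notin> dilate b (halfspaces v' a')" using b by (simp add: mem_dilate_iff)
      have "S k \<bullet> eta = (S k - real k *\<^sub>R eta) \<bullet> eta + real k * (norm (eta :: real^'d))\<^sup>2"
        by (simp add: inner_diff_left power2_norm_eq_inner)
      also have "(S k - real k *\<^sub>R eta) \<bullet> eta \<le> norm (S k - real k *\<^sub>R eta) * norm (eta :: real^'d)"
        by (rule norm_cauchy_schwarz)
      also have "\<dots> \<le> \<kappa> * b * norm (eta :: real^'d)"
        using tube by (intro mult_right_mono) auto
      also have "real k * (norm (eta :: real^'d))\<^sup>2 \<le> M * b * (norm (eta :: real^'d))\<^sup>2"
        using kn n by (intro mult_right_mono) auto
      finally have "S k \<bullet> eta \<le> (M * (norm (eta :: real^'d))\<^sup>2 + \<kappa> * norm (eta :: real^'d)) * b"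
        by (simp add: algebra_simps)
      also have "\<dots> < \<gamma> * b" using \<gamma> b by simp
      finally show "S k \<notin> dilate b ?G" unfolding dilate_upper_halfspace[OF b] by simp
    qed
    then have "step_kernel D b \<theta> c \<delta>2 v' a' ?G 0 (Suc m) S = mixed_kernel D b \<theta> c \<delta>2 v' a' (S m)"
      unfolding step_kernel_Suc[OF b \<theta>0 Gm] by simp
    also have "\<dots> = density (walk_kernel D (S m)) (f m (S m))"
      unfolding mixed_kernel_eq f_def using True by simp
    finally show ?thesis .
  next
    case False
    \<comment> \<open>By time \<open>m\<close> the original target has been hit, hence also the
      enlarged one, so the steps follow the random walk.\<close>
    then have "S (Suc n) \<in> V (Suc n)" by (intro S) simp
    then have "r b (S (Suc n)) > 0" by (simp add: V_def)
    then have "rfun b v' a' (S (Suc n)) > 0" using r_le_r'[of b "S (Suc n)"] by linarith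
    then have "S (Suc n) \<in> dilate b (halfspaces v' a')" using b by (simp add: mem_dilate_iff)
    then have "step_kernel D b \<theta> c \<delta>2 v' a' ?G 0 (Suc m) S = walk_kernel D (S m)"
      unfolding step_kernel_Suc[OF b \<theta>0 Gm] using False by (auto simp: not_le Suc_le_eq)
    also have "\<dots> = density (walk_kernel D (S m)) (f m (S m))"
    proof -
      have "f m (S m) = (\<lambda>_. 1)" using False by (simp add: f_def fun_eq_iff)
      then show ?thesis by (simp only: density_1)
    qed
    finally show ?thesis .
  qed
  have confined_eq: "confined V (Suc n) S = indicator (path_good \<kappa> b n) S" for S
  proof (cases "S \<in> path_good \<kappa> b n")
    case True
    then have "S k \<in> V k" if "k \<le> Suc n" for k
      using that by (auto simp: path_good_def V_def le_Suc_eq)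
    then have "confined V (Suc n) S = 1"
      unfolding confined_def by (intro prod.neutral) auto
    then show ?thesis using True by simp
  next
    case False
    have "\<exists>k\<le>Suc n. S k \<notin> V k"
    proof (rule ccontr)
      assume "\<not> (\<exists>k\<le>Suc n. S k \<notin> V k)"
      then have SV: "S k \<in> V k" if "k \<le> Suc n" for k using that by blast
      have "norm (S k - real k *\<^sub>R eta) \<le> \<kappa> * b" if "k \<le> n" for k
        using SV[of k] that by (simp add: V_def)
      moreover have "r b (S (Suc n)) > 0"
        using SV[of "Suc n"] by (simp add: V_def)
      ultimately show False using False by (simp add: path_good_def)
    qed
    then have "confined V (Suc n) S = 0"
      unfolding confined_def by (intro prod_zero) (auto simp: indicator_def)
    then show ?thesis using False by simp
  qed
  have main: "(\<integral>\<^sup>+S. confined V (Suc n) S * indicator B S \<partial>Q)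
    = (\<integral>\<^sup>+x. step_weight f (Suc n) (walk x) * confined V (Suc n) (walk x) * indicator B (walk x) \<partial>seq.S)"
    unfolding Q_def
  proof (rule approx_law_confined[OF b \<theta>0 Gm Vm fm step B])
    show "V k = UNIV" if "k > Suc n" for k using that by (simp add: V_def)
    show "f k s s1 = 1" if "k \<ge> Suc n" for k s s1 using that by (simp add: f_def)
  qed
  interpret Q: prob_space Q
    unfolding Q_def by (rule prob_space_approx_law[OF b \<theta>0 Gm])
  have setsQ: "sets Q = sets path_space"
    unfolding Q_def by (rule sets_approx_law[OF b \<theta>0 Gm])
  have inB: "path_good \<kappa> b n \<inter> B \<in> sets Q"
    using sets_path_good B by (simp add: setsQ)
  have Xm: "{x \<in> good \<kappa> b n. walk x \<in> B} \<in> sets seq.S"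
  proof -
    have "{x \<in> good \<kappa> b n. walk x \<in> B} = good \<kappa> b n \<inter> (walk -` B \<inter> space seq.S)" by auto
    also have "\<dots> \<in> sets seq.S"
      using measurable_sets[OF measurable_walk_path B] sets_good by blast
    finally show ?thesis .
  qed
  have "ennreal lb * emeasure seq.S {x \<in> good \<kappa> b n. walk x \<in> B}
    = (\<integral>\<^sup>+x. ennreal lb * indicator {x \<in> good \<kappa> b n. walk x \<in> B} x \<partial>seq.S)"
    using Xm by (simp add: nn_integral_cmult_indicator)
  also have "\<dots> \<le> (\<integral>\<^sup>+x. step_weight f (Suc n) (walk x) * confined V (Suc n) (walk x) * indicator B (walk x) \<partial>seq.S)"
  proof (intro nn_integral_mono)
    fix x
    show "ennreal lb * indicator {x \<in> good \<kappa> b n. walk x \<in> B} x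
      \<le> step_weight f (Suc n) (walk x) * confined V (Suc n) (walk x) * indicator B (walk x)"
    proof (cases "x \<in> good \<kappa> b n \<and> walk x \<in> B")
      case True
      then have pg: "walk x \<in> path_good \<kappa> b n" by (simp add: walk_in_path_good_iff)
      have "lb \<le> (\<Prod>k\<le>n. kernel_density D b \<theta> c \<delta>2 v' a' (walk x k) (walk x (Suc k)))"
        unfolding lb_def
      proof (rule E.density_product_ge[OF b \<theta> c \<kappa> M \<kappa>'' pos comparable Ipos n])
        show "norm (walk x k - real k *\<^sub>R eta) \<le> \<kappa> * b" if "k \<le> n" for k
          using pg that by (simp add: path_good_def)
        show "rfun b v' a' (walk x (Suc n)) > 0"
          using pg r_le_r'[of b "walk x (Suc n)"] by (simp add: path_good_def)
      qed
      then have "ennreal lb \<le> ennreal (\<Prod>k\<le>n. kernel_density D b \<theta> c \<delta>2 v' a' (walk x k) (walk x (Suc k)))"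
        by (rule ennreal_leI)
      also have "\<dots> = (\<Prod>k\<le>n. ennreal (kernel_density D b \<theta> c \<delta>2 v' a' (walk x k) (walk x (Suc k))))"
        by (intro prod_ennreal[symmetric] kernel_density_nonneg \<theta>0)
      also have "\<dots> = step_weight f (Suc n) (walk x)"
        unfolding step_weight_def f_def lessThan_Suc_atMost by (intro prod.cong) auto
      finally show ?thesis using True pg by (simp add: confined_eq)
    qed simp
  qed
  also have "\<dots> = (\<integral>\<^sup>+S. confined V (Suc n) S * indicator B S \<partial>Q)" by (rule main[symmetric])
  also have "\<dots> = (\<integral>\<^sup>+S. indicator (path_good \<kappa> b n \<inter> B) S \<partial>Q)"
    by (intro nn_integral_cong) (simp add: confined_eq indicator_def)
  also have "\<dots> = emeasure Q (path_good \<kappa> b n \<inter> B)"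
    using inB by simp
  finally have "ennreal (lb * measure seq.S {x \<in> good \<kappa> b n. walk x \<in> B}) \<le> ennreal (measure Q (path_good \<kappa> b n \<inter> B))"
    using lb by (simp add: Q.emeasure_eq_measure seq.P.emeasure_eq_measure ennreal_mult)
  then show ?thesis unfolding lb_def by (subst (asm) ennreal_le_iff) auto
qed

lemma Iex_le_Iex': "Iex v a b u \<le> Iex v' a' b u"
  unfolding Iex_def
  by (intro integral_mono integrable_Iex max.mono order_refl diff_right_mono r_le_r')

text \<open>The three errors in the denominator are the cost of the enlargement, the shift of the
  integrated tail to \<open>- 1 - \<kappa>'' * b\<close>, and the lower bound on the hitting
  probability. The error in the numerator is the mass of hitting paths that are not good.\<close>

lemma approx_law_lower_bound:
  assumes P: "rv_target_pos D \<alpha> v a"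
    and e: "e > 0" and \<kappa>0: "\<kappa>0 > 0" and \<theta>: "0 < \<theta>" "\<theta> < 1" and M: "M > 0"
    and gap: "eventually (\<lambda>b. Iex v' a' b 0 \<le> Iex v a b 0 + e * g b) at_top"
    and missed: "\<And>\<kappa>. \<kappa> > 0 \<Longrightarrow> eventually (\<lambda>b.
        measure seq.S (hit b - (\<Union>n\<in>{n. real n \<le> M * b}. good \<kappa> b n)) \<le> e * g b) at_top"
  shows "\<exists>c \<delta>2 \<gamma>. 0 < c \<and> c < 1 \<and> 1 - \<kappa>0 < c \<and> 0 < \<delta>2 \<and> \<delta>2 < 1 \<and> \<delta>2 < \<kappa>0 \<and> 1 / \<kappa>0 < \<gamma> \<and>
    eventually (\<lambda>b. b > 0 \<and>
      prob_space (approx_law D b \<theta> c \<delta>2 v' a' {y. y \<bullet> eta \<ge> \<gamma>} 0) \<and>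
      sets (approx_law D b \<theta> c \<delta>2 v' a' {y. y \<bullet> eta \<ge> \<gamma>} 0) = sets path_space \<and>
      (\<forall>B\<in>sets path_space.
        \<theta> / (measure seq.S (hit b) + 3 * (e * g b)) * (measure seq.S {x \<in> hit b. walk x \<in> B} - e * g b)
        \<le> measure (approx_law D b \<theta> c \<delta>2 v' a' {y. y \<bullet> eta \<ge> \<gamma>} 0) B)) at_top"
proof -
  interpret P: rv_target_pos D \<alpha> v a by (rule P)
  define L' where "L' = vmax v'"
  have L': "L' > 0" unfolding L'_def by (rule E.L_pos)
  have M_amin: "M + E.amin \<ge> 0" using M E.amin_pos by simp
  obtain cM where cM: "cM > 0" "eventually (\<lambda>b. Iex v a b ((M + E.amin) * b) \<ge> cM * g b) at_top"
    using P.Iex_ge[OF M_amin] by blast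
  obtain cP where cP: "cP > 0" "eventually (\<lambda>b. \<P>(x in D. r b x > (M + E.amin) * b) \<ge> cP * tail b) at_top"
    using P.prob_r_ge[OF M_amin] by blast
  have "E.amin / (2 * L') > 0" using E.amin_pos L' by simp
  then obtain K3 where K3: "K3 > 0" "eventually (\<lambda>b. tail (E.amin / (2 * L') * b) \<le> K3 * tail b) at_top"
    using H_scale_le by blast
  \<comment> \<open>The first bound keeps the shifted levels far above that of the origin; the
    second makes integrated tails whose levels differ by \<open>3 * \<kappa>'' * b\<close>
    comparable up to \<theta>; the third makes the shift at time 0 cost at most
    \<open>e * g b\<close>.\<close>
  define \<kappa>'' where "\<kappa>'' = min (E.amin / 8) (min ((1 - \<theta>) * cM / (3 * K3)) (e / (2 * K3)))"
  have \<kappa>'': "\<kappa>'' > 0" "8 * \<kappa>'' \<le> E.amin" "3 * \<kappa>'' * K3 \<le> (1 - \<theta>) * cM" "2 * \<kappa>'' * K3 \<le> e"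
  proof -
    show "\<kappa>'' > 0" using E.amin_pos \<theta> cM(1) K3(1) e by (simp add: \<kappa>''_def)
    have "\<kappa>'' \<le> E.amin / 8" "\<kappa>'' \<le> (1 - \<theta>) * cM / (3 * K3)" "\<kappa>'' \<le> e / (2 * K3)"
      by (simp_all add: \<kappa>''_def)
    then show "8 * \<kappa>'' \<le> E.amin" "3 * \<kappa>'' * K3 \<le> (1 - \<theta>) * cM" "2 * \<kappa>'' * K3 \<le> e"
      using K3(1) by (simp_all add: pos_le_divide_eq mult_ac)
  qed
  \<comment> \<open>The tube uses at most half of the shift \<open>\<kappa>''\<close>; the other
    half is left for the fraction \<open>c\<close>. The second bound keeps the good events
    disjoint.\<close>
  define \<kappa> where "\<kappa> = min (\<kappa>'' / (2 * L')) (amin / (2 * L))"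
  have \<kappa>: "\<kappa> > 0" "2 * (L' * \<kappa>) \<le> \<kappa>''" "L * \<kappa> < amin"
  proof -
    show "\<kappa> > 0" using \<kappa>''(1) L' amin_pos L_pos by (simp add: \<kappa>_def)
    have "\<kappa> \<le> \<kappa>'' / (2 * L')" "\<kappa> \<le> amin / (2 * L)" by (simp_all add: \<kappa>_def)
    then have "2 * (L' * \<kappa>) \<le> \<kappa>''" "2 * (L * \<kappa>) \<le> amin"
      using L' L_pos by (simp_all add: pos_le_divide_eq mult_ac)
    then show "2 * (L' * \<kappa>) \<le> \<kappa>''" "L * \<kappa> < amin" using amin_pos by simp_all
  qed
  have L\<kappa>: "L' * \<kappa> > 0" using L' \<kappa> by simp
  define A where "A = E.amax + M + \<kappa>''"
  have A: "A > 0"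
    using E.amin_le[of undefined] E.le_amax[of undefined] E.amin_pos M \<kappa>''(1) by (simp add: A_def)
  \<comment> \<open>The missing height up to time \<open>M * b\<close> is at most
    \<open>A * b\<close>, so \<open>c' * A \<le> \<kappa>'' / 2\<close> fits the relaxation of the
    jump set into the second half of the shift.\<close>
  define c' where "c' = min (\<kappa>0 / 2) (min (1 / 2) (\<kappa>'' / (2 * A)))"
  define c where "c = 1 - c'"
  have c': "c' > 0" "c' < 1" "c' < \<kappa>0" "2 * (c' * A) \<le> \<kappa>''"
  proof -
    show "c' > 0" using \<kappa>0 \<kappa>''(1) A by (simp add: c'_def)
    have "c' \<le> \<kappa>0 / 2" "c' \<le> 1 / 2" "c' \<le> \<kappa>'' / (2 * A)" by (simp_all only: c'_def min.cobounded1 min.cobounded2 min.coboundedI2)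
    then show "c' < 1" "c' < \<kappa>0" "2 * (c' * A) \<le> \<kappa>''" using \<kappa>0 A by (simp_all add: pos_le_divide_eq mult_ac)
  qed
  have c: "0 < c" "c < 1" "1 - \<kappa>0 < c" using c' by (simp_all add: c_def)
  have cond: "vmax v' * \<kappa> + (1 - c) * (E.amax + M + vmax v' * \<kappa>) \<le> \<kappa>''"
  proof -
    have "E.amax + M + L' * \<kappa> \<le> A" using \<kappa>(2) L\<kappa> unfolding A_def by linarith
    then have "c' * (E.amax + M + L' * \<kappa>) \<le> c' * A" using c' by (intro mult_left_mono) auto
    then show ?thesis using c'(4) \<kappa>(2) by (simp add: c_def L'_def)
  qed
  define \<delta>2 where "\<delta>2 = min (\<kappa>0 / 2) (min (1 / 2) (E.amin / 2))"
  have \<delta>2: "0 < \<delta>2" "\<delta>2 < 1" "\<delta>2 < \<kappa>0" "\<delta>2 + vmax v' * \<kappa> \<le> E.amin"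
  proof -
    show "0 < \<delta>2" using \<kappa>0 E.amin_pos by (simp add: \<delta>2_def)
    have "\<delta>2 \<le> \<kappa>0 / 2" "\<delta>2 \<le> 1 / 2" "\<delta>2 \<le> E.amin / 2" by (simp_all only: \<delta>2_def min.cobounded1 min.cobounded2 min.coboundedI2)
    then show "\<delta>2 < 1" "\<delta>2 < \<kappa>0" "\<delta>2 + vmax v' * \<kappa> \<le> E.amin"
      using \<kappa>0 \<kappa>(2) \<kappa>''(1,2) unfolding L'_def[symmetric] by linarith+
  qed
  define \<gamma> where "\<gamma> = max (1 / \<kappa>0) (M * (norm (eta :: real^'d))\<^sup>2 + \<kappa> * norm (eta :: real^'d)) + 1"
  have \<gamma>: "1 / \<kappa>0 < \<gamma>" "M * (norm (eta :: real^'d))\<^sup>2 + \<kappa> * norm (eta :: real^'d) < \<gamma>"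
    by (auto simp: \<gamma>_def max_def)
  have "eventually (\<lambda>b. b > 0 \<and>
      prob_space (approx_law D b \<theta> c \<delta>2 v' a' {y. y \<bullet> eta \<ge> \<gamma>} 0) \<and>
      sets (approx_law D b \<theta> c \<delta>2 v' a' {y. y \<bullet> eta \<ge> \<gamma>} 0) = sets path_space \<and>
      (\<forall>B\<in>sets path_space.
        \<theta> / (measure seq.S (hit b) + 3 * (e * g b)) * (measure seq.S {x \<in> hit b. walk x \<in> B} - e * g b)
        \<le> measure (approx_law D b \<theta> c \<delta>2 v' a' {y. y \<bullet> eta \<ge> \<gamma>} 0) B)) at_top"
    using gap missed[OF \<kappa>(1)] prob_hit_ge[OF e] cM(2) cP(2) K3(2) eventually_ge_at_top[of "1 / \<kappa>''"]
      eventually_gt_at_top[of 0]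
  proof eventually_elim
    case (elim b)
    have b: "b > 0" by fact
    have g: "g b > 0" using b by (rule g_pos)
    have \<kappa>b: "1 \<le> \<kappa>'' * b" using elim(7) \<kappa>''(1) by (simp add: field_simps)
    have L\<kappa>b: "0 < L' * \<kappa> * b" "2 * (L' * \<kappa> * b) \<le> \<kappa>'' * b"
    proof -
      show "0 < L' * \<kappa> * b" using L\<kappa> b by (rule mult_pos_pos)
      show "2 * (L' * \<kappa> * b) \<le> \<kappa>'' * b" using mult_right_mono[OF \<kappa>(2), of b] b by linarith
    qed
    define Q where "Q = approx_law D b \<theta> c \<delta>2 v' a' {y. y \<bullet> eta \<ge> \<gamma>} 0"
    have Gm: "dilate b {y :: real^'d. y \<bullet> eta \<ge> \<gamma>} \<in> sets borel"
      unfolding dilate_upper_halfspace[OF b] by measurable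
    have \<theta>0: "\<theta> \<ge> 0" using \<theta> by simp
    have probQ: "prob_space Q" unfolding Q_def by (rule prob_space_approx_law[OF b \<theta>0 Gm])
    have setsQ: "sets Q = sets path_space" unfolding Q_def by (rule sets_approx_law[OF b \<theta>0 Gm])
    have tail_le: "\<P>(x in D. rfun b v' a' x > u) \<le> K3 * tail b" if "u \<ge> - (2 * \<kappa>'' * b)" for u
    proof -
      have "\<P>(x in D. rfun b v' a' x > u) \<le> \<P>(x in D. rfun b v' a' x > - (2 * \<kappa>'' * b))"
        using that by (intro finite_measure_mono) (auto, measurable)
      also have "\<dots> \<le> tail ((E.amin * b - 2 * \<kappa>'' * b) / L')"
        unfolding L'_def using b by (intro E.prob_r_le) simp
      also have "\<dots> \<le> tail (E.amin / (2 * L') * b)"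
      proof (rule H_mono)
        have "8 * \<kappa>'' * b \<le> E.amin * b" using \<kappa>''(2) b by (intro mult_right_mono) auto
        then have "E.amin * b / 2 \<le> E.amin * b - 2 * \<kappa>'' * b" using b \<kappa>''(1) \<kappa>b by linarith
        then have "(E.amin * b / 2) / L' \<le> (E.amin * b - 2 * \<kappa>'' * b) / L'"
          using L' by (intro divide_right_mono) auto
        then show "E.amin / (2 * L') * b \<le> (E.amin * b - 2 * \<kappa>'' * b) / L'" by simp
      qed
      also have "\<dots> \<le> K3 * tail b" by fact
      finally show ?thesis .
    qed
    have I_ge: "cM * g b \<le> Iex v' a' b u" if "u \<le> (M + E.amin) * b" for u
    proof -
      have "cM * g b \<le> Iex v a b ((M + E.amin) * b)" by fact
      also have "\<dots> \<le> Iex v' a' b ((M + E.amin) * b)" by (rule Iex_le_Iex')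
      also have "\<dots> \<le> Iex v' a' b u" using that by (rule Iex_antimono)
      finally show ?thesis .
    qed
    have far: "real k + L' * \<kappa> * b \<le> (M + E.amin) * b" "M * b + L' * \<kappa> * b \<le> (M + E.amin) * b"
      if "real k \<le> M * b" for k
    proof -
      have "\<kappa>'' * b \<le> E.amin * b" using \<kappa>''(1,2) b by (intro mult_right_mono) auto
      then show "real k + L' * \<kappa> * b \<le> (M + E.amin) * b" "M * b + L' * \<kappa> * b \<le> (M + E.amin) * b"
        using that L\<kappa>b by (simp_all add: distrib_right)
    qed
    have Mb: "real 0 \<le> M * b" using M b by simp
    have Ipos: "Iex v' a' b (M * b + vmax v' * \<kappa> * b) > 0"
      using I_ge[OF far(2)[OF Mb]] mult_pos_pos[OF cM(1) g] unfolding L'_def by linarith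
    have pos: "\<P>(x in D. rfun b v' a' x > M * b + vmax v' * \<kappa> * b) > 0"
    proof -
      have "0 < cP * tail b" using cP(1) H_pos by simp
      also have "\<dots> \<le> \<P>(x in D. r b x > (M + E.amin) * b)" by fact
      also have "\<dots> \<le> \<P>(x in D. rfun b v' a' x > M * b + vmax v' * \<kappa> * b)"
      proof (rule finite_measure_mono)
        show "{x \<in> space D. r b x > (M + E.amin) * b} \<subseteq> {x \<in> space D. rfun b v' a' x > M * b + vmax v' * \<kappa> * b}"
        proof safe
          fix x assume "(M + E.amin) * b < r b x"
          then show "M * b + vmax v' * \<kappa> * b < rfun b v' a' x"
            using far(2)[OF Mb] r_le_r'[of b x] unfolding L'_def by linarith
        qed
      qed measurable
      finally show ?thesis .
    qed
    have comparable: "\<theta> * Iex v' a' b (real k - 1 - \<kappa>'' * b) \<le> Iex v' a' b (real k + vmax v' * \<kappa> * b)"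
      if k: "real k \<le> M * b" for k :: nat
    proof -
      define u0 where "u0 = real k - 1 - \<kappa>'' * b"
      define u1 where "u1 = real k + L' * \<kappa> * b"
      have u: "u0 \<le> u1" "u1 - u0 \<le> 3 * \<kappa>'' * b" "u0 \<ge> - (2 * \<kappa>'' * b)"
        using \<kappa>b L\<kappa>b by (simp_all add: u0_def u1_def)
      have "Iex v' a' b u0 - Iex v' a' b u1 \<le> (u1 - u0) * \<P>(x in D. rfun b v' a' x > u0)"
        by (rule Iex_diff_le[OF u(1)])
      also have "\<dots> \<le> (3 * \<kappa>'' * b) * (K3 * tail b)"
        using u tail_le[OF u(3)] \<kappa>b by (intro mult_mono) auto
      also have "\<dots> = (3 * \<kappa>'' * K3) * g b" by (simp add: g_def)
      also have "\<dots> \<le> (1 - \<theta>) * cM * g b" using \<kappa>''(3) g by (intro mult_right_mono) auto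
      also have "\<dots> = (1 - \<theta>) * (cM * g b)" by simp
      also have "\<dots> \<le> (1 - \<theta>) * Iex v' a' b u1"
        using I_ge[OF far(1)[OF k]] \<theta> unfolding u1_def by (intro mult_left_mono) auto
      finally have "Iex v' a' b u0 \<le> (2 - \<theta>) * Iex v' a' b u1" by (simp add: algebra_simps)
      \<comment> \<open>A relative difference of \<open>1 - \<theta>\<close> is compensated by the
        factor \<theta>, because \<open>\<theta> * (2 - \<theta>)\<close> is 1 minus a
        square.\<close>
      then have "\<theta> * Iex v' a' b u0 \<le> \<theta> * ((2 - \<theta>) * Iex v' a' b u1)"
        using \<theta> by (intro mult_left_mono) auto
      also have "\<dots> = (1 - (1 - \<theta>)\<^sup>2) * Iex v' a' b u1"
        by (simp add: power2_eq_square algebra_simps)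
      also have "\<dots> \<le> 1 * Iex v' a' b u1"
        by (intro mult_right_mono Iex_nonneg) simp
      finally show ?thesis by (simp add: u0_def u1_def L'_def)
    qed
    define J where "J = Iex v' a' b (- 1 - \<kappa>'' * b)"
    \<comment> \<open>For \<open>1 \<le> \<kappa>'' * b\<close> the level is shifted by at most
      \<open>2 * \<kappa>'' * b\<close>; the cost of the enlargement and the lower bound on the
      hitting probability supply the other two error terms.\<close>
    have J_le: "J \<le> measure seq.S (hit b) + 3 * (e * g b)"
    proof -
      have "J - Iex v' a' b 0 \<le> (0 - (- 1 - \<kappa>'' * b)) * \<P>(x in D. rfun b v' a' x > - 1 - \<kappa>'' * b)"
        unfolding J_def using \<kappa>b by (intro Iex_diff_le) simp
      also have "\<dots> \<le> (2 * \<kappa>'' * b) * (K3 * tail b)"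
        using \<kappa>b by (intro mult_mono tail_le) auto
      also have "\<dots> = (2 * \<kappa>'' * K3) * g b" by (simp add: g_def)
      also have "\<dots> \<le> e * g b" using \<kappa>''(4) g by (intro mult_right_mono) auto
      finally show ?thesis using elim(1,3) by simp
    qed
    have J_pos: "J > 0"
    proof -
      have "- 1 - \<kappa>'' * b \<le> M * b + vmax v' * \<kappa> * b"
      proof -
        have "0 \<le> M * b" using M b by simp
        then show ?thesis using \<kappa>b L\<kappa>b(1) unfolding L'_def by linarith
      qed
      then have "Iex v' a' b (M * b + vmax v' * \<kappa> * b) \<le> J"
        unfolding J_def by (rule Iex_antimono)
      with Ipos show ?thesis by linarith
    qed
    have "\<theta> / (measure seq.S (hit b) + 3 * (e * g b)) * (measure seq.S {x \<in> hit b. walk x \<in> B} - e * g b) \<le> measure Q B"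
      if B: "B \<in> sets path_space" for B
    proof (cases "measure seq.S {x \<in> hit b. walk x \<in> B} \<le> e * g b")
      \<comment> \<open>The left side is nonpositive here. In the other case the difference is
        positive, so the denominator may be replaced by the smaller \<open>J\<close>.\<close>
      case True
      then have "\<theta> / (measure seq.S (hit b) + 3 * (e * g b)) * (measure seq.S {x \<in> hit b. walk x \<in> B} - e * g b) \<le> 0"
        using \<theta> e g by (intro mult_nonneg_nonpos divide_nonneg_nonneg add_nonneg_nonneg) auto
      also have "0 \<le> measure Q B" by simp
      finally show ?thesis .
    next
      case False
      interpret Q: prob_space Q by (rule probQ)
      define N where "N = nat \<lfloor>M * b\<rfloor>"
      have N: "real n \<le> M * b \<longleftrightarrow> n \<le> N" for n
        using Mb unfolding N_def by (intro real_le_iff_le_nat_floor) simp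
      have Bm: "walk -` B \<inter> space seq.S \<in> sets seq.S"
        by (rule measurable_sets[OF measurable_walk_path B])
      have Xm: "{x \<in> X. walk x \<in> B} \<in> sets seq.S" if "X \<in> sets seq.S" for X
      proof -
        have "{x \<in> X. walk x \<in> B} = X \<inter> (walk -` B \<inter> space seq.S)" by auto
        then show ?thesis using that Bm by simp
      qed
      let ?U = "\<Union>n\<in>{n. real n \<le> M * b}. good \<kappa> b n"
      have "{x \<in> hit b. walk x \<in> B} \<subseteq> (hit b - ?U) \<union> (\<Union>n\<in>{..N}. {x \<in> good \<kappa> b n. walk x \<in> B})"
        by (auto simp: N)
      then have "measure seq.S {x \<in> hit b. walk x \<in> B} \<le> measure seq.S ((hit b - ?U) \<union> (\<Union>n\<in>{..N}. {x \<in> good \<kappa> b n. walk x \<in> B}))"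
        by (intro seq.P.finite_measure_mono sets.Un sets.Diff sets.countable_UN' sets.finite_UN Xm sets_hit sets_good) auto
      also have "\<dots> \<le> measure seq.S (hit b - ?U) + measure seq.S (\<Union>n\<in>{..N}. {x \<in> good \<kappa> b n. walk x \<in> B})"
        by (intro measure_Un_le sets.Diff sets.countable_UN' sets.finite_UN Xm sets_hit sets_good) auto
      also have "measure seq.S (\<Union>n\<in>{..N}. {x \<in> good \<kappa> b n. walk x \<in> B}) \<le> (\<Sum>n\<le>N. measure seq.S {x \<in> good \<kappa> b n. walk x \<in> B})"
        by (intro measure_UNION_le Xm sets_good) auto
      finally have s: "measure seq.S {x \<in> hit b. walk x \<in> B} - e * g b \<le> (\<Sum>n\<le>N. measure seq.S {x \<in> good \<kappa> b n. walk x \<in> B})"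
        using elim(2) by simp
      have "\<theta> / (measure seq.S (hit b) + 3 * (e * g b)) * (measure seq.S {x \<in> hit b. walk x \<in> B} - e * g b)
        \<le> \<theta> / J * (measure seq.S {x \<in> hit b. walk x \<in> B} - e * g b)"
        using J_le J_pos \<theta> False by (intro mult_right_mono divide_left_mono mult_pos_pos) auto
      also have "\<dots> \<le> \<theta> / J * (\<Sum>n\<le>N. measure seq.S {x \<in> good \<kappa> b n. walk x \<in> B})"
        using s \<theta> J_pos by (intro mult_left_mono) auto
      also have "\<dots> \<le> (\<Sum>n\<le>N. measure Q (path_good \<kappa> b n \<inter> B))"
        unfolding sum_distrib_left
      proof (rule sum_mono)
        fix n assume "n \<in> {..N}"
        then have n: "real n \<le> M * b" by (simp add: N)
        have \<kappa>0': "0 \<le> \<kappa>" "M \<ge> 0" using \<kappa>(1) M by simp_all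
        show "\<theta> / J * measure seq.S {x \<in> good \<kappa> b n. walk x \<in> B} \<le> measure Q (path_good \<kappa> b n \<inter> B)"
          unfolding J_def Q_def
          by (rule approx_law_path_good_ge[OF b \<theta> c(1,2) \<kappa>0'(1) \<delta>2(4,1) \<kappa>0'(2) cond pos comparable Ipos \<gamma>(2) n B])
      qed
      also have "\<dots> = measure Q (\<Union>n\<in>{..N}. path_good \<kappa> b n \<inter> B)"
      proof (rule Q.finite_measure_finite_Union[symmetric])
        show "disjoint_family_on (\<lambda>n. path_good \<kappa> b n \<inter> B) {..N}"
          using disjoint_path_good[OF b \<kappa>(3)] unfolding disjoint_family_on_def by blast
        show "(\<lambda>n. path_good \<kappa> b n \<inter> B) ` {..N} \<subseteq> sets Q"
          using sets_path_good B by (auto simp: setsQ)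
      qed simp
      also have "\<dots> \<le> measure Q B"
        using B by (intro Q.finite_measure_mono) (auto simp: setsQ)
      finally show ?thesis .
    qed
    then show ?case using b probQ setsQ unfolding Q_def by blast
  qed
  with c \<delta>2 \<gamma>(1) show ?thesis by blast
qed

end

text \<open>The three errors in the denominator amount to at most \<open>\<epsilon> / 3 * p\<close>,
  and \<open>(1 - 2 * \<epsilon> / 3) * (1 + \<epsilon> / 3) \<le> 1 - \<epsilon> / 3\<close>. So
  the coefficient of \<open>m - d\<close> is at least \<open>(1 - 2 * \<epsilon> / 3) / p\<close>,
  and the total loss is at most \<open>2 * \<epsilon> / 3 + \<epsilon> / 9\<close>.\<close>

lemma conditional_ratio_le:
  fixes m p q \<theta> \<epsilon> d :: real
  assumes p: "p > 0" and m: "0 \<le> m" "m \<le> p" and \<epsilon>: "0 < \<epsilon>" "\<epsilon> \<le> 1" and \<theta>: "1 - \<epsilon> / 3 \<le> \<theta>"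
    and d: "0 \<le> d" "d \<le> \<epsilon> / 9 * p" and q: "0 \<le> q" "\<theta> / (p + 3 * d) * (m - d) \<le> q"
  shows "m / p - q \<le> \<epsilon>"
proof (cases "m \<le> d")
  case True
  then have "m / p \<le> \<epsilon> / 9" using d p by (simp add: pos_divide_le_eq)
  then show ?thesis using q \<epsilon> by linarith
next
  case False
  have "(1 - 2 * \<epsilon> / 3) * (p + 3 * d) \<le> \<theta> * p"
  proof -
    have "(1 - 2 * \<epsilon> / 3) * (p + 3 * d) \<le> (1 - 2 * \<epsilon> / 3) * (p + \<epsilon> / 3 * p)"
      using d \<epsilon> by (intro mult_left_mono) auto
    also have "\<dots> = ((1 - 2 * \<epsilon> / 3) * (1 + \<epsilon> / 3)) * p" by (simp add: algebra_simps)
    also have "\<dots> \<le> (1 - \<epsilon> / 3) * p"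
      using p \<epsilon> by (intro mult_right_mono) (auto simp: field_simps)
    also have "\<dots> \<le> \<theta> * p" using \<theta> p by (intro mult_right_mono) auto
    finally show ?thesis .
  qed
  then have "(1 - 2 * \<epsilon> / 3) / p \<le> \<theta> / (p + 3 * d)"
    using p d by (simp add: frac_le_eq divide_le_eq le_divide_eq mult.commute)
  then have "(1 - 2 * \<epsilon> / 3) / p * (m - d) \<le> q"
    using q(2) False by (meson diff_ge_0_iff_ge less_imp_le mult_right_mono not_le order_trans)
  moreover have "(1 - 2 * \<epsilon> / 3) / p * (m - d) = m / p - d / p - 2 * \<epsilon> / 3 * ((m - d) / p)"
    using p by (simp add: field_simps)
  moreover have "d / p \<le> \<epsilon> / 9" using d p by (simp add: pos_divide_le_eq)
  moreover have "2 * \<epsilon> / 3 * ((m - d) / p) \<le> 2 * \<epsilon> / 3 * 1"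
    using m d p \<epsilon> by (intro mult_left_mono) (auto simp: pos_divide_le_eq)
  ultimately show ?thesis using \<epsilon> by linarith
qed

text \<open>The arbitrary \<kappa> renders "sufficiently close" and "sufficiently large": parameters
  exist within every prescribed distance of their limits. The bound variable \<open>c\<close> is the
  fraction in the jump sets, as \<open>a\<close> denotes the levels.\<close>

theorem theorem1:
  fixes D :: "(real^'d) measure"
    and \<alpha> :: real
    and \<mu> :: "(ereal^'d) measure"
    and v :: "'m::finite \<Rightarrow> real^'d"
    and a :: "'m \<Rightarrow> real"
  assumes "prob_space D" and "sets D = sets borel"
    and continuous_dist: "\<And>x. measure D {x} = 0"
    and mean: "integrable D (\<lambda>x. x)" "(\<integral>x. x \<partial>D) = eta"
    and "\<alpha> > 1"
    and "mv_regularly_varying D \<alpha> \<mu>"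
    and "\<And>j. eta \<bullet> v j = - 1"
    and "\<And>j. a j > 0"
    and "emeasure \<mu> (emb ` halfspaces v a) > 0"
  shows "\<forall>\<epsilon>>0. \<forall>\<kappa>>0.
    \<exists>\<theta> c \<delta> \<delta>2 \<beta> \<gamma> b0.
      {\<theta>, c, \<delta>, \<delta>2} \<subseteq> {0<..<1} \<and> 1 - \<kappa> < \<theta> \<and> 1 - \<kappa> < c \<and> \<delta> < \<kappa> \<and> \<delta>2 < \<kappa> \<and>
      1 / \<kappa> < \<beta> \<and> 1 / \<kappa> < \<gamma> \<and> 1 / \<kappa> < b0 \<and>
      (\<forall>b\<ge>b0.
        (SUP B\<in>sets (path_space :: (nat \<Rightarrow> real^'d) measure).
          \<bar>measure (approx_law D b \<theta> c \<delta>2 (enlarged_normals \<delta> v) (enlarged_levels \<beta> a)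
              {y. y \<bullet> eta \<ge> \<gamma>} 0) B
           - measure (cond_walk_law D (dilate b (halfspaces v a)) 0) B\<bar>) \<le> \<epsilon>)"
proof (intro allI impI)
  fix \<epsilon> \<kappa> :: real assume \<epsilon>: "\<epsilon> > 0" and \<kappa>: "\<kappa> > 0"
  interpret T: rv_target D \<alpha> v a
    using assms regvar_tail_of_mv_regularly_varying[OF assms(1,2) \<open>\<alpha> > 1\<close> \<open>mv_regularly_varying D \<alpha> \<mu>\<close>]
    by (intro rv_target.intro rv_increments.intro rv_increments_axioms.intro rv_target_axioms.intro)
  have P: "rv_target_pos D \<alpha> v a"
    using T.target_prob_ge[OF assms(7,10)]
    by (intro rv_target_pos.intro rv_target_pos_axioms.intro T.rv_target_axioms)
  interpret P: rv_target_pos D \<alpha> v a by (rule P)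
  obtain c1 where c1: "c1 > 0" "eventually (\<lambda>b. T.Iex v a b (0 * b) \<ge> c1 * T.g b) at_top"
    using P.Iex_ge[of 0] by auto
  define \<epsilon>' where "\<epsilon>' = min \<epsilon> 1"
  have \<epsilon>': "0 < \<epsilon>'" "\<epsilon>' \<le> 1" "\<epsilon>' \<le> \<epsilon>" using \<epsilon> by (auto simp: \<epsilon>'_def)
  \<comment> \<open>The hitting probability is at least \<open>c1 / 2 * g b\<close>, so
    \<open>e * g b\<close> is at most \<open>\<epsilon>' / 9\<close> times it, as
    \<open>conditional_ratio_le\<close> requires.\<close>
  define e where "e = c1 * \<epsilon>' / 18"
  have e: "e > 0" "e \<le> c1 / 2" using c1(1) \<epsilon>' by (auto simp: e_def)
  define \<theta> where "\<theta> = 1 - min (\<kappa> / 2) (\<epsilon>' / 3)"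
  have \<theta>: "0 < \<theta>" "\<theta> < 1" "1 - \<kappa> < \<theta>" "1 - \<epsilon>' / 3 \<le> \<theta>"
    using \<kappa> \<epsilon>' by (auto simp: \<theta>_def min_def)
  obtain M where M: "M > 0" "\<And>\<kappa>. \<kappa> > 0 \<Longrightarrow> eventually (\<lambda>b.
      measure T.seq.S (T.hit b - (\<Union>n\<in>{n. real n \<le> M * b}. T.good \<kappa> b n)) \<le> e * T.g b) at_top"
    using T.prob_hit_diff_good_le[OF e(1)] by blast
  obtain \<delta>0 \<beta>0 where \<delta>\<beta>: "\<delta>0 > 0" "\<beta>0 > 0"
    and gap0: "\<And>\<delta> \<beta>. 0 < \<delta> \<Longrightarrow> \<delta> \<le> \<delta>0 \<Longrightarrow> \<beta>0 \<le> \<beta> \<Longrightarrow> eventually (\<lambda>b.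
      T.Iex (enlarged_normals \<delta> v) (enlarged_levels \<beta> a) b 0 \<le> T.Iex v a b 0 + e * T.g b) at_top"
    using T.Iex_enlarged_le[OF e(1)] by blast
  define \<delta> where "\<delta> = min \<delta>0 (min (\<kappa> / 2) (1 / 2))"
  have \<delta>: "0 < \<delta>" "\<delta> < 1" "\<delta> < \<kappa>" "\<delta> \<le> \<delta>0" using \<delta>\<beta> \<kappa> by (auto simp: \<delta>_def min_def)
  define \<beta> where "\<beta> = max \<beta>0 (1 / \<kappa> + 1)"
  have \<beta>: "0 < \<beta>" "1 / \<kappa> < \<beta>" "\<beta>0 \<le> \<beta>" using \<delta>\<beta>(2) by (auto simp: \<beta>_def max_def)
  let ?v = "enlarged_normals \<delta> v" and ?a = "enlarged_levels \<beta> a :: 'm + 'm + 'd \<Rightarrow> real"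
  interpret E: rv_enlarged D \<alpha> v a ?v ?a
    using T.rv_target_enlarged[OF \<delta>(1,2) \<beta>(1)] T.rfun_enlarged_ge T.rv_target_axioms
    by (intro rv_enlarged.intro rv_enlarged_axioms.intro)
  obtain c \<delta>2 \<gamma> where par: "0 < c" "c < 1" "1 - \<kappa> < c" "0 < \<delta>2" "\<delta>2 < 1" "\<delta>2 < \<kappa>" "1 / \<kappa> < \<gamma>"
    and ev: "eventually (\<lambda>b. b > 0 \<and>
      prob_space (approx_law D b \<theta> c \<delta>2 ?v ?a {y. y \<bullet> eta \<ge> \<gamma>} 0) \<and>
      sets (approx_law D b \<theta> c \<delta>2 ?v ?a {y. y \<bullet> eta \<ge> \<gamma>} 0) = sets path_space \<and>
      (\<forall>B\<in>sets path_space.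
        \<theta> / (measure T.seq.S (T.hit b) + 3 * (e * T.g b)) * (measure T.seq.S {x \<in> T.hit b. T.walk x \<in> B} - e * T.g b)
        \<le> measure (approx_law D b \<theta> c \<delta>2 ?v ?a {y. y \<bullet> eta \<ge> \<gamma>} 0) B)) at_top"
    using E.approx_law_lower_bound[OF P e(1) \<kappa> \<theta>(1,2) M(1) gap0[OF \<delta>(1,4) \<beta>(3)] M(2)] by blast
  have "eventually (\<lambda>b. (SUP B\<in>sets (path_space :: (nat \<Rightarrow> real^'d) measure).
      \<bar>measure (approx_law D b \<theta> c \<delta>2 ?v ?a {y. y \<bullet> eta \<ge> \<gamma>} 0) B
       - measure (cond_walk_law D (dilate b (halfspaces v a)) 0) B\<bar>) \<le> \<epsilon>) at_top"
    using ev c1(2) T.prob_hit_ge[OF e(1)]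
  proof eventually_elim
    case (elim b)
    let ?Q = "approx_law D b \<theta> c \<delta>2 ?v ?a {y. y \<bullet> eta \<ge> \<gamma>} 0"
    let ?C = "cond_walk_law D (dilate b (halfspaces v a)) 0"
    let ?p = "measure T.seq.S (T.hit b)"
    have b: "b > 0" using elim(1) by blast
    have g: "T.g b > 0" using b by (rule T.g_pos)
    have "c1 / 2 * T.g b \<le> (c1 - e) * T.g b" using e g by (intro mult_right_mono) auto
    also have "\<dots> \<le> ?p" using elim(2,3) by (simp add: left_diff_distrib)
    finally have p_ge: "c1 / 2 * T.g b \<le> ?p" .
    then have p: "?p > 0" using c1(1) g by (meson half_gt_zero less_le_trans mult_pos_pos)
    have eg: "0 \<le> e * T.g b" "e * T.g b \<le> \<epsilon>' / 9 * ?p"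
    proof -
      show "0 \<le> e * T.g b" using e g by simp
      have "e * T.g b = \<epsilon>' / 9 * (c1 / 2 * T.g b)" by (simp add: e_def)
      also have "\<dots> \<le> \<epsilon>' / 9 * ?p" using p_ge \<epsilon>' by (intro mult_left_mono) auto
      finally show "e * T.g b \<le> \<epsilon>' / 9 * ?p" .
    qed
    interpret Q: prob_space ?Q using elim(1) by blast
    interpret C: prob_space ?C by (rule T.measure_cond_walk_law(2)[OF b p sets.empty_sets])
    have setsQ: "sets ?Q = sets path_space" using elim(1) by blast
    have setsC: "sets ?C = sets (path_space :: (nat \<Rightarrow> real^'d) measure)"
      by (rule T.measure_cond_walk_law(3)[OF b p sets.empty_sets])
    have one_sided: "measure ?C B - measure ?Q B \<le> \<epsilon>'" if B: "B \<in> sets path_space" for B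
    proof -
      have "measure T.seq.S {x \<in> T.hit b. T.walk x \<in> B} \<le> ?p"
        by (intro T.seq.P.finite_measure_mono) (auto simp del: T.space_S)
      then show ?thesis
        unfolding T.measure_cond_walk_law(1)[OF b p B]
        using elim(1) B eg \<theta>(4) \<epsilon>' p
        by (intro conditional_ratio_le[where \<theta> = \<theta> and d = "e * T.g b"]) auto
    qed
    have "\<bar>measure ?Q B - measure ?C B\<bar> \<le> \<epsilon>" if B: "B \<in> sets path_space" for B
    proof -
      have spaces: "space ?Q = space path_space" "space ?C = space path_space"
        using sets_eq_imp_space_eq[OF setsQ] sets_eq_imp_space_eq[OF setsC] by simp_all
      \<comment> \<open>Both laws have total mass 1, so the one-sided bound for the complement is
        the reverse bound for \<open>B\<close>.\<close>
      have "measure ?C (space path_space - B) - measure ?Q (space path_space - B) \<le> \<epsilon>'"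
        using B by (intro one_sided) auto
      moreover have "measure ?C (space path_space - B) = 1 - measure ?C B"
        using C.prob_compl[of B] B by (simp add: setsC spaces)
      moreover have "measure ?Q (space path_space - B) = 1 - measure ?Q B"
        using Q.prob_compl[of B] B by (simp add: setsQ spaces)
      ultimately show ?thesis using one_sided[OF B] \<epsilon>'(3) by linarith
    qed
    then show ?case
      by (intro cSUP_least) auto
  qed
  then obtain b1 where b1: "\<And>b. b \<ge> b1 \<Longrightarrow> (SUP B\<in>sets (path_space :: (nat \<Rightarrow> real^'d) measure).
      \<bar>measure (approx_law D b \<theta> c \<delta>2 ?v ?a {y. y \<bullet> eta \<ge> \<gamma>} 0) B
       - measure (cond_walk_law D (dilate b (halfspaces v a)) 0) B\<bar>) \<le> \<epsilon>"
    unfolding eventually_at_top_linorder by blast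
  define b0 where "b0 = max b1 (1 / \<kappa> + 1)"
  have b0: "1 / \<kappa> < b0" "b1 \<le> b0" by (auto simp: b0_def max_def)
  show "\<exists>\<theta> c \<delta> \<delta>2 \<beta> \<gamma> b0.
      {\<theta>, c, \<delta>, \<delta>2} \<subseteq> {0<..<1} \<and> 1 - \<kappa> < \<theta> \<and> 1 - \<kappa> < c \<and> \<delta> < \<kappa> \<and> \<delta>2 < \<kappa> \<and>
      1 / \<kappa> < \<beta> \<and> 1 / \<kappa> < \<gamma> \<and> 1 / \<kappa> < b0 \<and>
      (\<forall>b\<ge>b0.
        (SUP B\<in>sets (path_space :: (nat \<Rightarrow> real^'d) measure).
          \<bar>measure (approx_law D b \<theta> c \<delta>2 (enlarged_normals \<delta> v) (enlarged_levels \<beta> a)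
              {y. y \<bullet> eta \<ge> \<gamma>} 0) B
           - measure (cond_walk_law D (dilate b (halfspaces v a)) 0) B\<bar>) \<le> \<epsilon>)"
  proof (intro exI conjI allI impI)
    show "{\<theta>, c, \<delta>, \<delta>2} \<subseteq> {0<..<1}" using \<theta> par \<delta> by simp
    fix b assume "b0 \<le> b"
    then show "(SUP B\<in>sets (path_space :: (nat \<Rightarrow> real^'d) measure).
          \<bar>measure (approx_law D b \<theta> c \<delta>2 (enlarged_normals \<delta> v) (enlarged_levels \<beta> a)
              {y. y \<bullet> eta \<ge> \<gamma>} 0) B
           - measure (cond_walk_law D (dilate b (halfspaces v a)) 0) B\<bar>) \<le> \<epsilon>"
      using b0(2) by (intro b1) simp
  qed (use \<theta> par \<delta> \<beta> b0 in simp_all)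
qed

end
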